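(* Let $\Gamma$ be a connected, $k$-regular, irreducible, well-covered, and co-well-covered CIS graph. If $k\leq 7$ then $\Gamma$ is either a complete graph or isomorphic to one of $L(K_{3,3})$, $L(K_{4,4})$, $C_4[K_2]$, $K_{3,3}[K_2]$ or $Q_n$ for some $n\geq 4$.
   Context: All graphs are finite, simple and undirected (with non-empty vertex set). A clique (respectively, stable set) is a set of pairwise adjacent (respectively, pairwise non-adjacent) vertices; "maximal" means maximal with respect to inclusion. A graph is CIS if every maximal stable set and every maximal clique have non-empty intersection. A graph is well-covered if all its maximal stable sets have the same size, and co-well-covered if its complement is well-covered (equivalently, all its maximal cliques have the same size). A graph is irreducible if no two distinct vertices have the same (open) neighborhood. $K_n$, $C_n$ are the complete graph and the cycle of order $n$, $K_{m,n}$ is the complete bipartite graph with parts of sizes $m$ and $n$. $L(\Gamma)$ is the line graph of $\Gamma$: its vertices are the edges of $\Gamma$, two distinct edges being adjacent if and only if they share an endpoint. The lexicographic product $\Gamma_1[\Gamma_2]$ has vertex set $V(\Gamma_1)\times V(\Gamma_2)$, with $(u,x)$ and $(v,y)$ adjacent if and only if either $\{u,v\}\in E(\Gamma_1)$, or $u=v$ and $\{x,y\}\in E(\Gamma_2)$. For $n\geq 3$, $Q_n$ is the graph with vertex set $\mathbb{Z}_n\times\mathbb{Z}_2\times\mathbb{Z}_2$ whose edges are: all pairs $\{(i,x,y),(i+1,y,z)\}$ with $i\in\mathbb{Z}_n$, $x,y,z\in\mathbb{Z}_2$; and all pairs $\{(i,x,y),(i,u,v)\}$ with $i\in\mathbb{Z}_n$,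 $x,y,u,v\in\mathbb{Z}_2$, $(x,y)\neq(u,v)$. *)

theory Defs
  imports "Graph_Theory.Graph_Theory"
begin

text \<open>
  A finite simple undirected graph is a \<^verbatim>\<open>pair_graph\<close>: every edge uv is represented by the two
  arcs (u,v) and (v,u). Non-emptiness of the vertex set is part of the library's
  \<^verbatim>\<open>connected\<close>.
\<close>

definition neighborhood :: "'a pair_pre_digraph \<Rightarrow> 'a \<Rightarrow> 'a set" where
  "neighborhood G v = {w. (v, w) \<in> parcs G}"

definition regular_graph :: "nat \<Rightarrow> 'a pair_pre_digraph \<Rightarrow> bool" where
  "regular_graph k G \<longleftrightarrow> (\<forall>v\<in>pverts G. card (neighborhood G v) = k)"

definition irreducible_graph :: "'a pair_pre_digraph \<Rightarrow> bool" where
  "irreducible_graph G \<longleftrightarrow>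
     (\<forall>u\<in>pverts G. \<forall>v\<in>pverts G. u \<noteq> v \<longrightarrow> neighborhood G u \<noteq> neighborhood G v)"

definition clique :: "'a pair_pre_digraph \<Rightarrow> 'a set \<Rightarrow> bool" where
  "clique G C \<longleftrightarrow> C \<subseteq> pverts G \<and> (\<forall>u\<in>C. \<forall>v\<in>C. u \<noteq> v \<longrightarrow> (u, v) \<in> parcs G)"

definition stable_set :: "'a pair_pre_digraph \<Rightarrow> 'a set \<Rightarrow> bool" where
  "stable_set G S \<longleftrightarrow> S \<subseteq> pverts G \<and> (\<forall>u\<in>S. \<forall>v\<in>S. (u, v) \<notin> parcs G)"

definition maximal_clique :: "'a pair_pre_digraph \<Rightarrow> 'a set \<Rightarrow> bool" where
  "maximal_clique G C \<longleftrightarrow> clique G C \<and> (\<forall>D. clique G D \<and> C \<subseteq> D \<longrightarrow> D = C)"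

definition maximal_stable_set :: "'a pair_pre_digraph \<Rightarrow> 'a set \<Rightarrow> bool" where
  "maximal_stable_set G S \<longleftrightarrow> stable_set G S \<and> (\<forall>T. stable_set G T \<and> S \<subseteq> T \<longrightarrow> T = S)"

definition CIS :: "'a pair_pre_digraph \<Rightarrow> bool" where
  "CIS G \<longleftrightarrow> (\<forall>S C. maximal_stable_set G S \<and> maximal_clique G C \<longrightarrow> S \<inter> C \<noteq> {})"

definition graph_complement :: "'a pair_pre_digraph \<Rightarrow> 'a pair_pre_digraph" where
  "graph_complement G =
     \<lparr> pverts = pverts G,
       parcs = {(u, v). u \<in> pverts G \<and> v \<in> pverts G \<and> u \<noteq> v \<and> (u, v) \<notin> parcs G} \<rparr>"

definition well_covered :: "'a pair_pre_digraph \<Rightarrow> bool" where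
  "well_covered G \<longleftrightarrow>
     (\<forall>S T. maximal_stable_set G S \<and> maximal_stable_set G T \<longrightarrow> card S = card T)"

definition co_well_covered :: "'a pair_pre_digraph \<Rightarrow> bool" where
  "co_well_covered G \<longleftrightarrow> well_covered (graph_complement G)"

definition complete_graph :: "nat \<Rightarrow> nat pair_pre_digraph" where
  "complete_graph n = \<lparr> pverts = {..<n}, parcs = {(u, v). u < n \<and> v < n \<and> u \<noteq> v} \<rparr>"

definition complete_bipartite_graph :: "nat \<Rightarrow> nat \<Rightarrow> (nat + nat) pair_pre_digraph" where
  "complete_bipartite_graph m n =
     \<lparr> pverts = Inl ` {..<m} \<union> Inr ` {..<n},
       parcs = (Inl ` {..<m}) \<times> (Inr ` {..<n}) \<union> (Inr ` {..<n}) \<times> (Inl ` {..<m}) \<rparr>"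

text \<open>A cycle only for n at least 3; for n = 1 this is a loop.\<close>

definition cycle_graph :: "nat \<Rightarrow> nat pair_pre_digraph" where
  "cycle_graph n =
     \<lparr> pverts = {..<n},
       parcs = {(i, j). i < n \<and> j < n \<and> (j = Suc i mod n \<or> i = Suc j mod n)} \<rparr>"

definition undirected_edges :: "'a pair_pre_digraph \<Rightarrow> 'a set set" where
  "undirected_edges G = {{u, v} | u v. (u, v) \<in> parcs G}"

definition line_graph :: "'a pair_pre_digraph \<Rightarrow> 'a set pair_pre_digraph" where
  "line_graph G =
     \<lparr> pverts = undirected_edges G,
       parcs = {(e, f). e \<in> undirected_edges G \<and> f \<in> undirected_edges G \<and> e \<noteq> f \<and> e \<inter> f \<noteq> {}} \<rparr>"

definition lex_product ::
    "'a pair_pre_digraph \<Rightarrow> 'b pair_pre_digraph \<Rightarrow> ('a \<times> 'b) pair_pre_digraph" where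
  "lex_product G H =
     \<lparr> pverts = pverts G \<times> pverts H,
       parcs = {((u, x), (v, y)) | u x v y.
                  (u, x) \<in> pverts G \<times> pverts H \<and> (v, y) \<in> pverts G \<times> pverts H \<and>
                  ((u, v) \<in> parcs G \<or> u = v \<and> (x, y) \<in> parcs H)} \<rparr>"

text \<open>
  Residues modulo n and modulo 2 are represented by the numbers below n and below 2. The graph is
  used for n at least 3.
\<close>

definition Q_graph :: "nat \<Rightarrow> (nat \<times> nat \<times> nat) pair_pre_digraph" where
  "Q_graph n =
     (let A = {((i, x, y), (Suc i mod n, y, z)) | i x y z. i < n \<and> x < 2 \<and> y < 2 \<and> z < 2};
          B = {((i, x, y), (i, u, v)) | i x y u v.
                 i < n \<and> x < 2 \<and> y < 2 \<and> u < 2 \<and> v < 2 \<and> (x, y) \<noteq> (u, v)}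
      in \<lparr> pverts = {..<n} \<times> {..<2} \<times> {..<2}, parcs = A \<union> A\<inverse> \<union> B \<rparr>)"

abbreviation graph_iso :: "'a pair_pre_digraph \<Rightarrow> 'b pair_pre_digraph \<Rightarrow> bool" where
  "graph_iso G H \<equiv> digraph_iso (with_proj G) (with_proj H)"

text \<open>
  The library's isomorphism of digraphs also maps arcs; on graphs represented by pairs it is an
  adjacency-preserving bijection of the vertex sets.
\<close>

lemma graph_iso_iff:
  assumes "pair_wf_digraph G" "pair_wf_digraph H"
  shows "graph_iso G H \<longleftrightarrow>
    (\<exists>f. bij_betw f (pverts G) (pverts H) \<and>
         (\<forall>u\<in>pverts G. \<forall>v\<in>pverts G. (u, v) \<in> parcs G \<longleftrightarrow> (f u, f v) \<in> parcs H))"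
    (is "?L \<longleftrightarrow> ?R")
proof
  assume ?L
  then obtain h where h: "pre_digraph.digraph_isomorphism (with_proj G) h"
    and H: "with_proj H = app_iso h (with_proj G)"
    unfolding digraph_iso_def by blast
  define f where "f = iso_verts h"
  have V: "pverts H = f ` pverts G"
    using arg_cong[OF H, of verts] by (simp add: f_def)
  have A: "parcs H = iso_arcs h ` parcs G"
    using arg_cong[OF H, of arcs] by simp
  have T: "iso_tail h = fst" "iso_head h = snd"
    using arg_cong[OF H, of tail] arg_cong[OF H, of head] by simp_all
  have inj: "inj_on f (pverts G)"
    using h by (simp add: pre_digraph.digraph_isomorphism_def f_def)
  have eq: "iso_arcs h (u, v) = (f u, f v)" if "(u, v) \<in> parcs G" for u v
  proof -
    have "\<forall>a\<in>parcs G. f (fst a) = fst (iso_arcs h a) \<and> f (snd a) = snd (iso_arcs h a)"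
      using h by (simp add: pre_digraph.digraph_isomorphism_def f_def T)
    from bspec[OF this that] show ?thesis by (simp add: prod_eq_iff)
  qed
  have "(u, v) \<in> parcs G \<longleftrightarrow> (f u, f v) \<in> parcs H" if uv: "u \<in> pverts G" "v \<in> pverts G" for u v
  proof
    assume "(u, v) \<in> parcs G"
    then show "(f u, f v) \<in> parcs H" unfolding A by (metis eq imageI)
  next
    assume "(f u, f v) \<in> parcs H"
    then obtain u' v' where a: "(u', v') \<in> parcs G" and "(f u, f v) = iso_arcs h (u', v')"
      unfolding A by (metis imageE surj_pair)
    then have "f u = f u'" "f v = f v'" by (simp_all add: eq)
    moreover have "u' \<in> pverts G" "v' \<in> pverts G"
      using pair_wf_digraph.wellformed'[OF assms(1) a] by simp_all
    ultimately have "u = u'" "v = v'"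
      using inj uv by (simp_all add: inj_on_eq_iff)
    with a show "(u, v) \<in> parcs G" by simp
  qed
  then show ?R
    using inj V unfolding bij_betw_def by (intro exI[of _ f]) simp
next
  assume ?R
  then obtain f where inj: "inj_on f (pverts G)" and V: "pverts H = f ` pverts G"
    and adj: "\<And>u v. u \<in> pverts G \<Longrightarrow> v \<in> pverts G \<Longrightarrow> (u, v) \<in> parcs G \<longleftrightarrow> (f u, f v) \<in> parcs H"
    unfolding bij_betw_def by blast
  define h where "h = \<lparr> iso_verts = f, iso_arcs = map_prod f f, iso_head = snd, iso_tail = fst \<rparr>"
  note wf = pair_wf_digraph.wellformed'[OF assms(1)] pair_wf_digraph.wellformed'[OF assms(2)]
  have sub: "parcs G \<subseteq> pverts G \<times> pverts G"
    using wf(1,2) by (simp add: subset_iff)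
  have "inj_on (map_prod f f) (parcs G)"
    by (rule inj_on_subset[OF map_prod_inj_on[OF inj inj] sub])
  moreover have "wf_digraph (with_proj G)"
    using assms(1) by (simp add: wf_digraph_wp_iff)
  ultimately have "pre_digraph.digraph_isomorphism (with_proj G) h"
    using inj by (simp add: pre_digraph.digraph_isomorphism_def h_def)
  moreover have "parcs H = map_prod f f ` parcs G"
  proof
    show "parcs H \<subseteq> map_prod f f ` parcs G"
    proof
      fix a assume a: "a \<in> parcs H"
      obtain x y where xy: "a = (x, y)" by (cases a)
      obtain u v where uv: "u \<in> pverts G" "v \<in> pverts G" "x = f u" "y = f v"
        using wf(3,4)[OF a[unfolded xy]] unfolding V by blast
      have "(u, v) \<in> parcs G" using adj[OF uv(1,2)] a xy uv(3,4) by simp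
      then show "a \<in> map_prod f f ` parcs G"
        by (rule rev_image_eqI) (simp add: xy uv)
    qed
    show "map_prod f f ` parcs G \<subseteq> parcs H"
    proof
      fix a assume "a \<in> map_prod f f ` parcs G"
      then obtain u v where uv: "(u, v) \<in> parcs G" "a = (f u, f v)" by (metis imageE map_prod_simp surj_pair)
      then show "a \<in> parcs H" using adj[of u v] wf(1,2)[OF uv(1)] by simp
    qed
  qed
  then have "with_proj H = app_iso h (with_proj G)"
    using V by (simp add: with_proj_def app_iso_def h_def)
  ultimately show ?L unfolding digraph_iso_def by blast
qed

end

theory Submission
  imports Defs
begin

text \<open>
  Let \<open>\<omega>\<close> be the common size of the maximal cliques. By the CIS property no stable set dominates a
  maximal clique. Hence two distinct maximal cliques share at most \<open>\<omega> - 2\<close> vertices: otherwise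
  the two exchanged vertices would have the same neighborhood. If the graph is not complete, this
  leaves \<open>\<omega> = 3\<close> or \<open>4 \<le> \<omega> \<le> k - 1 \<le> 6\<close>, and the possible ways in which the maximal cliques
  through a vertex overlap are few. If all of them meet in single vertices and each vertex lies in two,
  the graph is a grid. For \<open>\<omega> = 4\<close> and \<open>k = 7\<close> the neighborhood of a vertex is either a windmill of
  three triangles, which forces \<open>K\<^sub>3\<^sub>,\<^sub>3[K\<^sub>2]\<close>, or a path of three triangles; in the second case the
  middle triangles define a partition of the vertices into maximal cliques, and these are arranged
  cyclically as in \<open>Q\<^sub>n\<close>.
\<close>

section \<open>Recognizing the target graphs\<close>

text \<open>CIS only forbids dominating stable sets, whereas a classification has to produce edges.
  The bridge is \<open>adj_of_cover\<close>: if each vertex of a maximal clique is adjacent to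
  \<open>s\<close> or to \<open>t\<close>, then \<open>s\<close> and \<open>t\<close> are adjacent.
  Stable sets with more than two vertices are needed only for triangles and grids. Regularity
  supplies the converse: once \<open>k\<close> neighbors of a vertex are known, there are no others;
  connectedness then spreads a local picture over the whole graph. The cases are organized by the
  outer degree \<open>k + 1 - \<omega>\<close>, the number of neighbors of a vertex outside a
  maximal clique \<open>C\<close> through it. If every other maximal clique through a vertex of
  \<open>C\<close> takes up all its outer neighbors, the traces of these cliques partition
  \<open>C\<close> into parts of equal size, and divisibility removes the pairs (5, 6), (6, 7) and
  (5, 7) for (\<open>\<omega>\<close>, \<open>k\<close>). The bound \<open>n \<ge> 4\<close>
  expresses that the two blocks next to a given block are not adjacent to each other.\<close>

lemma graph_iso_lex_product_K2:
  assumes G: "pair_wf_digraph G" and H: "pair_wf_digraph H" "\<And>x. (x, x) \<notin> parcs H"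
    and f: "\<And>v. v \<in> pverts G \<Longrightarrow> f v \<in> pverts H"
    and fibre: "\<And>y. y \<in> pverts H \<Longrightarrow> card {v \<in> pverts G. f v = y} = 2"
    and adj: "\<And>u v. u \<in> pverts G \<Longrightarrow> v \<in> pverts G \<Longrightarrow>
      (u, v) \<in> parcs G \<longleftrightarrow> u \<noteq> v \<and> (f u = f v \<or> (f u, f v) \<in> parcs H)"
  shows "graph_iso G (lex_product H (complete_graph 2))"
proof -
  let ?L = "lex_product H (complete_graph 2)"
  have wf: "pair_wf_digraph ?L"
    by unfold_locales (auto simp: lex_product_def)
  have "\<exists>p q. p \<noteq> q \<and> {v \<in> pverts G. f v = y} = {p, q}" if "y \<in> pverts H" for y
    using fibre[OF that] by (auto simp: card_2_iff)
  then obtain p q where pq: "\<And>y. y \<in> pverts H \<Longrightarrow> p y \<noteq> q y"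
    "\<And>y. y \<in> pverts H \<Longrightarrow> {v \<in> pverts G. f v = y} = {p y, q y}"
    by metis
  have P: "p y \<in> pverts G" "q y \<in> pverts G" "f (p y) = y" "f (q y) = y" if "y \<in> pverts H" for y
    using pq(2)[OF that] by auto
  have cases: "v = p (f v) \<or> v = q (f v)" if "v \<in> pverts G" for v
    using pq(2)[OF f[OF that]] that by auto
  \<comment> \<open>The order within a fibre is arbitrary: adjacency depends only on
    \<open>f\<close> and on equality of vertices, so any bijection with first component
    \<open>f\<close> is an isomorphism.\<close>
  define g where "g v = (f v, if v = p (f v) then 0 else 1 :: nat)" for v
  have fst_g: "fst (g v) = f v" for v by (simp add: g_def)
  have eq: "u = v" if "u \<in> pverts G" "v \<in> pverts G" "g u = g v" for u v
    using cases[OF that(1)] cases[OF that(2)] that(3) by (auto simp: g_def split: if_splits)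
  have V: "pverts ?L = pverts H \<times> {0, 1}"
    by (auto simp: lex_product_def complete_graph_def)
  have "bij_betw g (pverts G) (pverts ?L)"
  proof (rule bij_betwI')
    show "(g u = g v) = (u = v)" if "u \<in> pverts G" "v \<in> pverts G" for u v
      using eq that by auto
    show "g v \<in> pverts ?L" if "v \<in> pverts G" for v
      using f[OF that] by (simp add: V g_def)
    show "\<exists>v\<in>pverts G. z = g v" if z: "z \<in> pverts ?L" for z
    proof -
      obtain y i where y: "z = (y, i)" "y \<in> pverts H" "i = 0 \<or> i = 1" using z V by auto
      then have "z = g (if i = 0 then p y else q y)"
        using P[OF y(2)] pq(1)[OF y(2)] by (auto simp: g_def)
      then show ?thesis using P[OF y(2)] by (metis (full_types))
    qed
  qed
  moreover have "(u, v) \<in> parcs G \<longleftrightarrow> (g u, g v) \<in> parcs ?L" if "u \<in> pverts G" "v \<in> pverts G" for u v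
  proof (cases "f u = f v")
    case True
    then have "u = v \<longleftrightarrow> snd (g u) = snd (g v)"
      using eq[OF that] unfolding prod_eq_iff by (auto simp: fst_g)
    moreover have "(g u, g v) \<in> parcs ?L \<longleftrightarrow> snd (g u) \<noteq> snd (g v)"
      using f[OF that(1)] True H(2) by (simp add: lex_product_def complete_graph_def g_def)
    ultimately show ?thesis using adj[OF that] True by simp
  next
    case False
    then have "(g u, g v) \<in> parcs ?L \<longleftrightarrow> (f u, f v) \<in> parcs H"
      using f[OF that(1)] f[OF that(2)] by (simp add: lex_product_def complete_graph_def g_def)
    then show ?thesis using adj[OF that] False by auto
  qed
  ultimately show ?thesis using graph_iso_iff[OF G wf] by blast
qed

text \<open>A vertex with coordinates \<open>(i, j)\<close> becomes the edge
  \<open>{Inl i, Inr j}\<close>; sharing an endpoint is then agreeing in a coordinate.\<close>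

lemma graph_iso_line_graph_complete_bipartite:
  assumes G: "pair_wf_digraph G"
    and bij: "bij_betw g (pverts G) ({..<m} \<times> {..<m})"
    and adj: "\<And>u v. u \<in> pverts G \<Longrightarrow> v \<in> pverts G \<Longrightarrow>
      (u, v) \<in> parcs G \<longleftrightarrow> u \<noteq> v \<and> (fst (g u) = fst (g v) \<or> snd (g u) = snd (g v))"
  shows "graph_iso G (line_graph (complete_bipartite_graph m m))"
proof -
  let ?L = "line_graph (complete_bipartite_graph m m)"
  define h where "h = (\<lambda>(i, j). {Inl i, Inr j} :: (nat + nat) set)"
  have E: "undirected_edges (complete_bipartite_graph m m) = h ` ({..<m} \<times> {..<m})"
  proof
    show "undirected_edges (complete_bipartite_graph m m) \<subseteq> h ` ({..<m} \<times> {..<m})"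
      by (auto simp: undirected_edges_def complete_bipartite_graph_def h_def image_iff insert_commute)
    show "h ` ({..<m} \<times> {..<m}) \<subseteq> undirected_edges (complete_bipartite_graph m m)"
      by (force simp: undirected_edges_def complete_bipartite_graph_def h_def)
  qed
  have injh: "inj h" by (auto simp: h_def inj_def doubleton_eq_iff)
  have wf: "pair_wf_digraph ?L"
    by unfold_locales (auto simp: line_graph_def)
  have "bij_betw h ({..<m} \<times> {..<m}) (pverts ?L)"
    unfolding bij_betw_def using injh E by (auto simp: line_graph_def intro: inj_on_subset)
  then have "bij_betw (h \<circ> g) (pverts G) (pverts ?L)" by (rule bij_betw_trans[OF bij])
  moreover have "(u, v) \<in> parcs G \<longleftrightarrow> ((h \<circ> g) u, (h \<circ> g) v) \<in> parcs ?L"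
    if uv: "u \<in> pverts G" "v \<in> pverts G" for u v
  proof -
    have mem: "h (g u) \<in> undirected_edges (complete_bipartite_graph m m)"
      "h (g v) \<in> undirected_edges (complete_bipartite_graph m m)"
      unfolding E using bij_betwE[OF bij] uv by blast+
    have "h (g u) \<inter> h (g v) \<noteq> {} \<longleftrightarrow> fst (g u) = fst (g v) \<or> snd (g u) = snd (g v)"
      by (auto simp: h_def split: prod.splits)
    moreover have "h (g u) = h (g v) \<longleftrightarrow> u = v"
      using injh bij uv by (metis bij_betw_def inj_eq inj_on_eq_iff)
    ultimately show ?thesis using adj[OF uv] mem by (auto simp: line_graph_def)
  qed
  ultimately show ?thesis using graph_iso_iff[OF G wf] by blast
qed

text \<open>A longest path closes up to the cycle. Its last vertex has both neighbors on the path,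
  and the one that is not its predecessor must be the first vertex, since an inner vertex would get
  a third neighbor; \<open>conn\<close> then excludes vertices off this cycle. Connectedness is
  given as a closure principle because \<open>R\<close> will be a relation between sets of vertices,
  not the arc relation of a graph.\<close>

lemma connected_two_regular_is_cycle:
  fixes R :: "'b \<Rightarrow> 'b \<Rightarrow> bool"
  assumes fin: "finite X" and ne: "X \<noteq> {}"
    and sym: "\<And>x y. R x y \<Longrightarrow> R y x" and irrefl: "\<And>x. \<not> R x x"
    and deg: "\<And>x. x \<in> X \<Longrightarrow> card {y. R x y} = 2"
    and closed: "\<And>x y. x \<in> X \<Longrightarrow> R x y \<Longrightarrow> y \<in> X"
    and conn: "\<And>W x. x \<in> W \<Longrightarrow> x \<in> X \<Longrightarrow> (\<And>y z. y \<in> W \<Longrightarrow> y \<in> X \<Longrightarrow> R y z \<Longrightarrow> z \<in> W) \<Longrightarrow> X \<subseteq> W"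
  obtains xs where "distinct xs" "set xs = X" "3 \<le> length xs"
    "\<And>i j. i < length xs \<Longrightarrow> j < length xs \<Longrightarrow>
      R (xs ! i) (xs ! j) \<longleftrightarrow> j = Suc i mod length xs \<or> i = Suc j mod length xs"
proof -
  define path where "path xs \<longleftrightarrow> distinct xs \<and> set xs \<subseteq> X \<and>
    (\<forall>i. Suc i < length xs \<longrightarrow> R (xs ! i) (xs ! Suc i))" for xs
  have bound: "length xs \<le> card X" if "path xs" for xs
    using that fin by (metis card_mono distinct_card path_def)
  obtain x where x: "x \<in> X" using ne by blast
  obtain y z where yz: "{w. R x w} = {y, z}" "y \<noteq> z"
    using deg[OF x] by (auto simp: card_2_iff)
  have "R x y" "R x z" using yz by auto
  then have "path [y, x, z]"
    using x closed yz sym irrefl unfolding path_def by (auto simp: nth_Cons split: nat.splits)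
  then obtain xs where xs: "path xs" "\<And>ys. path ys \<Longrightarrow> length ys \<le> length xs"
    using ex_has_greatest_nat[of path "[y, x, z]" length "Suc (card X)"] bound
    by (auto simp: less_Suc_eq_le)
  define n where "n = length xs"
  have n: "3 \<le> n" using xs(2)[OF \<open>path [y, x, z]\<close>] by (simp add: n_def)
  have dist: "distinct xs" and sub: "set xs \<subseteq> X"
    and step: "\<And>i. Suc i < n \<Longrightarrow> R (xs ! i) (xs ! Suc i)"
    using xs(1) by (auto simp: path_def n_def)
  have inj: "xs ! i = xs ! j \<longleftrightarrow> i = j" if "i < n" "j < n" for i j
    using that dist by (simp add: n_def nth_eq_iff_index_eq)
  have inX: "xs ! i \<in> X" if "i < n" for i using that sub by (auto simp: n_def)
  have finR: "finite {y. R x y}" if "x \<in> X" for x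
    using deg[OF that] by (metis card.infinite zero_neq_numeral)
  let ?l = "xs ! (n - 1)"
  have l: "?l \<in> X" using inX n by simp
  have end_nbr: "y \<in> set xs" if "R ?l y" for y
  proof (rule ccontr)
    assume y: "y \<notin> set xs"
    have "path (xs @ [y])" unfolding path_def
    proof (intro conjI allI impI)
      show "distinct (xs @ [y])" using y dist by simp
      show "set (xs @ [y]) \<subseteq> X" using sub closed[OF l that] by simp
      fix i assume i: "Suc i < length (xs @ [y])"
      show "R ((xs @ [y]) ! i) ((xs @ [y]) ! Suc i)"
      proof (cases "Suc i < n")
        case True then show ?thesis using step by (simp add: nth_append n_def)
      next
        case False
        then have "i = n - 1" "Suc i = n" using i n by (auto simp: n_def)
        then show ?thesis using that by (simp add: nth_append n_def)
      qed
    qed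
    then show False using xs(2) by fastforce
  qed
  have "\<not> {y. R ?l y} \<subseteq> {xs ! (n - 2)}"
    using deg[OF l] card_mono[of "{xs ! (n - 2)}" "{y. R ?l y}"] by auto
  then obtain y0 where y0: "R ?l y0" "y0 \<noteq> xs ! (n - 2)" by auto
  obtain j where j: "j < n" "y0 = xs ! j" using end_nbr[OF y0(1)] by (auto simp: in_set_conv_nth n_def)
  have jn: "j \<noteq> n - 2" "j \<noteq> n - 1" using j y0 irrefl by auto
  have "j = 0"
  proof (rule ccontr)
    assume "j \<noteq> 0"
    then have "R (xs ! j) (xs ! (j - 1))" "R (xs ! j) (xs ! Suc j)" "R (xs ! j) ?l"
      using sym step[of "j - 1"] step[of j] j jn y0 by auto
    then have "{xs ! (j - 1), xs ! Suc j, ?l} \<subseteq> {y. R (xs ! j) y}" by auto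
    then have "card {xs ! (j - 1), xs ! Suc j, ?l} \<le> 2"
      using deg[OF inX[OF j(1)]] finR[OF inX[OF j(1)]] by (metis card_mono)
    moreover have "card {xs ! (j - 1), xs ! Suc j, ?l} = 3"
    proof -
      have "xs ! (j - 1) \<noteq> xs ! Suc j" "xs ! (j - 1) \<noteq> ?l" "xs ! Suc j \<noteq> ?l"
        using inj[of "j - 1" "Suc j"] inj[of "j - 1" "n - 1"] inj[of "Suc j" "n - 1"] j(1) jn n by auto
      then show ?thesis by simp
    qed
    ultimately show False by simp
  qed
  then have close: "R ?l (xs ! 0)" using y0 j by simp
  have succ: "R (xs ! i) (xs ! (Suc i mod n))" if "i < n" for i
  proof (cases "Suc i < n")
    case True then show ?thesis using step by simp
  next
    case False
    then have "Suc i = n" "i = n - 1" using that by auto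
    then show ?thesis using close by simp
  qed
  have nbrs: "{y. R (xs ! i) y} = {xs ! (Suc i mod n), xs ! (if i = 0 then n - 1 else i - 1)}"
    if i: "i < n" for i
  proof -
    let ?p = "if i = 0 then n - 1 else i - 1"
    have p: "?p < n" "Suc ?p mod n = i" using i n by auto
    have "Suc i mod n \<noteq> ?p" using i n by (auto simp: mod_Suc)
    then have "card {xs ! (Suc i mod n), xs ! ?p} = 2"
      using inj[OF _ p(1), of "Suc i mod n"] n by auto
    moreover have "{xs ! (Suc i mod n), xs ! ?p} \<subseteq> {y. R (xs ! i) y}"
      using succ[OF i] succ[OF p(1)] p(2) sym by auto
    ultimately show ?thesis
      using card_subset_eq[OF finR[OF inX[OF i]]] deg[OF inX[OF i]] by metis
  qed
  have "X \<subseteq> set xs"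
  proof (rule conn)
    have "0 < n" using n by simp
    then show "xs ! 0 \<in> set xs" "xs ! 0 \<in> X" using inX nth_mem n_def by blast+
    fix y z assume "y \<in> set xs" "R y z"
    then obtain i where i: "i < n" "y = xs ! i" by (auto simp: in_set_conv_nth n_def)
    then have "z = xs ! (Suc i mod n) \<or> z = xs ! (if i = 0 then n - 1 else i - 1)"
      using nbrs[OF i(1)] \<open>R y z\<close> by auto
    moreover have "Suc i mod n < n" "(if i = 0 then n - 1 else i - 1) < n" using i n by auto
    ultimately show "z \<in> set xs" by (metis n_def nth_mem)
  qed
  moreover have "R (xs ! i) (xs ! j) \<longleftrightarrow> j = Suc i mod n \<or> i = Suc j mod n"
    if i: "i < n" and j: "j < n" for i j
  proof -
    have "R (xs ! i) (xs ! j) \<longleftrightarrow> xs ! j \<in> {y. R (xs ! i) y}" by simp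
    also have "\<dots> \<longleftrightarrow> j = Suc i mod n \<or> j = (if i = 0 then n - 1 else i - 1)"
      unfolding nbrs[OF i] using inj[OF j] i n by auto
    also have "\<dots> \<longleftrightarrow> j = Suc i mod n \<or> i = Suc j mod n"
      using i j n by (auto simp: mod_Suc)
    finally show ?thesis .
  qed
  ultimately show thesis using that[of xs] dist sub n by (auto simp: n_def)
qed

lemma card_pos_obtain: assumes "0 < card A" obtains x where "x \<in> A"
  using assms by (metis card_gt_0_iff ex_in_conv)

section \<open>Maximal cliques in CIS graphs\<close>

text \<open>Co-well-coveredness appears as the constant \<open>\<omega>\<close>, the common size of
  the maximal cliques, so that no argument has to pass to the complement.\<close>

locale uniform_cis_graph =
  fixes G :: "'a pair_pre_digraph" and k \<omega> :: nat
  assumes pair_graph: "pair_graph G"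
    and connected: "Digraph_Component.connected (with_proj G)"
    and regular: "regular_graph k G"
    and irreducible: "irreducible_graph G"
    and CIS: "CIS G"
    and card_maximal_clique: "maximal_clique G C \<Longrightarrow> card C = \<omega>"
begin

abbreviation V :: "'a set" where "V \<equiv> pverts G"
abbreviation adj :: "'a \<Rightarrow> 'a \<Rightarrow> bool" (infix \<open>\<sim>\<close> 50) where "u \<sim> v \<equiv> (u, v) \<in> parcs G"
abbreviation N :: "'a \<Rightarrow> 'a set" where "N \<equiv> neighborhood G"
abbreviation Q :: "'a set \<Rightarrow> bool" where "Q \<equiv> maximal_clique G"

lemma in_N [simp]: "w \<in> N v \<longleftrightarrow> v \<sim> w"
  by (simp add: neighborhood_def)

lemma finite_V [simp]: "finite V"
  using pair_graph by (simp add: pair_graph_def pair_digraph_def pair_fin_digraph_def pair_fin_digraph_axioms_def)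

lemma adj_in_V: assumes "u \<sim> v" shows "u \<in> V" "v \<in> V"
proof -
  interpret pair_graph G by (rule pair_graph)
  show "u \<in> V" "v \<in> V" by (rule in_arcsD1[OF assms], rule in_arcsD2[OF assms])
qed

lemma adj_sym: "u \<sim> v \<Longrightarrow> v \<sim> u"
proof -
  interpret pair_graph G by (rule pair_graph)
  show "u \<sim> v \<Longrightarrow> v \<sim> u" by (simp add: arcs_symmetric)
qed

lemma adj_commute: "u \<sim> v \<longleftrightarrow> v \<sim> u"
  using adj_sym by blast

lemma adj_irrefl [simp]: "\<not> u \<sim> u"
proof -
  interpret pair_graph G by (rule pair_graph)
  show ?thesis using no_loops' by blast
qed

lemma adj_neq: "u \<sim> v \<Longrightarrow> u \<noteq> v"
  by auto

lemma N_subset_V: "N v \<subseteq> V"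
  using adj_in_V by auto

lemma finite_N [simp]: "finite (N v)"
  using N_subset_V finite_V by (rule finite_subset)

lemma card_N: "v \<in> V \<Longrightarrow> card (N v) = k"
  using regular by (simp add: regular_graph_def)

lemma eq_of_N_eq: "u \<in> V \<Longrightarrow> v \<in> V \<Longrightarrow> N u = N v \<Longrightarrow> u = v"
  using irreducible by (auto simp: irreducible_graph_def)

lemma V_nonempty: "V \<noteq> {}"
  using connected by (auto simp: connected_def strongly_connected_def)

lemma connected_closed:
  assumes "v \<in> W" "v \<in> V" "\<And>x y. x \<in> W \<Longrightarrow> x \<sim> y \<Longrightarrow> y \<in> W"
  shows "V \<subseteq> W"
proof
  interpret pair_graph G by (rule pair_graph)
  fix u assume "u \<in> V"
  have "v \<rightarrow>\<^sup>*\<^bsub>mk_symmetric (with_proj G)\<^esub> u"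
    using connected \<open>v \<in> V\<close> \<open>u \<in> V\<close> by (auto simp: connected_def strongly_connected_def)
  then have "v \<rightarrow>\<^sup>*\<^bsub>with_proj G\<^esub> u"
    using reachable_mk_symmetric_eq by (simp add: pair_sym_arcs)
  then show "u \<in> W"
    by (induction rule: reachable_induct) (use assms in auto)
qed

lemma clique_subset_V: "clique G K \<Longrightarrow> K \<subseteq> V"
  by (simp add: clique_def)

lemma clique_adj: "clique G K \<Longrightarrow> u \<in> K \<Longrightarrow> v \<in> K \<Longrightarrow> u \<noteq> v \<Longrightarrow> u \<sim> v"
  by (auto simp: clique_def)

lemma clique_finite: "clique G K \<Longrightarrow> finite K"
  using clique_subset_V finite_V finite_subset by blast

lemma clique_mono: "clique G K \<Longrightarrow> L \<subseteq> K \<Longrightarrow> clique G L"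
  by (auto simp: clique_def)

lemma clique_insert:
  "clique G (insert v K) \<longleftrightarrow> v \<in> V \<and> clique G K \<and> (\<forall>u\<in>K. u \<noteq> v \<longrightarrow> u \<sim> v)"
  by (auto simp: clique_def intro: adj_sym)

lemma clique_empty [simp]: "clique G {}"
  by (simp add: clique_def)

lemma maximal_cliqueD:
  assumes "Q C"
  shows "clique G C" "finite C" "C \<subseteq> V" "card C = \<omega>"
  using assms card_maximal_clique clique_finite clique_subset_V
  by (auto simp: maximal_clique_def)

lemma maximal_clique_adj: "Q C \<Longrightarrow> u \<in> C \<Longrightarrow> v \<in> C \<Longrightarrow> u \<noteq> v \<Longrightarrow> u \<sim> v"
  using clique_adj maximal_cliqueD(1) by blast

lemma clique_extend: assumes "clique G K" obtains C where "Q C" "K \<subseteq> C"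
proof -
  have "finite {D. clique G D}"
    by (rule finite_subset[of _ "Pow V"]) (auto dest: clique_subset_V)
  then obtain C where C: "clique G C" "K \<subseteq> C" "\<forall>D. clique G D \<longrightarrow> C \<subseteq> D \<longrightarrow> C = D"
    using finite_has_maximal2[of "{D. clique G D}" K] assms by auto
  then show thesis by (intro that[of C]) (auto simp: maximal_clique_def)
qed

lemma clique_card_le: assumes "clique G K" shows "card K \<le> \<omega>"
proof -
  obtain C where "Q C" "K \<subseteq> C" using clique_extend assms by blast
  then show ?thesis using maximal_cliqueD(2,4)[of C] card_mono[of C K] by simp
qed

lemma maximal_cliqueI: assumes "clique G K" "card K = \<omega>" shows "Q K"
proof -
  obtain C where "Q C" "K \<subseteq> C" using clique_extend assms by blast
  moreover from this have "K = C"
    using maximal_cliqueD(2,4)[of C] assms by (intro card_subset_eq) auto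
  ultimately show ?thesis by simp
qed

text \<open>Extend \<open>S\<close> to a maximal stable set and take its common vertex with
  \<open>C\<close>. That vertex may belong to \<open>S\<close>, so \<open>S\<close> and
  \<open>C\<close> need not be disjoint. CIS enters all later arguments in this form.\<close>

lemma stable_avoids:
  assumes "Q C" "stable_set G S" shows "\<exists>x\<in>C. \<forall>s\<in>S. \<not> s \<sim> x"
proof -
  have "finite {T. stable_set G T}"
    by (rule finite_subset[of _ "Pow V"]) (auto simp: stable_set_def)
  then obtain T where T: "stable_set G T" "S \<subseteq> T" "\<forall>D. stable_set G D \<longrightarrow> T \<subseteq> D \<longrightarrow> T = D"
    using finite_has_maximal2[of "{T. stable_set G T}" S] assms by auto
  then have "maximal_stable_set G T" by (auto simp: maximal_stable_set_def)
  then obtain x where "x \<in> T" "x \<in> C" using CIS assms(1) by (auto simp: CIS_def)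
  moreover have "\<forall>s\<in>S. \<not> s \<sim> x"
    using T(1,2) \<open>x \<in> T\<close> by (auto simp: stable_set_def)
  ultimately show ?thesis by blast
qed

text \<open>If \<open>s\<close> and \<open>t\<close> were non-adjacent, \<open>{s, t}\<close> would
  be a stable set dominating \<open>C\<close>. This is the main source of new edges.\<close>

lemma adj_of_cover:
  assumes "Q C" "s \<in> V" "t \<in> V" "\<And>z. z \<in> C \<Longrightarrow> z \<sim> s \<or> z \<sim> t"
  shows "s \<sim> t"
proof (rule ccontr)
  assume "\<not> s \<sim> t"
  then have "stable_set G {s, t}" using assms adj_sym by (auto simp: stable_set_def)
  then show False using stable_avoids[OF assms(1)] assms(4) adj_sym by blast
qed

text \<open>For a neighbor \<open>w\<close> of \<open>z\<close> outside \<open>K\<close>, the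
  vertices \<open>u\<close> and \<open>w\<close> together dominate \<open>C\<close>:
  \<open>u\<close> takes care of \<open>K\<close>, and \<open>w\<close> of \<open>z\<close>.\<close>

lemma N_subset_of_exchange:
  assumes Q: "Q C" "Q D" and CD: "C = insert z K" "D = insert u K"
    and nz: "z \<notin> K" "u \<notin> K" "u \<noteq> z"
  shows "N z \<subseteq> N u"
proof
  fix w assume "w \<in> N z"
  then have w: "z \<sim> w" by simp
  have fin: "finite K" using maximal_cliqueD(2)[OF Q(1)] CD by simp
  have V: "u \<in> V" using CD maximal_cliqueD(3)[OF Q(2)] by auto
  have zu: "\<not> z \<sim> u"
  proof
    assume "z \<sim> u"
    then have "clique G (insert u C)"
      using maximal_cliqueD(1)[OF Q(1)] maximal_cliqueD(1)[OF Q(2)] CD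
      by (auto simp: clique_insert)
    then have "card (insert u C) \<le> card C"
      using clique_card_le maximal_cliqueD(4)[OF Q(1)] by metis
    then show False using CD nz fin by auto
  qed
  have "u \<sim> w"
  proof (cases "w \<in> K")
    case True then show ?thesis using maximal_clique_adj[OF Q(2)] CD nz by blast
  next
    case False
    have "x \<sim> u \<or> x \<sim> w" if "x \<in> C" for x
      using that CD w maximal_clique_adj[OF Q(2), of x u] nz by auto
    then show ?thesis using adj_of_cover Q(1) V adj_in_V[OF w] by blast
  qed
  then show "w \<in> N u" by simp
qed

lemma card_Int_maximal_cliques:
  assumes Q: "Q C" "Q D" and ne: "C \<noteq> D"
  shows "card (C \<inter> D) + 2 \<le> \<omega>"
proof (rule ccontr)
  assume a: "\<not> ?thesis"
  note C = maximal_cliqueD[OF Q(1)] and D = maximal_cliqueD[OF Q(2)]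
  have "C \<inter> D \<noteq> C" "C \<inter> D \<noteq> D"
    using ne C D by (metis Int_lower2 card_subset_eq, metis Int_lower1 card_subset_eq)
  then have "C \<inter> D \<subset> C" "C \<inter> D \<subset> D" by auto
  then have lt: "card (C \<inter> D) < \<omega>" using psubset_card_mono C by metis
  have "card (C - D) = \<omega> - card (C \<inter> D)" "card (D - C) = \<omega> - card (C \<inter> D)"
    using C D by (metis card_Diff_subset_Int finite_Int, metis Int_commute card_Diff_subset_Int finite_Int)
  then have "card (C - D) = 1" "card (D - C) = 1" using a lt by auto
  then obtain z u where zu: "C - D = {z}" "D - C = {u}" by (auto simp: card_1_singleton_iff)
  have eq: "C = insert z (C \<inter> D)" "D = insert u (C \<inter> D)"
    and nz: "z \<notin> C \<inter> D" "u \<notin> C \<inter> D" "u \<noteq> z" using zu by auto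
  have "N z \<subseteq> N u" by (rule N_subset_of_exchange[OF Q eq nz])
  moreover have "N u \<subseteq> N z" by (rule N_subset_of_exchange[OF Q(2,1) eq(2,1) nz(2,1) nz(3)[symmetric]])
  moreover have "z \<in> V" "u \<in> V" using C D zu by auto
  ultimately show False using eq_of_N_eq nz by blast
qed

lemma maximal_clique_unique:
  assumes "Q C" "Q D" "K \<subseteq> C" "K \<subseteq> D" "\<omega> \<le> card K + 1"
  shows "C = D"
proof (rule ccontr)
  assume "C \<noteq> D"
  then have "card (C \<inter> D) + 2 \<le> \<omega>" using card_Int_maximal_cliques assms by blast
  moreover have "card K \<le> card (C \<inter> D)"
    using assms maximal_cliqueD(2)[OF assms(1)] by (intro card_mono) auto
  ultimately show False using assms by simp
qed

text \<open>The vertex \<open>v\<close> and its neighbors in \<open>C\<close> lie in a maximal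
  clique other than \<open>C\<close>, so the bound on intersections of maximal cliques also bounds
  the trace of a single vertex.\<close>

lemma card_trace:
  assumes "Q C" "v \<in> V" "v \<notin> C"
  shows "card (C \<inter> N v) + 2 \<le> \<omega>"
proof -
  have "clique G (insert v (C \<inter> N v))"
    using assms maximal_cliqueD(1)[OF assms(1)] by (auto simp: clique_insert intro: clique_mono adj_sym)
  then obtain D where D: "Q D" "insert v (C \<inter> N v) \<subseteq> D" using clique_extend by blast
  then have "card (C \<inter> D) + 2 \<le> \<omega>" using card_Int_maximal_cliques[OF assms(1) D(1)] assms by auto
  moreover have "card (C \<inter> N v) \<le> card (C \<inter> D)"
    using D maximal_cliqueD(2)[OF assms(1)] by (intro card_mono) auto
  ultimately show ?thesis by simp
qed

lemma trace_le:
  assumes "Q C" "v \<in> V" "v \<notin> C" "K \<subseteq> C" "\<And>x. x \<in> K \<Longrightarrow> x \<sim> v"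
  shows "card K + 2 \<le> \<omega>"
proof -
  have "K \<subseteq> C \<inter> N v" using assms(4,5) adj_sym by fastforce
  then have "card K \<le> card (C \<inter> N v)"
    using maximal_cliqueD(2)[OF assms(1)] by (intro card_mono) auto
  then show ?thesis using card_trace[OF assms(1-3)] by simp
qed

lemma maximal_clique_subset_N: "Q C \<Longrightarrow> x \<in> C \<Longrightarrow> C - {x} \<subseteq> N x"
  by (metis DiffE in_N insertCI maximal_clique_adj subsetI)

lemma N_Int_maximal_clique: "Q C \<Longrightarrow> x \<in> C \<Longrightarrow> N x \<inter> C = C - {x}"
  using maximal_clique_adj by (auto dest: adj_neq)

text \<open>\<open>C\<close> itself accounts for \<open>\<omega> - 1\<close> of the neighbors of
  \<open>x\<close>. The outer degree is kept in additive form to avoid truncated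
  subtraction.\<close>

lemma card_N_Diff:
  assumes "Q C" "x \<in> C" shows "card (N x - C) + \<omega> = k + 1"
proof -
  note C = maximal_cliqueD[OF assms(1)]
  have "card (N x) = card (N x - C) + card (N x \<inter> C)"
    by (metis Int_Diff_disjoint Int_Diff_Un add.commute card_Un_disjoint finite_Diff finite_Int finite_N)
  moreover have "card (N x \<inter> C) = \<omega> - 1"
    using N_Int_maximal_clique[OF assms] C assms by simp
  moreover have "\<omega> > 0" using C assms card_gt_0_iff by blast
  ultimately show ?thesis using card_N C assms by auto
qed

lemma vertex_in_maximal_clique: assumes "v \<in> V" obtains C where "Q C" "v \<in> C"
  using clique_extend[of "{v}"] assms by (auto simp: clique_insert)

lemma edge_in_maximal_clique: assumes "u \<sim> v" obtains C where "Q C" "u \<in> C" "v \<in> C"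
  using clique_extend[of "{u, v}"] assms adj_in_V[OF assms] by (auto simp: clique_insert intro: adj_sym)

lemma triangle_in_maximal_clique:
  assumes "u \<sim> v" "u \<sim> w" "v \<sim> w" obtains C where "Q C" "u \<in> C" "v \<in> C" "w \<in> C"
proof -
  have "clique G {u, v, w}"
    using assms adj_in_V(1)[OF assms(1)] adj_in_V[OF assms(3)] by (auto simp: clique_def intro: adj_sym)
  then show thesis using clique_extend that by (metis insert_subset)
qed

lemma complete_if: assumes "\<omega> = k + 1" shows "\<exists>n. complete_digraph n (with_proj G)"
proof -
  obtain v where v: "v \<in> V" using V_nonempty by blast
  then obtain C where C: "Q C" "v \<in> C" using vertex_in_maximal_clique by blast
  have "V \<subseteq> C"
  proof (rule connected_closed[OF C(2) v])
    fix x y assume "x \<in> C" "x \<sim> y"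
    then have "N x - C = {}" using card_N_Diff[OF C(1)] assms by auto
    then show "y \<in> C" using \<open>x \<sim> y\<close> by auto
  qed
  then have "V = C" using C maximal_cliqueD by blast
  then have "u \<sim> v \<longleftrightarrow> (u, v) \<in> V \<times> V \<and> u \<noteq> v" for u v
    using adj_in_V[of u v] adj_neq[of u v] maximal_clique_adj[OF C(1), of u v] by auto
  then have "parcs G = {(u, v). (u, v) \<in> V \<times> V \<and> u \<noteq> v}" by blast
  then show ?thesis unfolding complete_digraph_pair_def using finite_V by blast
qed

lemma card_maximal_clique_Diff:
  assumes "Q C" "Q D" "C \<noteq> D" shows "card (D - C) \<ge> 2" "card (D - C) = \<omega> - card (C \<inter> D)"
proof -
  show eq: "card (D - C) = \<omega> - card (C \<inter> D)"
    using maximal_cliqueD[OF assms(1)] maximal_cliqueD[OF assms(2)]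
    by (metis Int_commute card_Diff_subset_Int finite_Int)
  show "card (D - C) \<ge> 2"
    using card_Int_maximal_cliques[OF assms] eq by simp
qed

lemma other_maximal_clique:
  assumes "Q C" "x \<in> C" "x \<sim> u" "u \<notin> C"
  obtains D where "Q D" "x \<in> D" "u \<in> D" "D \<noteq> C" "D - C \<subseteq> N x - C"
proof -
  obtain D where D: "Q D" "x \<in> D" "u \<in> D" using edge_in_maximal_clique assms by blast
  show thesis
  proof (rule that[OF D])
    show "D \<noteq> C" using D assms by auto
    have "x \<sim> y" if "y \<in> D - C" for y
      using that assms(2) by (intro maximal_clique_adj[OF D(1) D(2)]) auto
    then show "D - C \<subseteq> N x - C" by auto
  qed
qed

text \<open>A second maximal clique \<open>D\<close> meets \<open>C\<close> at \<open>v\<close>: the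
  nonempty intersection has size at most \<open>\<omega> - 2\<close>, and \<open>D - C\<close> puts
  at least two vertices among the \<open>k + 1 - \<omega>\<close> outer neighbors of
  \<open>v\<close>.\<close>

lemma omega_bounds: assumes "\<omega> \<noteq> k + 1" shows "3 \<le> \<omega>" "\<omega> < k"
proof -
  obtain v where v: "v \<in> V" using V_nonempty by blast
  then obtain C where C: "Q C" "v \<in> C" using vertex_in_maximal_clique by blast
  have "N v - C \<noteq> {}" using card_N_Diff[OF C] assms card.empty by fastforce
  then obtain u where "u \<in> N v - C" by blast
  then have u: "v \<sim> u" "u \<notin> C" by auto
  obtain D where D: "Q D" "v \<in> D" "u \<in> D" "D \<noteq> C" "D - C \<subseteq> N v - C"
    using other_maximal_clique[OF C u] by blast
  have "card (C \<inter> D) > 0" using C D maximal_cliqueD(2)[OF C(1)] by (auto simp: card_gt_0_iff)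
  then show "3 \<le> \<omega>" using card_Int_maximal_cliques[OF C(1) D(1)] D by auto
  have "2 \<le> card (D - C)" using card_maximal_clique_Diff C D by blast
  also have "\<dots> \<le> card (N v - C)" using D by (intro card_mono) auto
  finally show "\<omega> < k" using card_N_Diff[OF C] by simp
qed

lemma other_maximal_clique_exists:
  assumes "\<omega> \<noteq> k + 1" "Q C" "x \<in> C"
  obtains D where "Q D" "x \<in> D" "D \<noteq> C" "D - C \<subseteq> N x - C"
proof -
  have "N x - C \<noteq> {}" using card_N_Diff[OF assms(2,3)] assms(1) card.empty by fastforce
  then obtain u where "u \<in> N x - C" by blast
  then have u: "x \<sim> u" "u \<notin> C" by auto
  show thesis using other_maximal_clique[OF assms(2,3) u] that by blast
qed

section \<open>Grids\<close>

lemma pair_wf: "pair_wf_digraph G"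
  using pair_graph by (simp add: pair_graph_def pair_digraph_def pair_fin_digraph_def)

text \<open>The first assumption is \<open>k = 2 * (\<omega> - 1)\<close>: two maximal cliques that
  meet only in a vertex account for its whole neighborhood. It holds for
  \<open>\<omega> = 3\<close>, \<open>k = 4\<close> and for \<open>\<omega> = 4\<close>,
  \<open>k = 6\<close>, the two grids of the classification.\<close>

context
  assumes two: "k + 2 = 2 * \<omega>" and omega_ge: "3 \<le> \<omega>"
    and meet: "\<And>C D. Q C \<Longrightarrow> Q D \<Longrightarrow> C \<noteq> D \<Longrightarrow> card (C \<inter> D) \<le> 1"
begin

lemma meet_unique:
  assumes "Q C" "Q D" "a \<in> C" "b \<in> C" "a \<in> D" "b \<in> D" "a \<noteq> b" shows "C = D"
proof (rule ccontr)
  assume "C \<noteq> D"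
  then have "card (C \<inter> D) \<le> 1" using meet assms by blast
  moreover have "card {a, b} \<le> card (C \<inter> D)"
    using assms maximal_cliqueD(2)[OF assms(1)] by (intro card_mono) auto
  ultimately show False using assms by simp
qed

lemma two_nbrs_in_clique:
  assumes "Q C" "a \<in> C" "b \<in> C" "a \<noteq> b" "u \<sim> a" "u \<sim> b" shows "u \<in> C"
proof -
  have "a \<sim> b" using maximal_clique_adj assms by blast
  then obtain D where "Q D" "u \<in> D" "a \<in> D" "b \<in> D" using triangle_in_maximal_clique assms by metis
  then show ?thesis using meet_unique[of C D a b] assms by blast
qed

lemma N_eq_two_cliques:
  assumes "Q C" "Q D" "C \<noteq> D" "x \<in> C" "x \<in> D" shows "N x = C \<union> D - {x}"
proof -
  note C = maximal_cliqueD[OF assms(1)] and D = maximal_cliqueD[OF assms(2)]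
  have i: "C \<inter> D = {x}" using meet_unique[OF assms(1,2)] assms by auto
  then have "card (C \<union> D) + 1 = \<omega> + \<omega>" using card_Un_Int[OF C(2) D(2)] C D by simp
  then have "card (C \<union> D - {x}) = k" using assms C D two by simp
  moreover have "C \<union> D - {x} \<subseteq> N x"
    using maximal_clique_subset_N[OF assms(1,4)] maximal_clique_subset_N[OF assms(2,5)] by blast
  ultimately show ?thesis using card_subset_eq[OF finite_N] card_N C assms by (metis subsetD)
qed

lemma only_two_cliques:
  assumes "Q C" "Q D" "C \<noteq> D" "x \<in> C" "x \<in> D" "Q E" "x \<in> E" shows "E = C \<or> E = D"
proof (rule ccontr)
  assume a: "\<not> ?thesis"
  have "E \<subseteq> {x}"
  proof
    fix y assume y: "y \<in> E"
    show "y \<in> {x}"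
    proof (rule ccontr)
      assume n: "y \<notin> {x}"
      then have "y \<in> N x" using maximal_clique_adj assms y by auto
      then have "y \<in> C \<or> y \<in> D" using N_eq_two_cliques[OF assms(1-5)] by auto
      then show False using meet_unique[of E C x y] meet_unique[of E D x y] assms a y n by auto
    qed
  qed
  then have "card E \<le> 1" using card_mono[of "{x}" E] by simp
  then show False using maximal_cliqueD(4)[OF assms(6)] omega_ge by simp
qed

lemma second_clique: assumes "Q C" "x \<in> C" obtains D where "Q D" "x \<in> D" "D \<noteq> C"
  using other_maximal_clique_exists[OF _ assms] two omega_ge by auto

text \<open>By \<open>two_nbrs_in_clique\<close> a vertex outside \<open>R\<close> is adjacent to at
  most one vertex of \<open>R\<close>, so \<open>T\<close> and \<open>y\<close> rule out fewer than
  \<open>\<omega>\<close> vertices. Separating \<open>T\<close> from \<open>S\<close> keeps vertices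
  known to have no neighbor in \<open>R\<close> out of the count.\<close>

lemma pick_nonadjacent:
  assumes "Q R" "y \<in> R" "finite S" "S \<inter> R = {}" "T \<subseteq> S" "card T + 1 < \<omega>"
    "\<And>s. s \<in> S - T \<Longrightarrow> N s \<inter> R = {}"
  obtains w where "w \<in> R" "w \<noteq> y" "\<And>s. s \<in> S \<Longrightarrow> \<not> s \<sim> w"
proof -
  have "card (N s \<inter> R) \<le> 1" if "s \<in> T" for s
  proof (rule ccontr)
    assume "\<not> ?thesis"
    then have "\<not> N s \<inter> R \<subseteq> {a}" for a using card_mono[of "{a}" "N s \<inter> R"] by auto
    then obtain a b where "a \<in> N s \<inter> R" "b \<in> N s \<inter> R" "a \<noteq> b" by (metis subsetI singletonI)
    then show False using two_nbrs_in_clique[OF assms(1), of a b s] that assms by auto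
  qed
  moreover have "finite T" using assms finite_subset by blast
  ultimately have "card (\<Union>s\<in>T. N s \<inter> R) \<le> card T"
    using card_UN_le[of T "\<lambda>s. N s \<inter> R"] sum_bounded_above[of T "\<lambda>s. card (N s \<inter> R)" 1] by force
  moreover have "card (R - {y}) = \<omega> - 1" using maximal_cliqueD[OF assms(1)] assms by simp
  ultimately have "\<not> R - {y} \<subseteq> (\<Union>s\<in>T. N s \<inter> R)"
    using card_mono[of "\<Union>s\<in>T. N s \<inter> R" "R - {y}"] \<open>finite T\<close> assms(6) by fastforce
  then obtain w where "w \<in> R - {y}" "w \<notin> (\<Union>s\<in>T. N s \<inter> R)" by blast
  then have w: "w \<in> R" "w \<noteq> y" "\<And>s. s \<in> T \<Longrightarrow> \<not> s \<sim> w" by auto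
  have "\<not> s \<sim> w" if "s \<in> S" for s
    using w assms(7)[of s] that by (cases "s \<in> T") auto
  then show thesis using that w by blast
qed

text \<open>A vertex u of the clique R x without neighbor in the clique R p could be extended greedily to
  a stable set that dominates C.\<close>

lemma transversal_neighbor:
  assumes C: "Q C" and R: "\<And>x. x \<in> C \<Longrightarrow> Q (R x)" "\<And>x. x \<in> C \<Longrightarrow> x \<in> R x"
    and disj: "\<And>x y. x \<in> C \<Longrightarrow> y \<in> C \<Longrightarrow> x \<noteq> y \<Longrightarrow> R x \<inter> R y = {}"
    and x: "x \<in> C" and p: "p \<in> C" "p \<noteq> x" and u: "u \<in> R x" "u \<noteq> x"
  shows "\<exists>w\<in>R p. u \<sim> w"
proof (rule ccontr)
  assume no: "\<not> ?thesis"
  note Cf = maximal_cliqueD[OF C]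
  have uV: "u \<in> V" using u maximal_cliqueD(3)[OF R(1)[OF x]] by auto
  have "\<exists>S. stable_set G S \<and> u \<in> S \<and> finite S \<and> card S \<le> card Y + 1 \<and>
      S \<subseteq> R x \<union> (\<Union>y\<in>Y. R y) \<and> (\<forall>y\<in>Y. \<exists>s\<in>S. s \<sim> y)"
    if "finite Y" "Y \<subseteq> C - {x, p}" for Y
    using that
  proof (induction Y rule: finite_induct)
    case empty
    then show ?case using u uV by (intro exI[of _ "{u}"]) (auto simp: stable_set_def)
  next
    case (insert y Y)
    then obtain S where S: "stable_set G S" "u \<in> S" "finite S" "card S \<le> card Y + 1"
      "S \<subseteq> R x \<union> (\<Union>y\<in>Y. R y)" "\<forall>y\<in>Y. \<exists>s\<in>S. s \<sim> y" by auto
    have y: "y \<in> C" "y \<noteq> x" "y \<notin> Y" and Y: "Y \<subseteq> C" "x \<notin> Y" "p \<notin> Y" "p \<noteq> y" using insert by auto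
    \<comment> \<open>The index \<open>p\<close> is reserved, so
      \<open>card Y \<le> \<omega> - 3\<close> and \<open>S\<close> has at most
      \<open>\<omega> - 2\<close> vertices: there is room in \<open>R y\<close> to avoid the
      neighbors of all of them.\<close>
    have "card (insert x (insert p (insert y Y))) \<le> \<omega>"
      using Cf x p y Y by (metis card_mono insert_subset)
    then have small: "card S + 1 < \<omega>"
      using S(4) x p y Y insert.hyps(1) by auto
    have "S \<inter> R y = {}" using S(5) disj x y Y by fast
    then obtain w where w: "w \<in> R y" "w \<noteq> y" "\<And>s. s \<in> S \<Longrightarrow> \<not> s \<sim> w"
      using pick_nonadjacent[OF R(1)[OF y(1)] R(2)[OF y(1)] S(3) _ subset_refl small] by auto
    have "w \<in> V" using w maximal_cliqueD(3)[OF R(1)[OF y(1)]] by auto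
    then have "stable_set G (insert w S)"
      using S(1) w(3) adj_sym by (auto simp: stable_set_def)
    moreover have "w \<sim> y" using maximal_clique_adj[OF R(1)[OF y(1)] w(1) R(2)[OF y(1)] w(2)] .
    moreover have "card (insert w S) \<le> card (insert y Y) + 1"
      using S(3,4) insert.hyps card_insert_le_m1 by (simp add: card_insert_if)
    ultimately show ?case using S w by (intro exI[of _ "insert w S"]) auto
  qed
  from this[of "C - {x, p}"] obtain S where S: "stable_set G S" "u \<in> S" "finite S"
    "card S \<le> card (C - {x, p}) + 1" "S \<subseteq> R x \<union> (\<Union>y\<in>C - {x, p}. R y)"
    "\<forall>y\<in>C - {x, p}. \<exists>s\<in>S. s \<sim> y" using Cf by auto
  have "card (C - {x, p}) = \<omega> - 2"
    using Cf x p by (simp add: card_Diff_subset)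
  \<comment> \<open>At \<open>p\<close> the set \<open>S\<close> may have
    \<open>\<omega> - 1\<close> vertices, one more than the count permits; \<open>u\<close> is
    exempt because it has no neighbor in \<open>R p\<close>.\<close>
  then have small: "card (S - {u}) + 1 < \<omega>" using S omega_ge by simp
  have d: "S \<inter> R p = {}" using S(5) disj x p by fast
  have "N s \<inter> R p = {}" if "s \<in> S - (S - {u})" for s using that no by auto
  then obtain w where w: "w \<in> R p" "w \<noteq> p" "\<And>s. s \<in> S \<Longrightarrow> \<not> s \<sim> w"
    using pick_nonadjacent[OF R(1)[OF p(1)] R(2)[OF p(1)] S(3) d _ small] by auto
  have "w \<in> V" using w maximal_cliqueD(3)[OF R(1)[OF p(1)]] by auto
  then have "stable_set G (insert w S)"
    using S(1) w(3) adj_sym by (auto simp: stable_set_def)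
  then obtain z where z: "z \<in> C" "\<forall>s\<in>insert w S. \<not> s \<sim> z" using stable_avoids[OF C] by blast
  moreover have "w \<sim> p" using maximal_clique_adj[OF R(1)[OF p(1)] w(1) R(2)[OF p(1)] w(2)] .
  moreover have "u \<sim> x" using maximal_clique_adj[OF R(1)[OF x] u(1) R(2)[OF x] u(2)] .
  ultimately show False using S by blast
qed

text \<open>Take \<open>C\<close> as a row and the second cliques \<open>R x\<close> through its
  vertices as columns. The coordinates of \<open>v\<close> are its column \<open>c v\<close> and the
  vertex \<open>r v\<close> where the other clique \<open>T v\<close> through \<open>v\<close>
  crosses the reference column \<open>R x0\<close>.\<close>

lemma graph_iso_grid: "graph_iso G (line_graph (complete_bipartite_graph \<omega> \<omega>))"
proof -
  obtain x0 where x0V: "x0 \<in> V" using V_nonempty by blast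
  then obtain C where C: "Q C" and x0: "x0 \<in> C" using vertex_in_maximal_clique by blast
  note Cf = maximal_cliqueD[OF C]
  have "\<forall>x\<in>C. \<exists>D. Q D \<and> x \<in> D \<and> D \<noteq> C" using second_clique[OF C] by metis
  then obtain R where R: "\<And>x. x \<in> C \<Longrightarrow> Q (R x)" "\<And>x. x \<in> C \<Longrightarrow> x \<in> R x" "\<And>x. x \<in> C \<Longrightarrow> R x \<noteq> C"
    by metis
  have RC: "x = y" if "x \<in> C" "y \<in> R x" "y \<in> C" for x y
    using meet_unique[OF C R(1)[OF that(1)], of x y] that R by blast
  have disj: "R x \<inter> R y = {}" if "x \<in> C" "y \<in> C" "x \<noteq> y" for x y
  proof (rule ccontr)
    assume "R x \<inter> R y \<noteq> {}"
    then obtain u where u: "u \<in> R x" "u \<in> R y" by blast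
    have "u \<noteq> x" "u \<noteq> y" using RC that u by metis+
    then have "u \<sim> x" "u \<sim> y"
      using maximal_clique_adj[OF R(1) u(1) R(2)] maximal_clique_adj[OF R(1) u(2) R(2)] that by auto
    then have "u \<in> C" using two_nbrs_in_clique[OF C] that by blast
    then show False using RC that u by metis
  qed
  have trans: "\<exists>w\<in>R p. u \<sim> w" if "x \<in> C" "p \<in> C" "p \<noteq> x" "u \<in> R x" "u \<noteq> x" for x p u
    using transversal_neighbor[OF C, of R x p u] R disj that by blast
  \<comment> \<open>A clique that is not a column crosses every column. For \<open>v = x\<close> it
    is \<open>C\<close>; otherwise the neighbor of \<open>v\<close> in \<open>R p\<close> provided
    by \<open>trans\<close> is not in \<open>R x\<close>, hence in \<open>T\<close>.\<close>
  have meets: "\<exists>w. w \<in> T \<and> w \<in> R p"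
    if x: "x \<in> C" "v \<in> R x" and T: "Q T" "v \<in> T" "T \<noteq> R x" and p: "p \<in> C" for x v T p
  proof (cases "p = x")
    case True then show ?thesis using that by blast
  next
    case px: False
    show ?thesis
    proof (cases "v = x")
      case True
      then have "T = C" using only_two_cliques[OF C R(1)[OF x(1)], of x T] T R x by metis
      then show ?thesis using R p by blast
    next
      case False
      then obtain w where w: "w \<in> R p" "v \<sim> w" using trans[OF x(1) p px x(2)] by blast
      then have "w \<in> R x \<union> T - {v}" using N_eq_two_cliques[OF R(1)[OF x(1)] T(1)] T x by force
      then show ?thesis using w disj[OF p x(1) px] by blast
    qed
  qed
  have cover: "\<exists>x\<in>C. v \<in> R x" if "v \<in> V" for v
  proof -
    have "V \<subseteq> (\<Union>x\<in>C. R x)"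
    proof (rule connected_closed[OF _ x0V])
      show "x0 \<in> (\<Union>x\<in>C. R x)" using x0 R by blast
      fix u w assume "u \<in> (\<Union>x\<in>C. R x)" and uw: "u \<sim> w"
      then obtain x where x: "x \<in> C" "u \<in> R x" by blast
      obtain T where T: "Q T" "u \<in> T" "T \<noteq> R x" using second_clique[OF R(1)[OF x(1)] x(2)] by blast
      have "\<forall>p\<in>C. \<exists>w. w \<in> T \<and> w \<in> R p" using meets[OF x T] by blast
      then obtain h where h: "\<And>p. p \<in> C \<Longrightarrow> h p \<in> T \<and> h p \<in> R p" by metis
      \<comment> \<open>\<open>T\<close> has \<open>\<omega>\<close> vertices and meets
        \<open>\<omega>\<close> disjoint columns, so it consists of the crossing points.\<close>
      have "inj_on h C" using h disj by (intro inj_onI) (metis disjoint_iff)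
      then have "card (h ` C) = \<omega>" using Cf card_image by metis
      moreover have "h ` C \<subseteq> T" using h by auto
      ultimately have "h ` C = T" using maximal_cliqueD[OF T(1)] by (metis card_subset_eq)
      then have "T \<subseteq> (\<Union>x\<in>C. R x)" using h by blast
      moreover have "w \<in> R x \<union> T" using N_eq_two_cliques[OF R(1)[OF x(1)] T(1)] T x uw by force
      ultimately show "w \<in> (\<Union>x\<in>C. R x)" using x by blast
    qed
    then show ?thesis using that by blast
  qed
  then obtain c where c: "\<And>v. v \<in> V \<Longrightarrow> c v \<in> C" "\<And>v. v \<in> V \<Longrightarrow> v \<in> R (c v)" by metis
  have c_eq: "c v = x" if "v \<in> V" "x \<in> C" "v \<in> R x" for v x
    using disj[of "c v" x] c that by blast
  have "\<exists>T. Q T \<and> v \<in> T \<and> T \<noteq> R (c v)" if "v \<in> V" for v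
    using second_clique[OF R(1) c(2)] c that by metis
  then obtain T where T: "\<And>v. v \<in> V \<Longrightarrow> Q (T v)" "\<And>v. v \<in> V \<Longrightarrow> v \<in> T v"
    "\<And>v. v \<in> V \<Longrightarrow> T v \<noteq> R (c v)" by metis
  have TV: "v \<in> V" if "u \<in> V" "v \<in> T u" for u v using T(1)[OF that(1)] maximal_cliqueD(3) that by blast
  have T_neq: "T u \<noteq> R x" if "u \<in> V" "x \<in> C" for u x
    using T c_eq that by metis
  have T_eq: "T v = T u" if "u \<in> V" "v \<in> T u" for u v
  proof -
    have v: "v \<in> V" using TV that by blast
    show ?thesis
      using only_two_cliques[OF T(1)[OF v] R(1)[OF c(1)[OF v]] T(3)[OF v] T(2)[OF v] c(2)[OF v] T(1)[OF that(1)] that(2)]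
        T_neq that(1) c(1)[OF v] by metis
  qed
  have "\<exists>r. r \<in> T v \<and> r \<in> R x0" if "v \<in> V" for v
    using meets[OF c(1) c(2) T(1) T(2) T(3) x0] that by blast
  then obtain r where r: "\<And>v. v \<in> V \<Longrightarrow> r v \<in> T v" "\<And>v. v \<in> V \<Longrightarrow> r v \<in> R x0" by metis
  have r_eq: "r v = y" if "v \<in> V" "y \<in> T v" "y \<in> R x0" for v y
    using meet_unique[OF T(1)[OF that(1)] R(1)[OF x0]] T_neq[OF that(1) x0] r that by blast
  obtain h1 where h1: "bij_betw h1 C {..<\<omega>}"
    using ex_bij_betw_finite_nat[OF Cf(2)] Cf(4) by (auto simp: atLeast0LessThan)
  obtain h2 where h2: "bij_betw h2 (R x0) {..<\<omega>}"
    using ex_bij_betw_finite_nat[of "R x0"] maximal_cliqueD(2,4)[OF R(1)[OF x0]] by (auto simp: atLeast0LessThan)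
  \<comment> \<open>Vertices with equal \<open>r\<close> lie in the same non-column clique; a common
    column would be a second clique containing both.\<close>
  have inj: "u = v" if uv: "u \<in> V" "v \<in> V" "c u = c v" "r u = r v" for u v
  proof (rule ccontr)
    assume "u \<noteq> v"
    have "T u = T v" using T_eq[OF uv(1) r(1)[OF uv(1)]] T_eq[OF uv(2) r(1)[OF uv(2)]] uv by simp
    then have "T u = R (c u)"
      using meet_unique[of "T u" "R (c u)" u v] T R c uv \<open>u \<noteq> v\<close> by metis
    then show False using T uv by blast
  qed
  have "bij_betw (\<lambda>v. (c v, r v)) V (C \<times> R x0)"
  proof (rule bij_betwI')
    fix z assume "z \<in> C \<times> R x0"
    then obtain x y where z: "z = (x, y)" "x \<in> C" "y \<in> R x0" by blast
    have y: "y \<in> V" using z maximal_cliqueD(3)[OF R(1)[OF x0]] by auto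
    obtain v where v: "v \<in> T y" "v \<in> R x"
      using meets[OF c(1)[OF y] c(2)[OF y] T(1)[OF y] T(2)[OF y] T(3)[OF y] z(2)] by blast
    then have "v \<in> V" using TV y by blast
    moreover have "r v = y" using r_eq[OF \<open>v \<in> V\<close>] T_eq[OF y v(1)] T(2)[OF y] z by simp
    ultimately show "\<exists>v\<in>V. z = (c v, r v)" using c_eq z v by metis
  qed (use c r inj in auto)
  then have b: "bij_betw (map_prod h1 h2 \<circ> (\<lambda>v. (c v, r v))) V ({..<\<omega>} \<times> {..<\<omega>})"
    by (rule bij_betw_trans) (intro bij_betw_map_prod h1 h2)
  show ?thesis
  proof (rule graph_iso_line_graph_complete_bipartite[OF pair_wf b])
    fix u v assume uv: "u \<in> V" "v \<in> V"
    have 1: "h1 (c u) = h1 (c v) \<longleftrightarrow> c u = c v"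
      using h1 c uv by (metis bij_betw_def inj_on_eq_iff)
    have 2: "h2 (r u) = h2 (r v) \<longleftrightarrow> r u = r v"
      using h2 r uv by (metis bij_betw_def inj_on_eq_iff)
    have "u \<sim> v \<longleftrightarrow> u \<noteq> v \<and> (c u = c v \<or> r u = r v)"
    proof (intro iffI conjI)
      assume a: "u \<sim> v"
      then show "u \<noteq> v" by auto
      have "v \<in> T u \<union> R (c u)"
        using N_eq_two_cliques[OF T(1) R(1)[OF c(1)] T(3) T(2) c(2)] uv a by force
      then show "c u = c v \<or> r u = r v"
      proof
        assume "v \<in> T u"
        then have "r v \<in> T u" using T_eq[OF uv(1)] r(1)[OF uv(2)] by simp
        then show ?thesis using r_eq[OF uv(1)] r(2)[OF uv(2)] by blast
      next
        assume "v \<in> R (c u)"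
        then show ?thesis using c_eq[OF uv(2) c(1)[OF uv(1)]] by simp
      qed
    next
      assume a: "u \<noteq> v \<and> (c u = c v \<or> r u = r v)"
      then consider "c u = c v" | "T u = T v"
        using T_eq[OF uv(1) r(1)[OF uv(1)]] T_eq[OF uv(2) r(1)[OF uv(2)]] by metis
      then show "u \<sim> v"
      proof cases
        case 1 then show ?thesis using maximal_clique_adj[OF R(1)[OF c(1)] c(2)] c uv a by metis
      next
        case 2 then show ?thesis using maximal_clique_adj[OF T(1) T(2)] T uv a by metis
      qed
    qed
    then show "u \<sim> v \<longleftrightarrow> u \<noteq> v \<and>
        (fst ((map_prod h1 h2 \<circ> (\<lambda>v. (c v, r v))) u) = fst ((map_prod h1 h2 \<circ> (\<lambda>v. (c v, r v))) v) \<or>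
         snd ((map_prod h1 h2 \<circ> (\<lambda>v. (c v, r v))) u) = snd ((map_prod h1 h2 \<circ> (\<lambda>v. (c v, r v))) v))"
      using 1 2 by simp
  qed
qed

end

section \<open>Triangles and small outer degree\<close>

text \<open>Only the presence of edges has to be supplied. One neighbor in its own pair and two in
  each related pair already give a vertex \<open>k\<close> neighbors, so there are no further edges,
  and by connectedness the pairs exhaust \<open>V\<close>.\<close>

lemma graph_iso_blowup:
  assumes H: "pair_wf_digraph H" "finite (pverts H)" "pverts H \<noteq> {}" "\<And>i. (i, i) \<notin> parcs H"
    and A: "\<And>i. i \<in> pverts H \<Longrightarrow> card (A i) = 2"
    and disj: "\<And>i j. i \<in> pverts H \<Longrightarrow> j \<in> pverts H \<Longrightarrow> i \<noteq> j \<Longrightarrow> A i \<inter> A j = {}"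
    and adj: "\<And>i j u v. i \<in> pverts H \<Longrightarrow> j \<in> pverts H \<Longrightarrow> i = j \<or> (i, j) \<in> parcs H \<Longrightarrow>
      u \<in> A i \<Longrightarrow> v \<in> A j \<Longrightarrow> u \<noteq> v \<Longrightarrow> u \<sim> v"
    and deg: "\<And>i. i \<in> pverts H \<Longrightarrow> 2 * card {j. (i, j) \<in> parcs H} + 1 = k"
  shows "graph_iso G (lex_product H (complete_graph 2))"
proof -
  have HV: "j \<in> pverts H" if "(i, j) \<in> parcs H" for i j
    using pair_wf_digraph.arc_snd_in_verts[OF H(1) that] by simp
  define M where "M i = A i \<union> (\<Union>j\<in>{j. (i, j) \<in> parcs H}. A j)" for i
  have finA: "finite (A i)" if "i \<in> pverts H" for i using A[OF that] card.infinite by fastforce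
  have finH: "finite {j. (i, j) \<in> parcs H}" for i
    by (rule finite_subset[OF _ H(2)]) (use HV in auto)
  have N: "v \<in> V \<and> N v = M i - {v}" if i: "i \<in> pverts H" and v: "v \<in> A i" for i v
  proof -
    have "\<not> A i \<subseteq> {v}" using A[OF i] card_mono[of "{v}" "A i"] by auto
    then obtain w where "w \<in> A i" "w \<noteq> v" by blast
    then have "v \<sim> w" using adj[OF i i] v by auto
    then have V: "v \<in> V" using adj_in_V by blast
    have sub: "M i - {v} \<subseteq> N v"
    proof
      fix w assume "w \<in> M i - {v}"
      then obtain j where "w \<in> A j" "w \<noteq> v" "i = j \<or> (i, j) \<in> parcs H" by (auto simp: M_def)
      then show "w \<in> N v" using adj[OF i _ _ v] HV i by auto
    qed
    have "card (\<Union>j\<in>{j. (i, j) \<in> parcs H}. A j) = 2 * card {j. (i, j) \<in> parcs H}"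
      using finH A HV disj finA by (subst card_UN_disjoint) auto
    moreover have "A i \<inter> (\<Union>j\<in>{j. (i, j) \<in> parcs H}. A j) = {}"
      using disj[OF i HV] H(4) by fast
    moreover have "finite (\<Union>j\<in>{j. (i, j) \<in> parcs H}. A j)" using finH finA HV by auto
    ultimately have "card (M i) = k + 1" "finite (M i)"
      using deg[OF i] A[OF i] finA[OF i] by (auto simp: M_def card_Un_disjoint)
    moreover have "v \<in> M i" using v by (simp add: M_def)
    ultimately have "card (M i - {v}) = k" by simp
    then show ?thesis using card_subset_eq[OF finite_N sub] card_N[OF V] V by simp
  qed
  have cover: "\<exists>i\<in>pverts H. v \<in> A i" if "v \<in> V" for v
  proof -
    obtain i where i: "i \<in> pverts H" using H(3) by blast
    then obtain x where x: "x \<in> A i" using A[OF i] card.empty by fastforce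
    have "V \<subseteq> (\<Union>i\<in>pverts H. A i)"
    proof (rule connected_closed)
      show "x \<in> (\<Union>i\<in>pverts H. A i)" using i x by blast
      show "x \<in> V" using N i x by blast
      fix u w assume "u \<in> (\<Union>i\<in>pverts H. A i)" "u \<sim> w"
      then obtain j where j: "j \<in> pverts H" "u \<in> A j" by blast
      then have "w \<in> M j" using N[OF j] \<open>u \<sim> w\<close> in_N by blast
      then show "w \<in> (\<Union>i\<in>pverts H. A i)" using j HV by (auto simp: M_def)
    qed
    then show ?thesis using that by blast
  qed
  then obtain f where f: "\<And>v. v \<in> V \<Longrightarrow> f v \<in> pverts H" "\<And>v. v \<in> V \<Longrightarrow> v \<in> A (f v)" by metis
  have f_eq: "f v = i" if "i \<in> pverts H" "v \<in> A i" for i v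
    using disj[OF that(1) f(1), of v] N[OF that] f(2) that by blast
  show ?thesis
  proof (rule graph_iso_lex_product_K2[OF pair_wf H(1,4) f(1)])
    fix i assume i: "i \<in> pverts H"
    have "v \<in> V \<and> f v = i \<longleftrightarrow> v \<in> A i" for v
      using N[OF i, of v] f_eq[OF i, of v] f(2)[of v] by metis
    then have "{v \<in> V. f v = i} = A i" by blast
    then show "card {v \<in> V. f v = i} = 2" using A[OF i] by simp
  next
    fix u v assume uv: "u \<in> V" "v \<in> V"
    have "u \<sim> v \<longleftrightarrow> v \<in> M (f u) - {u}" using N[OF f(1) f(2)] uv in_N by blast
    also have "\<dots> \<longleftrightarrow> u \<noteq> v \<and> (f u = f v \<or> (f u, f v) \<in> parcs H)"
    proof -
      have "v \<in> A i \<longleftrightarrow> f v = i" if "i \<in> pverts H" for i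
        using f_eq[OF that, of v] f(2)[OF uv(2)] by metis
      then show ?thesis using f(1)[OF uv(1)] HV by (auto simp: M_def)
    qed
    finally show "u \<sim> v \<longleftrightarrow> u \<noteq> v \<and> (f u = f v \<or> (f u, f v) \<in> parcs H)" .
  qed
qed

section \<open>Maximal cliques of size 3\<close>

lemma maximal_clique_triangle:
  assumes "\<omega> = 3" "a \<sim> b" "a \<sim> c" "b \<sim> c" shows "Q {a, b, c}"
proof (rule maximal_cliqueI)
  show "clique G {a, b, c}"
    using assms adj_in_V[OF assms(2)] adj_in_V[OF assms(3)] by (auto simp: clique_def intro: adj_sym)
  show "card {a, b, c} = \<omega>"
    using assms adj_neq[OF assms(2)] adj_neq[OF assms(3)] adj_neq[OF assms(4)] by simp
qed

text \<open>A second apex over an edge would have two neighbors in a triangle not containing it,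
  above the trace bound \<open>\<omega> - 2 = 1\<close>. Together with \<open>mate_exists\<close>,
  every neighborhood induces a perfect matching.\<close>

lemma triangle_unique:
  assumes "\<omega> = 3" "a \<sim> b" "a \<sim> c" "b \<sim> c" "a \<sim> d" "b \<sim> d" shows "c = d"
proof (rule ccontr)
  assume "c \<noteq> d"
  have Q: "Q {a, b, c}" using maximal_clique_triangle assms by blast
  have "card {a, b} + 2 \<le> \<omega>"
    by (rule trace_le[OF Q, of d]) (use assms adj_in_V[OF assms(5)] \<open>c \<noteq> d\<close> in auto)
  moreover have "a \<noteq> b" using assms by auto
  ultimately show False using assms by simp
qed

lemma mate_exists:
  assumes "\<omega> = 3" "u \<sim> x" obtains u' where "u \<sim> u'" "u' \<sim> x"
proof -
  obtain C where C: "Q C" "u \<in> C" "x \<in> C" using edge_in_maximal_clique[OF assms(2)] by blast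
  have "\<not> C \<subseteq> {u, x}"
    using card_mono[of "{u, x}" C] maximal_cliqueD(4)[OF C(1)] assms(1) card_2_iff'[of "{u, x}"]
    by (auto simp: card_insert_if split: if_splits)
  then obtain u' where "u' \<in> C" "u' \<noteq> u" "u' \<noteq> x" by blast
  then show thesis using that[of u'] maximal_clique_adj[OF C(1)] C by metis
qed

context
  assumes w3: "\<omega> = 3"
begin

lemma outer_triangle_cover:
  assumes t: "x \<sim> y" "x \<sim> z" "y \<sim> z" and o: "u \<sim> x" "w \<sim> y" "v \<sim> z" and n: "\<not> u \<sim> w"
  shows "u \<sim> v \<or> w \<sim> v"
proof (rule ccontr)
  assume a: "\<not> ?thesis"
  have "Q {x, y, z}" using maximal_clique_triangle w3 t by blast
  moreover have "stable_set G {u, w, v}"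
    using a n adj_in_V[OF o(1)] adj_in_V[OF o(2)] adj_in_V[OF o(3)] by (auto simp: stable_set_def dest: adj_sym)
  ultimately show False using stable_avoids[of "{x, y, z}" "{u, w, v}"] o by auto
qed

text \<open>If both \<open>u\<close> and \<open>w\<close> were adjacent to \<open>v\<close>, the
  mate \<open>v'\<close> of \<open>v\<close> at \<open>z\<close> would also be adjacent to one of
  them, and the edge from \<open>v\<close> to \<open>v'\<close> would lie in a second triangle
  besides the one with \<open>z\<close>.\<close>

lemma outer_triangle_parity:
  assumes t: "x \<sim> y" "x \<sim> z" "y \<sim> z" and o: "u \<sim> x" "w \<sim> y" "v \<sim> z"
    and out: "u \<noteq> z" "w \<noteq> z" "v \<noteq> x" "v \<noteq> y" and n: "\<not> u \<sim> w"
  shows "u \<sim> v \<longleftrightarrow> \<not> w \<sim> v"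
proof -
  have "\<not> (u \<sim> v \<and> w \<sim> v)"
  proof
    assume a: "u \<sim> v \<and> w \<sim> v"
    obtain v' where v': "v \<sim> v'" "v' \<sim> z" using mate_exists[OF w3 o(3)] .
    have "u \<sim> v' \<or> w \<sim> v'" by (rule outer_triangle_cover[OF t o(1,2) v'(2) n])
    moreover have "\<not> u \<sim> v'" using triangle_unique[OF w3, of v v' z u] v' o(3) a out adj_sym by metis
    moreover have "\<not> w \<sim> v'" using triangle_unique[OF w3, of v v' z w] v' o(3) a out adj_sym by metis
    ultimately show False by blast
  qed
  then show ?thesis using outer_triangle_cover[OF t o n] by blast
qed

text \<open>If \<open>w\<close> misses both mates, parity makes it adjacent to every outer neighbor
  \<open>u\<close> of \<open>x\<close>, as \<open>u\<close> cannot be adjacent to both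
  \<open>v\<close> and \<open>v'\<close>. For \<open>u\<close> and its mate at \<open>x\<close> this
  gives a second triangle on their edge.\<close>

lemma outer_meets_mates:
  assumes t: "x \<sim> y" "x \<sim> z" "y \<sim> z" and w: "w \<sim> y" "w \<noteq> x" "w \<noteq> z"
    and v: "v \<sim> z" "v' \<sim> z" "v \<sim> v'" "v \<noteq> x" "v \<noteq> y" "v' \<noteq> x" "v' \<noteq> y"
    and u: "u \<sim> x" "u \<noteq> y" "u \<noteq> z"
  shows "w \<sim> v \<or> w \<sim> v'"
proof (rule ccontr)
  assume a: "\<not> ?thesis"
  have ws: "w \<sim> u" if u: "u \<sim> x" "u \<noteq> y" "u \<noteq> z" for u
  proof -
    have "w \<sim> u \<longleftrightarrow> \<not> v \<sim> u" "w \<sim> u \<longleftrightarrow> \<not> v' \<sim> u"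
      using outer_triangle_parity[of y z x w v u] outer_triangle_parity[of y z x w v' u] t w v u a adj_sym
      by metis+
    moreover have "\<not> (v \<sim> u \<and> v' \<sim> u)" using triangle_unique[OF w3, of v v' z u] v u by metis
    ultimately show ?thesis by blast
  qed
  obtain u' where u': "u \<sim> u'" "u' \<sim> x" using mate_exists[OF w3 u(1)] .
  have "u' \<noteq> y" "u' \<noteq> z"
    using triangle_unique[OF w3, of x y z u] triangle_unique[OF w3, of x z y u] t u u' adj_sym by metis+
  then have "w \<sim> u" "w \<sim> u'" using ws u u' by auto
  then show False using triangle_unique[OF w3, of u u' x w] u u' w adj_sym by metis
qed

text \<open>For \<open>k \<ge> 5\<close> the vertex \<open>z\<close> has two disjoint pairs of outer
  mates, so an outer neighbor \<open>w\<close> of \<open>y\<close> is adjacent to two outer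
  neighbors \<open>v1\<close>, \<open>v2\<close> of \<open>z\<close>, and also to an outer neighbor
  \<open>u1\<close> of \<open>x\<close>. Parity joins \<open>u1\<close> to both, and the edge from
  \<open>u1\<close> to \<open>w\<close> lies in two triangles.\<close>

lemma valency_of_omega_3: assumes "\<omega> \<noteq> k + 1" shows "k = 4"
proof (rule ccontr)
  assume "k \<noteq> 4"
  then have k: "5 \<le> k" using omega_bounds[OF assms] w3 by simp
  obtain x where "x \<in> V" using V_nonempty by blast
  then obtain C where C: "Q C" using vertex_in_maximal_clique by blast
  then obtain x y z where xyz: "C = {x, y, z}" "x \<noteq> y" "x \<noteq> z" "y \<noteq> z"
    using maximal_cliqueD(4)[OF C] w3 by (auto simp: card_3_iff)
  have t: "x \<sim> y" "x \<sim> z" "y \<sim> z" using maximal_clique_adj[OF C] xyz by auto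
  have big: "3 \<le> card (N s - C)" if "s \<in> C" for s using card_N_Diff[OF C that] k w3 by simp
  have out: "\<exists>v. v \<sim> s \<and> v \<notin> C \<and> v \<notin> B" if "s \<in> C" "card B \<le> 2" "finite B" for s B
  proof -
    have "card (N s - C) \<le> card B" if "N s - C \<subseteq> B" by (rule card_mono[OF \<open>finite B\<close> that])
    then have "\<not> N s - C \<subseteq> B" using big[OF that(1)] that(2) by linarith
    then obtain v where "v \<in> N s - C" "v \<notin> B" by blast
    then show ?thesis using adj_sym[of s v] by auto
  qed
  obtain u where u: "u \<sim> x" "u \<notin> C" using out[of x "{}"] xyz by auto
  obtain w where w: "w \<sim> y" "w \<notin> C" using out[of y "{}"] xyz by auto
  obtain v where v: "v \<sim> z" "v \<notin> C" using out[of z "{}"] xyz by auto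
  obtain v' where v': "v \<sim> v'" "v' \<sim> z" using mate_exists[OF w3 v(1)] .
  have "card {v, v'} \<le> 2" by (cases "v = v'") auto
  then obtain v3 where v3: "v3 \<sim> z" "v3 \<notin> C" "v3 \<noteq> v" "v3 \<noteq> v'"
    using out[of z "{v, v'}"] xyz by auto
  obtain v4 where v4: "v3 \<sim> v4" "v4 \<sim> z" using mate_exists[OF w3 v3(1)] .
  obtain u' where u': "u \<sim> u'" "u' \<sim> x" using mate_exists[OF w3 u(1)] .
  have nC: "\<not> a \<sim> b" if a: "a \<sim> s" "a \<notin> C" and b: "s \<in> C" "b \<in> C" "s \<noteq> b" for a b s
  proof
    assume ab: "a \<sim> b"
    have "\<not> C \<subseteq> {s, b}" using xyz by auto
    then obtain c where c: "c \<in> C" "c \<noteq> s" "c \<noteq> b" by blast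
    have "s \<sim> b" "s \<sim> c" "b \<sim> c" using maximal_clique_adj[OF C] b c by blast+
    then show False using triangle_unique[OF w3, of s b c a] a ab c adj_sym by blast
  qed
  have mate_out: "a' \<notin> C" if "a \<sim> s" "a \<notin> C" "s \<in> C" "a \<sim> a'" "a' \<sim> s" for a a' s
    using nC[OF that(1-3), of a'] that adj_neq by metis
  have o: "v' \<notin> C" "v4 \<notin> C" "u' \<notin> C"
    using mate_out[OF v _ v'] mate_out[OF v3(1,2) _ v4] mate_out[OF u _ u'] xyz by auto
  have d: "v4 \<noteq> v" "v4 \<noteq> v'"
    using triangle_unique[OF w3, of v z v' v3] triangle_unique[OF w3, of v' z v v3] v v' v3 v4 adj_sym by metis+
  have "w \<sim> v \<or> w \<sim> v'"
    by (rule outer_meets_mates[OF t, where u = u]) (use u w v v' o xyz in auto)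
  moreover have "w \<sim> v3 \<or> w \<sim> v4"
    by (rule outer_meets_mates[OF t, where u = u]) (use u w v3 v4 o xyz in auto)
  ultimately obtain v1 v2 where v12: "w \<sim> v1" "w \<sim> v2" "v1 \<noteq> v2" "v1 \<sim> z" "v2 \<sim> z" "v1 \<notin> C" "v2 \<notin> C"
    using d v v' v3 v4 o by metis
  have "w \<sim> u \<or> w \<sim> u'"
    by (rule outer_meets_mates[of z y x, where u = v]) (use t u w v u' o xyz in \<open>auto intro: adj_sym\<close>)
  then obtain u1 where u1: "u1 \<sim> w" "u1 \<sim> x" "u1 \<notin> C" using u u' o adj_sym by metis
  have "u1 \<sim> s" if "w \<sim> s" "s \<sim> z" "s \<notin> C" for s
  proof (rule ccontr)
    assume "\<not> u1 \<sim> s"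
    then have "u1 \<sim> w \<longleftrightarrow> \<not> s \<sim> w"
      by (intro outer_triangle_parity[of x z y]) (use t u1 that w xyz in \<open>auto intro: adj_sym\<close>)
    then show False using u1 that adj_sym by blast
  qed
  then have "u1 \<sim> v1" "u1 \<sim> v2" using v12 by auto
  then show False using triangle_unique[OF w3 u1(1), of v1 v2] v12 by blast
qed

end

text \<open>Another maximal clique through \<open>x\<close> has outer part \<open>N x - C\<close>,
  of size \<open>k + 1 - \<omega>\<close>. Two such cliques with a common vertex in \<open>C\<close>
  have the same outer part, so their union is a clique and they coincide. The traces
  \<open>D x \<inter> C\<close> therefore partition \<open>C\<close> into parts of size
  \<open>\<omega> - (k + 1 - \<omega>)\<close>.\<close>

lemma card_Int_dvd:
  assumes ne: "\<omega> \<noteq> k + 1" and C: "Q C"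
    and all: "\<And>x D. x \<in> C \<Longrightarrow> Q D \<Longrightarrow> x \<in> D \<Longrightarrow> D \<noteq> C \<Longrightarrow> N x - C \<subseteq> D"
  shows "(\<omega> - (k + 1 - \<omega>)) dvd \<omega>"
proof -
  note Cf = maximal_cliqueD[OF C]
  have "\<exists>D. Q D \<and> x \<in> D \<and> D \<noteq> C" if "x \<in> C" for x
    using other_maximal_clique_exists[OF ne C that] by blast
  then obtain D where D: "\<And>x. x \<in> C \<Longrightarrow> Q (D x)" "\<And>x. x \<in> C \<Longrightarrow> x \<in> D x" "\<And>x. x \<in> C \<Longrightarrow> D x \<noteq> C"
    by metis
  have out: "D x - C = N s - C" if "x \<in> C" "s \<in> C" "s \<in> D x" for x s
    using all[OF that(2) D(1) that(3)] D that maximal_clique_subset_N[OF D(1)[OF that(1)] that(3)] by blast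
  have eq: "D x = D y" if x: "x \<in> C" and y: "y \<in> C" and s: "s \<in> C" "s \<in> D x" "s \<in> D y" for x y s
  proof -
    have o: "D x - C = D y - C" using out[OF x s(1,2)] out[OF y s(1,3)] by simp
    have cl: "clique G (D x \<union> D y)" unfolding clique_def
    proof (intro conjI ballI impI)
      show "D x \<union> D y \<subseteq> V" using maximal_cliqueD(3)[OF D(1)] x y by blast
      fix u v assume uv: "u \<in> D x \<union> D y" "v \<in> D x \<union> D y" "u \<noteq> v"
      then consider "u \<in> C" "v \<in> C" | "u \<in> D x" "v \<in> D x" | "u \<in> D y" "v \<in> D y" using o by blast
      then show "u \<sim> v" using maximal_clique_adj C D(1)[OF x] D(1)[OF y] uv(3) by cases blast+
    qed
    have "D x \<union> D y = D x" "D x \<union> D y = D y"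
      using D(1)[OF x] D(1)[OF y] cl unfolding maximal_clique_def by (metis Un_upper1, metis Un_upper2)
    then show ?thesis by simp
  qed
  have fin: "finite (D x)" if "x \<in> C" for x using maximal_cliqueD(2) D(1) that by blast
  have cardI: "card (D x \<inter> C) = \<omega> - (k + 1 - \<omega>)" if x: "x \<in> C" for x
  proof -
    have "card (N x - C) = k + 1 - \<omega>" using card_N_Diff[OF C x] by simp
    then have "card (D x - C) = k + 1 - \<omega>" using out[OF x x D(2)[OF x]] by simp
    moreover have "card (D x \<inter> C) + card (D x - C) = \<omega>"
      using card_Int_Diff[OF fin[OF x], of C] maximal_cliqueD(4)[OF D(1)[OF x]] by simp
    ultimately show ?thesis by simp
  qed
  have U: "\<Union>((\<lambda>x. D x \<inter> C) ` C) = C" using D by blast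
  have "(\<omega> - (k + 1 - \<omega>)) * card ((\<lambda>x. D x \<inter> C) ` C) =
      card (\<Union>((\<lambda>x. D x \<inter> C) ` C))"
  proof (rule card_partition)
    show "A \<inter> B = {}"
      if AB: "A \<in> (\<lambda>x. D x \<inter> C) ` C" "B \<in> (\<lambda>x. D x \<inter> C) ` C" "A \<noteq> B" for A B
    proof -
      obtain x y where "x \<in> C" "y \<in> C" "A = D x \<inter> C" "B = D y \<inter> C" using AB by blast
      then show ?thesis using eq[of x y] AB(3) by blast
    qed
  qed (use Cf(2) cardI in \<open>auto simp: U\<close>)
  then have "(\<omega> - (k + 1 - \<omega>)) * card ((\<lambda>x. D x \<inter> C) ` C) = card C"
    unfolding U .
  then show ?thesis using Cf by (metis dvd_triv_left)
qed

lemma outer_eq_if_two: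
  assumes "k = \<omega> + 1" "Q C" "x \<in> C" "Q D" "x \<in> D" "D \<noteq> C"
  shows "D - C = N x - C" "card (D - C) = 2"
proof -
  have c: "card (N x - C) = 2" using card_N_Diff[OF assms(2,3)] assms(1) by simp
  have "2 \<le> card (D - C)" using card_maximal_clique_Diff(1)[OF assms(2,4)] assms by simp
  moreover have sub: "D - C \<subseteq> N x - C"
    using maximal_clique_subset_N[OF assms(4,5)] assms(3) by blast
  ultimately show "D - C = N x - C" using c by (intro card_seteq) auto
  then show "card (D - C) = 2" using c by simp
qed

text \<open>With outer degree 2 the traces on \<open>C\<close> have size
  \<open>\<omega> - 2\<close>, and \<open>\<omega> - 2\<close> divides \<open>\<omega>\<close> only
  if it divides 2.\<close>

lemma omega_le_4_if_two: assumes "k = \<omega> + 1" shows "\<omega> \<le> 4"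
proof -
  obtain x where "x \<in> V" using V_nonempty by blast
  then obtain C where C: "Q C" using vertex_in_maximal_clique by blast
  have "(\<omega> - (k + 1 - \<omega>)) dvd \<omega>"
    by (rule card_Int_dvd[OF _ C]) (use outer_eq_if_two[OF assms C] assms in auto)
  then have d: "\<omega> - 2 dvd \<omega>" using assms by simp
  have "3 \<le> \<omega>" using omega_bounds assms by simp
  then have "(\<omega> - 2) + 2 = \<omega>" by simp
  then have "\<omega> - 2 dvd (\<omega> - 2) + 2" using d by metis
  then have "\<omega> - 2 dvd 2" by (metis dvd_add_triv_left_iff)
  then show ?thesis using dvd_imp_le[of "\<omega> - 2" 2] by simp
qed

text \<open>The traces of \<open>D\<close> and \<open>E\<close> split \<open>C\<close> into two
  pairs, and \<open>D - C\<close>, \<open>E - C\<close> are two more. In the cyclic order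
  \<open>C \<inter> D\<close>, \<open>C \<inter> E\<close>, \<open>E - C\<close>,
  \<open>D - C\<close> consecutive pairs are completely joined: \<open>E - C\<close> and
  \<open>D - C\<close> because they jointly dominate \<open>C\<close>, the others inside a
  clique.\<close>

lemma graph_iso_C4_K2:
  assumes w4: "\<omega> = 4" and k5: "k = 5"
  shows "graph_iso G (lex_product (cycle_graph 4) (complete_graph 2))"
proof -
  have ne: "\<omega> \<noteq> k + 1" and k: "k = \<omega> + 1" using w4 k5 by auto
  obtain x where "x \<in> V" using V_nonempty by blast
  then obtain C where C: "Q C" "x \<in> C" using vertex_in_maximal_clique by blast
  note Cf = maximal_cliqueD[OF C(1)]
  have Int2: "card (C \<inter> D) = 2" "card (D - C) = 2" if "s \<in> C" "Q D" "s \<in> D" "D \<noteq> C" for s D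
  proof -
    show c: "card (D - C) = 2" using outer_eq_if_two(2)[OF k C(1) that] .
    show "card (C \<inter> D) = 2"
      using card_maximal_clique_Diff(2)[OF C(1) that(2)] card_Int_maximal_cliques[OF C(1) that(2)] that c w4
      by auto
  qed
  obtain D where D: "Q D" "x \<in> D" "D \<noteq> C"
    using other_maximal_clique_exists[OF ne C] by blast
  have "card (C - D) = 2"
    using card_Diff_subset_Int[of C D] Int2(1)[OF C(2) D] Cf w4 by simp
  then obtain y where "y \<in> C - D" using card_pos_obtain[of "C - D"] by auto
  then have y: "y \<in> C" "y \<notin> D" by auto
  obtain E where E: "Q E" "y \<in> E" "E \<noteq> C"
    using other_maximal_clique_exists[OF ne C(1) y(1)] by blast
  note trace = trace_le[OF C(1), unfolded w4]
  \<comment> \<open>A common vertex would force equal outer parts; a vertex \<open>u\<close> there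
    would be adjacent to \<open>y\<close> and to the pair \<open>C \<inter> D\<close>, three
    vertices of \<open>C\<close>, against the trace bound 2.\<close>
  have DE: "C \<inter> D \<inter> E = {}"
  proof (rule ccontr)
    assume "\<not> ?thesis"
    then obtain s where s: "s \<in> C" "s \<in> D" "s \<in> E" by blast
    then have eq: "D - C = E - C"
      using outer_eq_if_two(1)[OF k C(1) s(1)] D E by metis
    obtain u where u: "u \<in> D - C" using Int2(2)[OF C(2) D] card_pos_obtain[of "D - C"] by auto
    have "card (insert y (C \<inter> D)) + 2 \<le> 4"
    proof (rule trace[of u])
      show "u \<in> V" using u maximal_cliqueD(3)[OF D(1)] by blast
      fix z assume "z \<in> insert y (C \<inter> D)"
      then show "z \<sim> u"
        using u eq y E(2) maximal_clique_adj[OF D(1), of z u] maximal_clique_adj[OF E(1), of y u] by blast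
    qed (use u y in auto)
    then show False using Int2(1)[OF C(2) D] y Cf by simp
  qed
  have SE: "C \<inter> E = C - D"
    by (rule card_seteq) (use DE Cf Int2(1)[OF y(1) E] \<open>card (C - D) = 2\<close> in auto)
  have UW: "(D - C) \<inter> (E - C) = {}"
  proof (rule ccontr)
    assume "\<not> ?thesis"
    then obtain u where u: "u \<in> D" "u \<in> E" "u \<notin> C" by blast
    have "card C + 2 \<le> 4"
    proof (rule trace[of u])
      show "u \<in> V" using u maximal_cliqueD(3)[OF D(1)] by blast
      fix z assume "z \<in> C"
      then show "z \<sim> u"
        using u SE maximal_clique_adj[OF D(1), of z u] maximal_clique_adj[OF E(1), of z u] by blast
    qed (use u in auto)
    then show False using Cf w4 by simp
  qed
  have join: "u \<sim> w" "w \<sim> u" if "u \<in> D - C" "w \<in> E - C" for u w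
  proof -
    show "u \<sim> w"
    proof (rule adj_of_cover[OF C(1)])
      show "u \<in> V" "w \<in> V" using that maximal_cliqueD(3)[OF D(1)] maximal_cliqueD(3)[OF E(1)] by blast+
      fix z assume "z \<in> C"
      then show "z \<sim> u \<or> z \<sim> w"
        using that SE maximal_clique_adj[OF D(1), of z u] maximal_clique_adj[OF E(1), of z w] by blast
    qed
    then show "w \<sim> u" by (rule adj_sym)
  qed
  define A where "A i = (if i = 0 then C \<inter> D else if i = 1 then C \<inter> E else if i = 2 then E - C else D - C)"
    for i :: nat
  have lt4: "i = 0 \<or> i = 1 \<or> i = 2 \<or> i = 3" if "i < 4" for i :: nat using that by auto
  have par: "(i, j) \<in> parcs (cycle_graph 4) \<longleftrightarrow>
      (i, j) \<in> {(0, 1), (1, 2), (2, 3), (3, 0), (1, 0), (2, 1), (3, 2), (0, 3)}" for i j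
  proof -
    have lt: "i < 4 \<longleftrightarrow> i = 0 \<or> i = 1 \<or> i = 2 \<or> i = 3" for i :: nat by auto
    have "i < 4 \<and> j < 4 \<and> (j = Suc i mod 4 \<or> i = Suc j mod 4) \<longleftrightarrow>
        (i, j) \<in> {(0, 1), (1, 2), (2, 3), (3, 0), (1, 0), (2, 1), (3, 2), (0, 3)}"
      unfolding lt by auto
    then show ?thesis by (simp only: cycle_graph_def pair_pre_digraph.simps mem_Collect_eq prod.case)
  qed
  show ?thesis
  proof (rule graph_iso_blowup[where A = A])
    show "pair_wf_digraph (cycle_graph 4)" by unfold_locales (auto simp: cycle_graph_def)
    show "finite (pverts (cycle_graph 4))" "pverts (cycle_graph 4) \<noteq> {}"
      by (auto simp: cycle_graph_def lessThan_empty_iff)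
    show "(i, i) \<notin> parcs (cycle_graph 4)" for i using par by auto
    fix i assume "i \<in> pverts (cycle_graph 4)"
    then have i: "i = 0 \<or> i = 1 \<or> i = 2 \<or> i = 3" using lt4 by (simp add: cycle_graph_def)
    show "card (A i) = 2"
      using i Int2[OF C(2) D] Int2[OF y(1) E] by (auto simp: A_def)
    have "{j. (i, j) \<in> parcs (cycle_graph 4)} =
        (if i = 0 then {1, 3} else if i = 1 then {0, 2} else if i = 2 then {1, 3} else {0, 2})"
      using i par by auto
    then show "2 * card {j. (i, j) \<in> parcs (cycle_graph 4)} + 1 = k" using k5 by auto
    fix j assume "j \<in> pverts (cycle_graph 4)"
    then have j: "j = 0 \<or> j = 1 \<or> j = 2 \<or> j = 3" using lt4 by (simp add: cycle_graph_def)
    show "A i \<inter> A j = {}" if "i \<noteq> j"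
      using i j that DE UW unfolding A_def by fastforce
    fix u v assume ij: "i = j \<or> (i, j) \<in> parcs (cycle_graph 4)" and uv: "u \<in> A i" "v \<in> A j" "u \<noteq> v"
    have "u \<in> C \<and> v \<in> C \<or> u \<in> D \<and> v \<in> D \<or> u \<in> E \<and> v \<in> E
      \<or> u \<in> D - C \<and> v \<in> E - C \<or> v \<in> D - C \<and> u \<in> E - C"
      using i ij[unfolded par] uv(1,2) by (elim disjE) (simp_all add: A_def, auto simp: A_def)
    then show "u \<sim> v"
      using maximal_clique_adj[OF C(1), of u v] maximal_clique_adj[OF D(1), of u v]
        maximal_clique_adj[OF E(1), of u v] uv(3) join by blast
  qed
qed

section \<open>Large intersections for \<open>\<omega> = 4\<close>, \<open>k = 6\<close> and for
  \<open>\<omega> = 5\<close>, \<open>k = 7\<close>\<close>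

lemma quad_absorbs:
  assumes "\<omega> = 4" "Q C" "a \<in> C" "b \<in> C" "c \<in> C" "a \<noteq> b" "a \<noteq> c" "b \<noteq> c"
    "a \<sim> v" "b \<sim> v" "c \<sim> v"
  shows "v \<in> C"
proof (rule ccontr)
  assume "v \<notin> C"
  then have "card {a, b, c} + 2 \<le> \<omega>"
    using assms adj_in_V(2)[OF assms(9)] by (intro trace_le[of C v]) auto
  then show False using assms by simp
qed

lemma quad_third:
  assumes "\<omega> = 4" "Q C" "a \<in> C" "b \<in> C" "a \<noteq> b"
  obtains c d where "C = {a, b, c, d}" "c \<noteq> a" "c \<noteq> b" "d \<noteq> a" "d \<noteq> b" "c \<noteq> d"
proof -
  note C = maximal_cliqueD[OF assms(2)]
  have "card (C - {a, b}) = 2" using C assms by (simp add: card_Diff_subset)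
  then obtain c d where "C - {a, b} = {c, d}" "c \<noteq> d" by (auto simp: card_2_iff)
  then show thesis using that[of c d] assms by blast
qed

text \<open>If \<open>C\<close> and \<open>D\<close> share the edge from \<open>x\<close> to
  \<open>y\<close>, they leave a single further neighbor \<open>t\<close> of \<open>x\<close>. A
  clique through \<open>x\<close> and \<open>t\<close> takes its other vertices from
  \<open>C \<union> D\<close>. If \<open>y\<close> is among them, or both come from the same clique,
  \<open>t\<close> is adjacent to three vertices of \<open>C\<close> or of \<open>D\<close>; if one
  comes from each, the one in \<open>D\<close> is adjacent to three vertices of
  \<open>C\<close>.\<close>

lemma meet_if_omega_4_valency_6:
  assumes w4: "\<omega> = 4" and k6: "k = 6" and Q: "Q C" "Q D" "C \<noteq> D"
  shows "card (C \<inter> D) \<le> 1"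
proof (rule ccontr)
  assume "\<not> ?thesis"
  then have c2: "card (C \<inter> D) = 2" using card_Int_maximal_cliques[OF Q] w4 by simp
  note C = maximal_cliqueD[OF Q(1)] and D = maximal_cliqueD[OF Q(2)]
  obtain x y where xy: "C \<inter> D = {x, y}" "x \<noteq> y" using c2 by (auto simp: card_2_iff)
  have x: "x \<in> C" "x \<in> D" and y: "y \<in> C" "y \<in> D" using xy by auto
  have "card (N x - C) = 3" using card_N_Diff[OF Q(1) x(1)] w4 k6 by simp
  moreover have "card (D - C) = 2"
    using card_maximal_clique_Diff(2)[OF Q(1,2)] Q(3) c2 w4 by simp
  ultimately have "\<not> N x - C \<subseteq> D - C" using card_mono[of "D - C" "N x - C"] D by auto
  then obtain t where "t \<in> N x - C" "t \<notin> D - C" by blast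
  then have t: "x \<sim> t" "t \<notin> C" "t \<notin> D" by auto
  obtain F where F: "Q F" "x \<in> F" "t \<in> F" using edge_in_maximal_clique t by blast
  have "N x \<subseteq> insert t (C \<union> D - {x})"
  proof -
    have sub: "insert t (C \<union> D - {x}) \<subseteq> N x"
      using maximal_clique_subset_N[OF Q(1) x(1)] maximal_clique_subset_N[OF Q(2) x(2)] t(1) by auto
    have "card (C \<union> D) = 6" using card_Un_Int[OF C(2) D(2)] C D c2 w4 by simp
    then have "card (insert t (C \<union> D - {x})) = 6"
      using C D x t by (simp add: card_insert_if)
    moreover have "card (N x) = 6" using card_N[of x] C x k6 by blast
    ultimately have "insert t (C \<union> D - {x}) = N x" by (intro card_seteq[OF finite_N sub]) simp
    then show ?thesis by simp
  qed
  moreover obtain q r where qr: "F = {x, t, q, r}" "q \<noteq> x" "q \<noteq> t" "r \<noteq> x" "r \<noteq> t" "q \<noteq> r"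
    using quad_third[OF w4 F(1,2,3)] t(1) adj_neq by metis
  moreover have adjF: "x \<sim> q" "x \<sim> r" "q \<sim> t" "r \<sim> t" "q \<sim> r" "r \<sim> q"
    using maximal_clique_adj[OF F(1)] qr by auto
  ultimately have qrCD: "q \<in> C \<union> D" "r \<in> C \<union> D" by auto
  have yF: "y \<notin> F"
  proof
    assume "y \<in> F"
    then obtain s where s: "s \<in> F" "s \<in> C \<union> D" "s \<noteq> x" "s \<noteq> y" "s \<noteq> t" "y \<noteq> t"
      using qr(1,6) qrCD y t xy(2) qr by blast
    then have "y \<sim> t" "s \<sim> t" using maximal_clique_adj[OF F(1) _ F(3)] \<open>y \<in> F\<close> by auto
    then show False
      using quad_absorbs[OF w4 Q(1), of x y s t] quad_absorbs[OF w4 Q(2), of x y s t] s x y xy(2) t by blast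
  qed
  note qrCD
  moreover have "\<not> (q \<in> C \<and> r \<in> C)" "\<not> (q \<in> D \<and> r \<in> D)"
    using quad_absorbs[OF w4 Q(1), of x q r t] quad_absorbs[OF w4 Q(2), of x q r t] x qr adjF t by metis+
  ultimately consider "q \<in> C" "r \<in> D" "r \<notin> C" | "r \<in> C" "q \<in> D" "q \<notin> C" by blast
  then show False
  proof cases
    case 1
    then have "r \<in> C"
      using quad_absorbs[OF w4 Q(1), of x y q r] x y xy(2) qr adjF yF maximal_clique_adj[OF Q(2) y(2), of r] by blast
    then show False using 1 by blast
  next
    case 2
    then have "q \<in> C"
      using quad_absorbs[OF w4 Q(1), of x y r q] x y xy(2) qr adjF yF maximal_clique_adj[OF Q(2) y(2), of q] by blast
    then show False using 2 by blast
  qed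
qed

text \<open>The outer degree is 3. Once intersections of size 3 are excluded, every other clique
  takes all outer neighbors, and traces of size 2 would partition the five vertices of
  \<open>C\<close>.\<close>

lemma not_omega_5_valency_7:
  assumes w5: "\<omega> = 5" and k7: "k = 7" shows False
proof -
  have ne: "\<omega> \<noteq> k + 1" using w5 k7 by simp
  have c3: "card (N s - C) = 3" if "Q C" "s \<in> C" for C s
    using card_N_Diff[OF that] w5 k7 by simp
  \<comment> \<open>For three common vertices, a second clique \<open>E\<close> through
    \<open>p\<close> in \<open>C - D\<close> meets \<open>C\<close> exactly in \<open>C - D\<close>;
    then \<open>E - C\<close> has three vertices and is joined to \<open>D - C\<close>, which fills
    the neighborhood of each \<open>b\<close> in \<open>D - C\<close>. The third outer neighbor
    \<open>t\<close> of \<open>x\<close> is adjacent to some such \<open>b\<close>, so it lies in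
    \<open>E\<close>, and a clique through \<open>x\<close>, \<open>p\<close>, \<open>t\<close>
    contradicts \<open>step1\<close>.\<close>
  have meet: "card (C \<inter> D) \<le> 2" if Q: "Q C" "Q D" "C \<noteq> D" for C D
  proof (rule ccontr)
    assume "\<not> ?thesis"
    then have c: "card (C \<inter> D) = 3" using card_Int_maximal_cliques[OF Q] w5 by simp
    note C = maximal_cliqueD[OF Q(1)] and D = maximal_cliqueD[OF Q(2)]
    note trace = trace_le[OF Q(1), unfolded w5]
    have DC: "card (D - C) = 2" using card_maximal_clique_Diff(2)[OF Q] c w5 by simp
    have CD: "card (C - D) = 2" using card_Diff_subset_Int[of C D] C c w5 by simp
    have no: "\<not> p \<sim> b" if p: "p \<in> C - D" and b: "b \<in> D - C" for p b
    proof
      assume pb: "p \<sim> b"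
      have "card (insert p (C \<inter> D)) + 2 \<le> 5"
      proof (rule trace[of b])
        fix z assume "z \<in> insert p (C \<inter> D)"
        then show "z \<sim> b" using pb b maximal_clique_adj[OF Q(2), of z b] by blast
      qed (use p b D in auto)
      then show False using c p C by simp
    qed
    have step1: "E \<inter> (C \<inter> D) = {}" if E: "Q E" "E \<noteq> C" "p \<in> E" and p: "p \<in> C - D" for E p
    proof (rule ccontr)
      assume "\<not> ?thesis"
      then obtain s where s: "s \<in> E" "s \<in> C" "s \<in> D" by blast
      have "E - C \<subseteq> N s - C" "D - C \<subseteq> N s - C"
        using maximal_clique_subset_N[OF E(1) s(1)] maximal_clique_subset_N[OF Q(2) s(3)] s(2) by blast+
      moreover have "2 \<le> card (E - C)" using card_maximal_clique_Diff(1)[OF Q(1) E(1)] E(2) by simp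
      ultimately have "(E - C) \<inter> (D - C) \<noteq> {}"
        using card_mono[of "N s - C" "(E - C) \<union> (D - C)"] card_Un_disjoint[of "E - C" "D - C"] c3[OF Q(1) s(2)] DC
          maximal_cliqueD(2)[OF E(1)] D by fastforce
      then obtain b where b: "b \<in> E" "b \<in> D - C" by blast
      then have "p \<sim> b" using maximal_clique_adj[OF E(1,3), of b] p by blast
      then show False using no p b by blast
    qed
    obtain p where p: "p \<in> C - D" using CD card_pos_obtain[of "C - D"] by auto
    obtain E where E: "Q E" "p \<in> E" "E \<noteq> C" "E - C \<subseteq> N p - C"
      using other_maximal_clique_exists[OF ne Q(1), of p] p by blast
    note Ef = maximal_cliqueD[OF E(1)]
    have "card (E - C) \<le> 3" using card_mono[OF _ E(4)] c3[OF Q(1), of p] p by simp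
    moreover have "card (C \<inter> E) + card (E - C) = 5"
      using card_Int_Diff[OF Ef(2), of C] Ef w5 by (simp add: Int_commute)
    ultimately have "2 \<le> card (C \<inter> E)" by simp
    moreover have CE: "C \<inter> E \<subseteq> C - D" using step1[OF E(1,3,2) p] by blast
    ultimately have eq: "C \<inter> E = C - D" using CD C by (intro card_seteq) auto
    then have W: "card (E - C) = 3" using \<open>card (C \<inter> E) + card (E - C) = 5\<close> CD by simp
    have WD: "(E - C) \<inter> (D - C) = {}"
      using no[OF p] maximal_clique_adj[OF E(1,2)] p by blast
    have join: "b \<sim> w" if "b \<in> D - C" "w \<in> E - C" for b w
    proof (rule adj_of_cover[OF Q(1)])
      show "b \<in> V" "w \<in> V" using that D Ef by blast+
      fix z assume "z \<in> C"
      then show "z \<sim> b \<or> z \<sim> w"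
        using that eq maximal_clique_adj[OF Q(2), of z b] maximal_clique_adj[OF E(1), of z w] by blast
    qed
    obtain x where "x \<in> C \<inter> D" using c card_pos_obtain[of "C \<inter> D"] by auto
    then have x: "x \<in> C" "x \<in> D" by auto
    have "\<not> N x - C \<subseteq> D - C" using c3[OF Q(1) x(1)] DC card_mono[of "D - C" "N x - C"] D by auto
    then obtain t where "t \<in> N x - C" "t \<notin> D - C" by blast
    then have t: "x \<sim> t" "t \<notin> C" "t \<notin> D" by auto
    obtain F where F: "Q F" "x \<in> F" "t \<in> F" "F \<noteq> C" "F - C \<subseteq> N x - C"
      using other_maximal_clique[OF Q(1) x(1) t(1,2)] by blast
    have "2 \<le> card (F - C)" using card_maximal_clique_Diff(1)[OF Q(1) F(1)] F(4) by simp
    moreover have DN: "D - C \<subseteq> N x - C" using maximal_clique_subset_N[OF Q(2) x(2)] x(1) by blast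
    ultimately have "(F - C) \<inter> (D - C) \<noteq> {}"
      using card_mono[of "N x - C" "(F - C) \<union> (D - C)"] card_Un_disjoint[of "F - C" "D - C"] c3[OF Q(1) x(1)] DC
        maximal_cliqueD(2)[OF F(1)] D F(5) by fastforce
    then obtain b where b: "b \<in> F" "b \<in> D - C" by blast
    have "b \<sim> t" using maximal_clique_adj[OF F(1) b(1) F(3)] b t by blast
    have sub: "(D - {b}) \<union> (E - C) \<subseteq> N b"
      using maximal_clique_subset_N[OF Q(2), of b] join[OF b(2)] b by auto
    have "(D - {b}) \<inter> (E - C) = {}" using WD by blast
    then have "card ((D - {b}) \<union> (E - C)) = 7"
      using D Ef W b w5 by (subst card_Un_disjoint) auto
    then have "N b = (D - {b}) \<union> (E - C)"
      using card_subset_eq[OF finite_N sub] card_N[of b] b D k7 by auto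
    then have "t \<in> E - C" using \<open>b \<sim> t\<close> t in_N by blast
    then have "p \<sim> t" using maximal_clique_adj[OF E(1,2), of t] p by blast
    have "x \<sim> p" using maximal_clique_adj[OF Q(1) x(1), of p] p x by blast
    obtain E' where E': "Q E'" "x \<in> E'" "p \<in> E'" "t \<in> E'"
      using triangle_in_maximal_clique[OF \<open>x \<sim> p\<close> t(1) \<open>p \<sim> t\<close>] by blast
    then show False using step1[OF E'(1) _ E'(3) p] t x by blast
  qed
  obtain x where "x \<in> V" using V_nonempty by blast
  then obtain C where C: "Q C" using vertex_in_maximal_clique by blast
  have "(\<omega> - (k + 1 - \<omega>)) dvd \<omega>"
  proof (rule card_Int_dvd[OF ne C])
    fix x D assume a: "x \<in> C" "Q D" "x \<in> D" "D \<noteq> C"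
    have "3 \<le> card (D - C)"
      using card_maximal_clique_Diff(2)[OF C a(2)] meet[OF C a(2)] a(4) w5 by simp
    moreover have "D - C \<subseteq> N x - C" using maximal_clique_subset_N[OF a(2,3)] a(1) by blast
    ultimately have "D - C = N x - C" using c3[OF C a(1)] by (intro card_seteq) auto
    then show "N x - C \<subseteq> D" by blast
  qed
  then show False using w5 k7 by simp
qed

section \<open>Cliques of size 4 in graphs of valency 7\<close>

text \<open>For \<open>\<omega> = 4\<close> and valency 7 the neighborhood of a vertex x consists of three triangles, which
  either share a vertex c (a windmill) or form a path with the middle triangle a, p, b.\<close>

definition windmill where
  "windmill x c u u' v v' w w' \<longleftrightarrow> distinct [x, c, u, u', v, v', w, w'] \<and>
    N x = {c, u, u', v, v', w, w'} \<and> Q {x, c, u, u'} \<and> Q {x, c, v, v'} \<and> Q {x, c, w, w'}"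

definition triangle_path where
  "triangle_path x a a1 a2 p b b1 b2 \<longleftrightarrow> distinct [x, a, a1, a2, p, b, b1, b2] \<and>
    N x = {a, a1, a2, p, b, b1, b2} \<and> Q {x, a, a1, a2} \<and> Q {x, a, p, b} \<and> Q {x, b, b1, b2}"

end

section \<open>Valency 7: shapes of the neighborhoods, and windmills\<close>

locale uniform_cis_graph_7 = uniform_cis_graph +
  assumes w4: "\<omega> = 4" and k7: "k = 7"
begin

lemma quad_unique:
  assumes "Q C" "Q D" "a \<in> C" "b \<in> C" "c \<in> C" "a \<in> D" "b \<in> D" "c \<in> D" "a \<noteq> b" "a \<noteq> c" "b \<noteq> c"
  shows "C = D"
  by (rule maximal_clique_unique[OF assms(1,2), of "{a, b, c}"]) (use assms w4 in auto)

text \<open>If two maximal cliques meet only in \<open>x\<close>, they cover six of its seven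
  neighbors, and the clique through the seventh takes one vertex from each: a path. Otherwise any
  two maximal cliques through \<open>x\<close> share an edge at \<open>x\<close>; if these edges
  were not all the same, some vertex would be adjacent to three vertices of a maximal clique not
  containing it.\<close>

lemma local_structure:
  assumes x: "x \<in> V"
  shows "(\<exists>c u u' v v' w w'. windmill x c u u' v v' w w') \<or>
    (\<exists>a a1 a2 p b b1 b2. triangle_path x a a1 a2 p b b1 b2)"
proof (cases "\<exists>C D. Q C \<and> Q D \<and> C \<inter> D = {x}")
  case True
  then obtain C D where Q: "Q C" "Q D" and CD: "C \<inter> D = {x}" by blast
  note C = maximal_cliqueD[OF Q(1)] and D = maximal_cliqueD[OF Q(2)]
  have xC: "x \<in> C" and xD: "x \<in> D" using CD by auto
  have sub: "C \<union> D - {x} \<subseteq> N x"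
    using maximal_clique_subset_N[OF Q(1) xC] maximal_clique_subset_N[OF Q(2) xD] by blast
  have "card (C \<union> D) = 7" using card_Un_Int[OF C(2) D(2)] C D CD w4 by simp
  then have 6: "card (C \<union> D - {x}) = 6" using xC C D by simp
  have 7: "card (N x) = 7" using card_N[OF x] k7 by simp
  have "card (N x - (C \<union> D - {x})) = 1"
    using card_Diff_subset[OF _ sub] C D 6 7 by simp
  then obtain p where "N x - (C \<union> D - {x}) = {p}" by (auto simp: card_1_singleton_iff)
  then have Nx: "N x = insert p (C \<union> D - {x})" and p: "p \<notin> C" "p \<notin> D" "x \<sim> p"
    using sub adj_neq[of x p] in_N[of p x] by auto
  obtain F where F: "Q F" "x \<in> F" "p \<in> F" using edge_in_maximal_clique p by blast
  have xp: "x \<noteq> p" using p xC by auto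
  obtain q r where qr: "F = {x, p, q, r}" "q \<noteq> x" "q \<noteq> p" "r \<noteq> x" "r \<noteq> p" "q \<noteq> r"
    using quad_third[OF w4 F xp] by metis
  have adj: "x \<sim> q" "x \<sim> r" "q \<sim> p" "r \<sim> p"
    using maximal_clique_adj[OF F(1)] qr xp by auto
  then have "q \<in> C \<union> D" "r \<in> C \<union> D" using Nx qr in_N by blast+
  moreover have "\<not> (q \<in> C \<and> r \<in> C)" "\<not> (q \<in> D \<and> r \<in> D)"
    using quad_absorbs[OF w4 Q(1), of x q r p] quad_absorbs[OF w4 Q(2), of x q r p] xC xD qr adj p by metis+
  ultimately obtain a b where ab: "a \<in> C" "b \<in> D" "a \<noteq> x" "b \<noteq> x" "F = {x, a, p, b}"
    using qr by (metis Un_iff insert_commute)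
  obtain a1 a2 where a12: "C = {x, a, a1, a2}" "a1 \<noteq> x" "a1 \<noteq> a" "a2 \<noteq> x" "a2 \<noteq> a" "a1 \<noteq> a2"
    using quad_third[OF w4 Q(1) xC ab(1)] ab by metis
  obtain b1 b2 where b12: "D = {x, b, b1, b2}" "b1 \<noteq> x" "b1 \<noteq> b" "b2 \<noteq> x" "b2 \<noteq> b" "b1 \<noteq> b2"
    using quad_third[OF w4 Q(2) xD ab(2)] ab by metis
  have dist: "distinct [x, a, a1, a2, p, b, b1, b2]"
    using CD ab a12 b12 p xp by auto
  have "triangle_path x a a1 a2 p b b1 b2"
    unfolding triangle_path_def
  proof (intro conjI)
    show "N x = {a, a1, a2, p, b, b1, b2}" unfolding Nx a12(1) b12(1) using dist by auto
    show "Q {x, a, a1, a2}" "Q {x, a, p, b}" "Q {x, b, b1, b2}"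
      using Q F(1) ab(5) a12(1) b12(1) by auto
  qed (rule dist)
  then show ?thesis by blast
next
  case False
  obtain C where C: "Q C" "x \<in> C" using vertex_in_maximal_clique x by blast
  note Cf = maximal_cliqueD[OF C(1)]
  have "card (N x - C) = 4" using card_N_Diff[OF C] w4 k7 by simp
  then obtain z where "z \<in> N x - C" using card_pos_obtain[of "N x - C"] by auto
  then obtain D where D: "Q D" "x \<in> D" "z \<in> D" "D \<noteq> C"
    using other_maximal_clique[OF C, of z] in_N by (metis DiffE)
  note Df = maximal_cliqueD[OF D(1)]
  have "C \<inter> D \<noteq> {x}" using False C D by blast
  then obtain c where c: "c \<in> C" "c \<in> D" "c \<noteq> x" using C D by blast
  obtain u u' where u: "C = {x, c, u, u'}" "u \<noteq> x" "u \<noteq> c" "u' \<noteq> x" "u' \<noteq> c" "u \<noteq> u'"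
    using quad_third[OF w4 C c(1)] c by metis
  obtain v v' where v: "D = {x, c, v, v'}" "v \<noteq> x" "v \<noteq> c" "v' \<noteq> x" "v' \<noteq> c" "v \<noteq> v'"
    using quad_third[OF w4 D(1,2) c(2)] c by metis
  have CD: "C \<inter> D = {x, c}"
  proof -
    have "y = x \<or> y = c" if "y \<in> C" "y \<in> D" for y
      using quad_unique[OF C(1) D(1), of x c y] C D c that by blast
    then show ?thesis using C D c by blast
  qed
  have sub: "C \<union> D - {x} \<subseteq> N x"
    using maximal_clique_subset_N[OF C] maximal_clique_subset_N[OF D(1,2)] by blast
  have "card (C \<union> D) = 6" using card_Un_Int[OF Cf(2) Df(2)] Cf Df CD c w4 by simp
  then have 5: "card (C \<union> D - {x}) = 5" using C Cf Df by simp
  have "card (N x - (C \<union> D - {x})) = 2"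
    using card_Diff_subset[OF _ sub] Cf Df 5 card_N[OF x] k7 by simp
  then obtain w w' where w: "N x - (C \<union> D - {x}) = {w, w'}" "w \<noteq> w'" by (auto simp: card_2_iff)
  have Nx: "N x = {w, w'} \<union> (C \<union> D - {x})" using w sub by blast
  have wx: "w \<in> N x" "w' \<in> N x" "w \<noteq> x" "w' \<noteq> x" using Nx adj_neq[of x x] in_N[of x x] by auto
  have wCD: "w \<notin> C \<union> D" "w' \<notin> C \<union> D" using w wx by blast+
  obtain F where F: "Q F" "x \<in> F" "w \<in> F" using edge_in_maximal_clique[of x w] wx by auto
  have "c \<in> F"
  proof (rule ccontr)
    assume cF: "c \<notin> F"
    have "C \<inter> F \<noteq> {x}" "D \<inter> F \<noteq> {x}" using False C D F by blast+
    then obtain y z where y: "y \<in> C" "y \<in> F" "y \<noteq> x" and z: "z \<in> D" "z \<in> F" "z \<noteq> x"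
      using C D F by blast
    have zC: "z \<notin> C" using CD z cF by blast
    have "x \<sim> z" "c \<sim> z" "y \<sim> z"
      using maximal_clique_adj[OF D(1), of x z] maximal_clique_adj[OF D(1), of c z]
        maximal_clique_adj[OF F(1), of y z] D c y z zC cF by auto
    then show False using quad_absorbs[OF w4 C(1), of x c y z] C c y z cF zC by blast
  qed
  then obtain q r where qr: "F = {x, c, q, r}" "q \<noteq> x" "q \<noteq> c" "r \<noteq> x" "r \<noteq> c" "q \<noteq> r"
    using quad_third[OF w4 F(1,2)] c by metis
  then obtain r where r: "F = {x, c, w, r}" "r \<noteq> x" "r \<noteq> c" "r \<noteq> w"
    using F(3) wCD C c by blast
  have "F \<noteq> C" "F \<noteq> D" using F(3) wCD by auto
  then have "r \<notin> C" "r \<notin> D"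
    using quad_unique[OF F(1) C(1), of x c r] quad_unique[OF F(1) D(1), of x c r] r C(2) D(2) c by auto
  moreover have "x \<sim> r" using maximal_clique_adj[OF F(1,2), of r] r by auto
  ultimately have "r = w'" using Nx r in_N by blast
  then have Qw: "Q {x, c, w, w'}" using F r by simp
  have dist: "distinct [x, c, u, u', v, v', w, w']"
  proof -
    have "u \<notin> D" "u' \<notin> D" using CD u by auto
    then show ?thesis using u v w wx wCD c by auto
  qed
  have "windmill x c u u' v v' w w'" unfolding windmill_def
  proof (intro conjI)
    show "N x = {c, u, u', v, v', w, w'}" unfolding Nx u(1) v(1) using dist by auto
    show "Q {x, c, u, u'}" "Q {x, c, v, v'}" using C(1) D(1) u(1) v(1) by auto
  qed (rule dist Qw)+
  then show ?thesis by blast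
qed

lemma windmill_rotate:
  assumes W: "windmill x c u u' v v' w w'" and q: "x \<sim> q" "q \<noteq> c"
  obtains q' r r' s s' where "windmill x c q q' r r' s s'"
proof -
  have "q \<in> {u, u', v, v', w, w'}" using W q in_N[of q x] unfolding windmill_def by auto
  moreover have "windmill x c u' u v v' w w'" "windmill x c v v' u u' w w'" "windmill x c v' v u u' w w'"
    "windmill x c w w' u u' v v'" "windmill x c w' w u u' v v'"
    using W unfolding windmill_def by (auto simp: insert_commute)
  ultimately show thesis using that W by blast
qed

text \<open>A common neighbor in another triangle of the windmill would be adjacent to
  \<open>x\<close>, \<open>c\<close> and \<open>u\<close>, hence absorbed by their clique. So
  different triangles are joined only through \<open>c\<close>.\<close>

lemma windmill_common:
  assumes W: "windmill x c u u' v v' w w'" and z: "x \<sim> z" "u \<sim> z"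
  shows "z = c \<or> z = u'"
proof -
  have Q: "Q {x, c, u, u'}" and d: "distinct [x, c, u, u', v, v', w, w']"
    and N: "N x = {c, u, u', v, v', w, w'}" and Q2: "Q {x, c, v, v'}" "Q {x, c, w, w'}"
    using W by (simp_all add: windmill_def)
  have "z \<in> {c, u, u', v, v', w, w'}" using z N in_N[of z x] by simp
  then have "z \<in> {x, c, u, u'} \<or> c \<sim> z"
    using maximal_clique_adj[OF Q2(1), of c z] maximal_clique_adj[OF Q2(2), of c z] d by auto
  then have "z \<in> {x, c, u, u'}"
    using quad_absorbs[OF w4 Q, of x c u z] z d by auto
  then show ?thesis using z by auto
qed

text \<open>The three cliques contain \<open>c\<close> as well and already give it seven neighbors,
  so \<open>x\<close> and \<open>c\<close> have the same closed neighborhood.\<close>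

lemma windmill_swap:
  assumes W: "windmill x c u u' v v' w w'" shows "windmill c x u u' v v' w w'"
proof -
  have Q: "Q {x, c, u, u'}" "Q {x, c, v, v'}" "Q {x, c, w, w'}"
    and d: "distinct [x, c, u, u', v, v', w, w']"
    using W by (simp_all add: windmill_def)
  have c: "c \<in> V" using maximal_cliqueD(3)[OF Q(1)] by simp
  have sub: "{x, u, u', v, v', w, w'} \<subseteq> N c"
  proof
    fix z assume "z \<in> {x, u, u', v, v', w, w'}"
    then show "z \<in> N c"
      using maximal_clique_adj[OF Q(1), of c z] maximal_clique_adj[OF Q(2), of c z]
        maximal_clique_adj[OF Q(3), of c z] d by auto
  qed
  have "card {x, u, u', v, v', w, w'} = 7" using d by simp
  then have "{x, u, u', v, v', w, w'} = N c"
    using card_subset_eq[OF finite_N sub] card_N[OF c] k7 by simp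
  then show ?thesis using Q d by (auto simp: windmill_def insert_commute)
qed

lemma triangle_path_sym:
  assumes "triangle_path x a a1 a2 p b b1 b2"
  shows "triangle_path x a a2 a1 p b b1 b2" "triangle_path x b b1 b2 p a a1 a2"
  using assms unfolding triangle_path_def by (auto simp: insert_commute)

text \<open>Another maximal clique \<open>F\<close> through \<open>x\<close> shares at most one more
  vertex with each of the three. With \<open>a\<close> or \<open>b\<close> in it, \<open>F\<close>
  would have at most three vertices, so it contains \<open>p\<close> and a vertex of each end; but
  then \<open>a\<close> is adjacent to three vertices of \<open>F\<close> and absorbed.\<close>

lemma triangle_path_quads:
  assumes P: "triangle_path x a a1 a2 p b b1 b2" and F: "Q F" "x \<in> F"
  shows "F = {x, a, a1, a2} \<or> F = {x, a, p, b} \<or> F = {x, b, b1, b2}"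
proof (rule ccontr)
  assume ne: "\<not> ?thesis"
  have Q: "Q {x, a, a1, a2}" "Q {x, a, p, b}" "Q {x, b, b1, b2}"
    and d: "distinct [x, a, a1, a2, p, b, b1, b2]" and N: "N x = {a, a1, a2, p, b, b1, b2}"
    using P by (simp_all add: triangle_path_def)
  have n1: "\<not> (y \<in> F \<and> z \<in> F)" if "y \<in> {a, a1, a2}" "z \<in> {a, a1, a2}" "y \<noteq> z" for y z
    using quad_unique[OF F(1) Q(1), of x y z] F(2) that d ne by auto
  have n2: "\<not> (y \<in> F \<and> z \<in> F)" if "y \<in> {a, p, b}" "z \<in> {a, p, b}" "y \<noteq> z" for y z
    using quad_unique[OF F(1) Q(2), of x y z] F(2) that d ne by auto
  have n3: "\<not> (y \<in> F \<and> z \<in> F)" if "y \<in> {b, b1, b2}" "z \<in> {b, b1, b2}" "y \<noteq> z" for y z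
    using quad_unique[OF F(1) Q(3), of x y z] F(2) that d ne by auto
  have n: "\<not> (a1 \<in> F \<and> a2 \<in> F)" "\<not> (b1 \<in> F \<and> b2 \<in> F)"
    "a \<in> F \<Longrightarrow> a1 \<notin> F \<and> a2 \<notin> F \<and> p \<notin> F \<and> b \<notin> F"
    "b \<in> F \<Longrightarrow> b1 \<notin> F \<and> b2 \<notin> F \<and> p \<notin> F \<and> a \<notin> F"
    using n1[of a1 a2] n3[of b1 b2] n1[of a a1] n1[of a a2] n2[of a p] n2[of a b]
      n3[of b b1] n3[of b b2] n2[of p b] d by auto
  have sub: "F \<subseteq> {x, a, a1, a2, p, b, b1, b2}"
    using maximal_clique_subset_N[OF F] N by auto
  have no3: "\<not> F \<subseteq> {x, y, z}" for y z
  proof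
    assume "F \<subseteq> {x, y, z}"
    then have "card F \<le> card {x, y, z}" by (intro card_mono) auto
    also have "\<dots> \<le> 3" using card_length[of "[x, y, z]"] by simp
    finally show False using maximal_cliqueD(4)[OF F(1)] w4 by simp
  qed
  have "a \<notin> F"
  proof
    assume "a \<in> F"
    then have "F \<subseteq> {x, a, b1} \<or> F \<subseteq> {x, a, b2}"
      using sub n(2,3) by blast
    then show False using no3 by blast
  qed
  moreover have "b \<notin> F"
  proof
    assume "b \<in> F"
    then have "F \<subseteq> {x, b, a1} \<or> F \<subseteq> {x, b, a2}"
      using sub n(1,4) by blast
    then show False using no3 by blast
  qed
  moreover have "\<exists>y\<in>{a1, a2}. y \<in> F"
  proof (rule ccontr)
    assume "\<not> ?thesis"
    then have "F \<subseteq> {x, p, b1} \<or> F \<subseteq> {x, p, b2}"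
      using sub n(2) calculation by blast
    then show False using no3 by blast
  qed
  moreover have "p \<in> F"
  proof (rule ccontr)
    assume "p \<notin> F"
    then have "F \<subseteq> {x, a1, b1} \<or> F \<subseteq> {x, a1, b2} \<or> F \<subseteq> {x, a2, b1} \<or> F \<subseteq> {x, a2, b2}"
      using sub n(1,2) calculation(1,2) by blast
    then show False using no3 by blast
  qed
  ultimately obtain y where y: "y \<in> {a1, a2}" "y \<in> F" "p \<in> F" "a \<notin> F" by blast
  have "x \<sim> a" "y \<sim> a" "p \<sim> a"
    using maximal_clique_adj[OF Q(1), of x a] maximal_clique_adj[OF Q(1), of y a]
      maximal_clique_adj[OF Q(2), of p a] d y by auto
  then show False using quad_absorbs[OF w4 F(1,2), of y p a] y d by auto
qed

text \<open>Every triangle at \<open>x\<close> lies in one of the three cliques. The sizes, 4 for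
  \<open>a\<close> and \<open>b\<close> and 2 for the others, serve to locate a given vertex on a
  path.\<close>

lemma triangle_path_common:
  assumes P: "triangle_path x a a1 a2 p b b1 b2"
  shows "N x \<inter> N a = {a1, a2, p, b}" "N x \<inter> N b = {a, p, b1, b2}" "N x \<inter> N p = {a, b}"
    "N x \<inter> N a1 = {a, a2}" "N x \<inter> N a2 = {a, a1}" "N x \<inter> N b1 = {b, b2}" "N x \<inter> N b2 = {b, b1}"
proof -
  have Q: "Q {x, a, a1, a2}" "Q {x, a, p, b}" "Q {x, b, b1, b2}"
    and d: "distinct [x, a, a1, a2, p, b, b1, b2]"
    using P by (simp_all add: triangle_path_def)
  have iff: "x \<sim> z \<and> y \<sim> z \<longleftrightarrow> z \<noteq> x \<and> z \<noteq> y \<and>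
    ({y, z} \<subseteq> {a, a1, a2} \<or> {y, z} \<subseteq> {a, p, b} \<or> {y, z} \<subseteq> {b, b1, b2})"
    if y: "x \<sim> y" for y z
  proof
    assume z: "x \<sim> z \<and> y \<sim> z"
    then obtain F where F: "Q F" "x \<in> F" "y \<in> F" "z \<in> F" using triangle_in_maximal_clique y by metis
    then show "z \<noteq> x \<and> z \<noteq> y \<and>
      ({y, z} \<subseteq> {a, a1, a2} \<or> {y, z} \<subseteq> {a, p, b} \<or> {y, z} \<subseteq> {b, b1, b2})"
      using triangle_path_quads[OF P F(1,2)] y z by auto
  next
    assume z: "z \<noteq> x \<and> z \<noteq> y \<and>
      ({y, z} \<subseteq> {a, a1, a2} \<or> {y, z} \<subseteq> {a, p, b} \<or> {y, z} \<subseteq> {b, b1, b2})"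
    then obtain F where F: "Q F" "x \<in> F" "y \<in> F" "z \<in> F" using Q by blast
    then show "x \<sim> z \<and> y \<sim> z" using maximal_clique_adj[OF F(1)] z by metis
  qed
  have adj: "x \<sim> y" if "y \<in> {a, a1, a2, p, b, b1, b2}" for y
    using P that in_N[of y x] unfolding triangle_path_def by blast
  have eq: "N x \<inter> N y = {z. z \<noteq> x \<and> z \<noteq> y \<and>
    ({y, z} \<subseteq> {a, a1, a2} \<or> {y, z} \<subseteq> {a, p, b} \<or> {y, z} \<subseteq> {b, b1, b2})}"
    if "y \<in> {a, a1, a2, p, b, b1, b2}" for y
    unfolding set_eq_iff Int_iff in_N mem_Collect_eq using iff[OF adj[OF that]] by blast
  show "N x \<inter> N a = {a1, a2, p, b}" "N x \<inter> N b = {a, p, b1, b2}" "N x \<inter> N p = {a, b}"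
    "N x \<inter> N a1 = {a, a2}" "N x \<inter> N a2 = {a, a1}" "N x \<inter> N b1 = {b, b2}" "N x \<inter> N b2 = {b, b1}"
    by (subst eq; use d in auto)+
qed

text \<open>Both \<open>x\<close> and \<open>c\<close> have only two common neighbors with
  \<open>u\<close>, so neither is \<open>a\<close> or \<open>b\<close>, and \<open>x\<close> is an
  end vertex of the path, say \<open>a1\<close>; then \<open>a\<close> is \<open>u'\<close>.
  Covering \<open>{x, c, u, u'}\<close> joins \<open>b\<close> to \<open>v\<close>,
  \<open>v'\<close>, \<open>w\<close>, \<open>w'\<close>, which with \<open>u\<close>,
  \<open>u'\<close>, \<open>p\<close>, \<open>b1\<close> makes eight neighbors.\<close>

lemma windmill_neighbor:
  assumes W: "windmill x c u u' v v' w w'"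
  shows "\<not> triangle_path u a a1 a2 p b b1 b2"
proof
  assume P: "triangle_path u a a1 a2 p b b1 b2"
  have Q: "Q {x, c, u, u'}" and d: "distinct [x, c, u, u', v, v', w, w']"
    and Nx: "N x = {c, u, u', v, v', w, w'}"
    using W by (simp_all add: windmill_def)
  note Nc = windmill_swap[OF W, unfolded windmill_def]
  have xu: "x \<sim> u" "u \<sim> x" "c \<sim> u" "u \<sim> c" "u \<sim> u'" "x \<sim> c" "x \<sim> u'" "c \<sim> u'"
    using maximal_clique_adj[OF Q] d by auto
  have "z \<in> N u \<inter> N x \<longleftrightarrow> z = c \<or> z = u'" for z
    using windmill_common[OF W, of z] xu by auto
  then have cx: "N u \<inter> N x = {c, u'}" by blast
  have "z \<in> N u \<inter> N c \<longleftrightarrow> z = x \<or> z = u'" for z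
    using windmill_common[OF windmill_swap[OF W], of z] xu adj_sym[of x c] by auto
  then have cc: "N u \<inter> N c = {x, u'}" by blast
  have core: False if P: "triangle_path u a a1 a2 p b b1 b2" and x: "x = a1" for a a1 a2 p b b1 b2
  proof -
    have QP: "Q {u, a, a1, a2}" "Q {u, a, p, b}" "Q {u, b, b1, b2}"
      and dP: "distinct [u, a, a1, a2, p, b, b1, b2]" using P by (simp_all add: triangle_path_def)
    note common = triangle_path_common[OF P]
    have eq: "{a, a2} = {c, u'}" using common(4) cx x by simp
    have "card (N u \<inter> N a) = 4" unfolding common(1) using dP by simp
    moreover have "card (N u \<inter> N c) = 2" unfolding cc using d by simp
    ultimately have "a \<noteq> c" by auto
    then have a: "a = u'" "a2 = c" using eq by (auto simp: doubleton_eq_iff)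
    have p: "z \<notin> N x" if "z \<in> {p, b, b1}" for z
    proof -
      have "z \<in> N u" using P that unfolding triangle_path_def by blast
      moreover have "z \<noteq> c" "z \<noteq> u'" using that dP a by auto
      ultimately show ?thesis using cx by blast
    qed
    have adjs: "u \<sim> p" "u \<sim> b" "u' \<sim> p" "u' \<sim> b" "p \<sim> b" "b \<sim> b1" "b \<sim> u" "b \<sim> u'" "b \<sim> p"
      using maximal_clique_adj[OF QP(2)] maximal_clique_adj[OF QP(3)] dP a by auto
    have sb: "s \<sim> b" if s: "s \<in> {v, v', w, w'}" for s
    proof (rule adj_of_cover[OF Q])
      have "x \<sim> s" "c \<sim> s" using Nx Nc s in_N[of s x] in_N[of s c] by auto
      then show "s \<in> V" "b \<in> V" using adj_in_V adjs by blast+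
      fix z assume "z \<in> {x, c, u, u'}"
      then show "z \<sim> s \<or> z \<sim> b" using \<open>x \<sim> s\<close> \<open>c \<sim> s\<close> adjs by auto
    qed
    have sub: "{u, u', p, v, v', w, w', b1} \<subseteq> N b" using sb adjs adj_sym by auto
    have "p \<notin> {v, v', w, w'}" "b1 \<notin> {v, v', w, w'}" using p Nx by blast+
    then have "distinct [u, u', p, v, v', w, w', b1]" using d dP a by auto
    from distinct_card[OF this] have "card {u, u', p, v, v', w, w', b1} = 8" by simp
    then have "8 \<le> card (N b)" using card_mono[OF finite_N sub] by simp
    then show False using card_N[of b] adj_in_V[OF adjs(2)] k7 by simp
  qed
  have dP: "distinct [u, a, a1, a2, p, b, b1, b2]" and NuP: "N u = {a, a1, a2, p, b, b1, b2}"
    using P by (simp_all add: triangle_path_def)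
  note common = triangle_path_common[OF P]
  have "card (N u \<inter> N a) = 4" "card (N u \<inter> N b) = 4"
    unfolding common using dP by simp_all
  moreover have "card (N u \<inter> N c) = 2" "card (N u \<inter> N x) = 2" unfolding cc cx using d by simp_all
  ultimately have n: "x \<noteq> a" "x \<noteq> b" "c \<noteq> a" "c \<noteq> b" by auto
  \<comment> \<open>For \<open>x = p\<close> the common neighbors \<open>c\<close>,
    \<open>u'\<close> would be \<open>a\<close>, \<open>b\<close>, but \<open>c\<close> is
    neither.\<close>
  have "x \<noteq> p" using common(3) cx n by auto
  then have "x \<in> {a1, a2, b1, b2}" using n xu NuP in_N[of x u] by auto
  then show False
    using core[OF P] core[OF triangle_path_sym(1)[OF P]] core[OF triangle_path_sym(2)[OF P]]
      core[OF triangle_path_sym(1)[OF triangle_path_sym(2)[OF P]]] by blast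
qed

lemma windmill_everywhere:
  assumes W: "windmill x c u u' v v' w w'" and y: "y \<in> V"
  shows "\<exists>c u u' v v' w w'. windmill y c u u' v v' w w'"
proof -
  have "V \<subseteq> {y. \<exists>c u u' v v' w w'. windmill y c u u' v v' w w'}"
  proof (rule connected_closed)
    show "x \<in> {y. \<exists>c u u' v v' w w'. windmill y c u u' v v' w w'}" using W by blast
    have "x \<sim> c" using W in_N[of c x] by (simp add: windmill_def)
    then show "x \<in> V" using adj_in_V by blast
    fix s t assume "s \<in> {y. \<exists>c u u' v v' w w'. windmill y c u u' v v' w w'}" and st: "s \<sim> t"
    then obtain c u u' v v' w w' where S: "windmill s c u u' v v' w w'" by blast
    show "t \<in> {y. \<exists>c u u' v v' w w'. windmill y c u u' v v' w w'}"
    proof (cases "t = c")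
      case True
      then show ?thesis using windmill_swap[OF S] by blast
    next
      case False
      then obtain t' r r' q q' where "windmill s c t t' r r' q q'"
        using windmill_rotate[OF S st] by metis
      from windmill_neighbor[OF this] show ?thesis
        using local_structure[OF adj_in_V(2)[OF st]] by auto
    qed
  qed
  then show ?thesis using y by blast
qed

text \<open>Vertices with the same closed neighborhood form pairs. The windmills at \<open>x\<close>
  and at \<open>u\<close> provide all six: \<open>{x, c}\<close>, \<open>{g, g'}\<close>,
  \<open>{h, h'}\<close> on one side and \<open>{u, u'}\<close>, \<open>{v, v'}\<close>,
  \<open>{w, w'}\<close> on the other.\<close>

lemma graph_iso_K33_K2:
  assumes W: "windmill x c u u' v v' w w'"
  shows "graph_iso G (lex_product (complete_bipartite_graph 3 3) (complete_graph 2))"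
proof -
  have Q: "Q {x, c, u, u'}" "Q {x, c, v, v'}" "Q {x, c, w, w'}"
    and d: "distinct [x, c, u, u', v, v', w, w']" and Nx: "N x = {c, u, u', v, v', w, w'}"
    using W by (simp_all add: windmill_def)
  note W' = windmill_swap[OF W]
  have Nc: "N c = {x, u, u', v, v', w, w'}" using W' by (simp add: windmill_def)
  have xu: "u \<sim> x" "u \<sim> c" "u \<sim> u'" "x \<sim> u" "c \<sim> u" using maximal_clique_adj[OF Q(1)] d by auto
  have vx: "x \<sim> v" "c \<sim> v" using Nx Nc in_N[of v x] in_N[of v c] by auto
  obtain t r r' s s' q q' where U: "windmill u t r r' s s' q q'"
    using windmill_everywhere[OF W adj_in_V(1)[OF xu(1)]] by blast
  have twin: "N t = {u, r, r', s, s', q, q'}" "N u = {t, r, r', s, s', q, q'}"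
    using U windmill_swap[OF U] by (simp_all add: windmill_def)
  have nuv: "\<not> u \<sim> v" using windmill_common[OF W vx(1)] d by auto
  \<comment> \<open>The twin \<open>t\<close> of \<open>u\<close> is \<open>x\<close> or adjacent to
    \<open>x\<close>, so \<open>windmill_common\<close> leaves \<open>x\<close>, \<open>c\<close>
    and \<open>u'\<close>. The first two are adjacent to \<open>v\<close>, which \<open>u\<close> is
    not.\<close>
  have "t = u'"
  proof (rule ccontr)
    assume "t \<noteq> u'"
    have "u \<sim> t" using twin(2) in_N[of t u] by simp
    have "t = x \<or> t = c"
    proof (cases "t = x")
      case False
      then have "x \<in> N t" using twin xu in_N[of x u] by auto
      then show ?thesis using windmill_common[OF W _ \<open>u \<sim> t\<close>] \<open>t \<noteq> u'\<close> adj_sym by auto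
    qed simp
    then have "v \<in> N t" using vx by auto
    then have "v \<in> N u" using twin d by auto
    then show False using nuv by simp
  qed
  then obtain x' g g' h h' where U': "windmill u u' x x' g g' h h'"
    using windmill_rotate[OF U xu(1)] d by (metis distinct_length_2_or_more)
  have QU: "Q {u, u', x, x'}" "Q {u, u', g, g'}" "Q {u, u', h, h'}"
    and dU: "distinct [u, u', x, x', g, g', h, h']" and Nu: "N u = {u', x, x', g, g', h, h'}"
    using U' by (simp_all add: windmill_def)
  have Nu': "N u' = {u, x, x', g, g', h, h'}"
    using windmill_swap[OF U'] by (simp add: windmill_def)
  have "{u, u', x, x'} = {x, c, u, u'}"
    using quad_unique[OF QU(1) Q(1), of x u u'] d by simp
  then have "x' = c" using dU d by (metis distinct_length_2_or_more insert_iff singletonD)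
  have disj: "{g, g', h, h'} \<inter> {x, c, u, u', v, v', w, w'} = {}"
  proof -
    have "z \<notin> N x" if "z \<in> {g, g', h, h'}" for z
    proof
      assume "z \<in> N x"
      moreover have "u \<sim> z" using that Nu in_N[of z u] by auto
      ultimately have "z = c \<or> z = u'" using windmill_common[OF W] by simp
      then show False using that dU \<open>x' = c\<close> by auto
    qed
    then show ?thesis using Nx dU by auto
  qed
  have join: "y \<sim> z" if "y \<in> {g, g', h, h'}" "z \<in> {v, v', w, w'}" for y z
  proof (rule adj_of_cover[OF Q(1)])
    have y: "u \<sim> y" "u' \<sim> y" using that Nu Nu' in_N[of y u] in_N[of y u'] by auto
    have z: "x \<sim> z" "c \<sim> z" using that Nx Nc in_N[of z x] in_N[of z c] by auto
    show "y \<in> V" "z \<in> V" using adj_in_V y z by blast+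
    show "s \<sim> y \<or> s \<sim> z" if "s \<in> {x, c, u, u'}" for s using that y z by auto
  qed
  define L where "L i = (if i = 0 then {x, c} else if i = 1 then {g, g'} else {h, h'})" for i :: nat
  define R where "R i = (if i = 0 then {u, u'} else if i = 1 then {v, v'} else {w, w'})" for i :: nat
  have LR: "y \<sim> z" if "y \<in> L i" "z \<in> R j" for y z i j
  proof -
    have "y \<in> {x, c} \<and> z \<in> {u, u', v, v', w, w'} \<or> y \<in> {g, g', h, h'} \<and> z \<in> {u, u'} \<or>
      y \<in> {g, g', h, h'} \<and> z \<in> {v, v', w, w'}"
      using that by (auto simp: L_def R_def split: if_splits)
    moreover have "y \<sim> z" if "y \<in> {x, c}" "z \<in> {u, u', v, v', w, w'}" using that Nx Nc in_N[of z x] in_N[of z c] by auto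
    moreover have "z \<sim> y" if "y \<in> {g, g', h, h'}" "z \<in> {u, u'}" using that Nu Nu' in_N[of y u] in_N[of y u'] by auto
    ultimately show ?thesis using join adj_sym by blast
  qed
  have pairs: "y \<sim> z" if "y \<in> L i" "z \<in> L i" "y \<noteq> z" for y z i
    using that maximal_clique_adj[OF Q(1), of y z] maximal_clique_adj[OF QU(2), of y z]
      maximal_clique_adj[OF QU(3), of y z] by (auto simp: L_def split: if_splits)
  have pairs': "y \<sim> z" if "y \<in> R i" "z \<in> R i" "y \<noteq> z" for y z i
    using that maximal_clique_adj[OF Q(1), of y z] maximal_clique_adj[OF Q(2), of y z]
      maximal_clique_adj[OF Q(3), of y z] by (auto simp: R_def split: if_splits)
  have cardLR: "card (L i) = 2" "card (R i) = 2" for i using d dU by (auto simp: L_def R_def)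
  have lt3: "i = 0 \<or> i = 1 \<or> i = 2" if "i < 3" for i :: nat using that by auto
  have disjL: "L i \<inter> L j = {}" "R i \<inter> R j = {}" if "i < 3" "j < 3" "i \<noteq> j" for i j
    using lt3[OF that(1)] lt3[OF that(2)] that(3) d dU disj by (auto simp: L_def R_def)
  have disjLR: "L i \<inter> R j = {}" for i j
    using LR[of _ i _ j] adj_irrefl by blast
  let ?H = "complete_bipartite_graph 3 3"
  show ?thesis
  proof (rule graph_iso_blowup[where A = "case_sum L R"])
    show "pair_wf_digraph ?H" by unfold_locales (auto simp: complete_bipartite_graph_def)
    show "finite (pverts ?H)" "pverts ?H \<noteq> {}"
      by (auto simp: complete_bipartite_graph_def lessThan_empty_iff)
    show "(i, i) \<notin> parcs ?H" for i by (auto simp: complete_bipartite_graph_def)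
    fix i assume i: "i \<in> pverts ?H"
    show "card (case_sum L R i) = 2" using cardLR by (cases i) auto
    have "{j. (i, j) \<in> parcs ?H} = (case i of Inl _ \<Rightarrow> Inr ` {..<3} | Inr _ \<Rightarrow> Inl ` {..<3})"
      using i by (auto simp: complete_bipartite_graph_def split: sum.splits)
    then show "2 * card {j. (i, j) \<in> parcs ?H} + 1 = k"
      using k7 by (auto simp: card_image split: sum.splits)
    fix j assume j: "j \<in> pverts ?H"
    show "case_sum L R i \<inter> case_sum L R j = {}" if "i \<noteq> j"
    proof -
      have "(\<exists>a<3. i = Inl a) \<or> (\<exists>a<3. i = Inr a)" "(\<exists>a<3. j = Inl a) \<or> (\<exists>a<3. j = Inr a)"
        using i j by (auto simp: complete_bipartite_graph_def)
      then show ?thesis using disjL disjLR that by (elim disjE exE conjE) (auto simp del: Int_iff, blast+)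
    qed
    fix y z assume "i = j \<or> (i, j) \<in> parcs ?H" "y \<in> case_sum L R i" "z \<in> case_sum L R j" "y \<noteq> z"
    then show "y \<sim> z"
      using LR pairs pairs' adj_sym by (auto simp: complete_bipartite_graph_def split: sum.splits)
  qed
qed

end

section \<open>Valency 7: path neighborhoods and their blocks\<close>

locale triangle_path_cis_graph = uniform_cis_graph_7 +
  assumes all_paths: "x \<in> V \<Longrightarrow> \<exists>a a1 a2 p b b1 b2. triangle_path x a a1 a2 p b b1 b2"
begin

text \<open>Each vertex has exactly two links, to the vertices \<open>a\<close> and \<open>b\<close>
  where consecutive triangles of its path meet; links record the path independently of its
  labelling.\<close>

definition link where
  "link x y \<longleftrightarrow> x \<noteq> y \<and> (\<exists>C D. Q C \<and> Q D \<and> C \<noteq> D \<and> {x, y} \<subseteq> C \<and> {x, y} \<subseteq> D)"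

text \<open>The links turn out to form cycles of length 4, so two steps reach the whole component of
  \<open>x\<close>. It is the middle clique \<open>{x, a, p, b}\<close>.\<close>

definition block where
  "block x = {y. y = x \<or> link x y \<or> (\<exists>z. link x z \<and> link z y)}"

lemma link_sym: "link x y \<Longrightarrow> link y x"
  unfolding link_def by blast

lemma linkI: "Q C \<Longrightarrow> Q D \<Longrightarrow> C \<noteq> D \<Longrightarrow> x \<in> C \<Longrightarrow> y \<in> C \<Longrightarrow> x \<in> D \<Longrightarrow> y \<in> D \<Longrightarrow> x \<noteq> y \<Longrightarrow> link x y"
  unfolding link_def by blast

lemma link_other_quad:
  assumes "link x y" obtains F where "Q F" "x \<in> F" "y \<in> F" "F \<noteq> C"
proof -
  obtain D E where "Q D" "Q E" "D \<noteq> E" "x \<in> D" "y \<in> D" "x \<in> E" "y \<in> E"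
    using assms unfolding link_def by auto
  then show thesis using that[of D] that[of E] by (cases "D = C") auto
qed

lemma triangle_pathD:
  assumes "triangle_path x a a1 a2 p b b1 b2"
  shows "distinct [x, a, a1, a2, p, b, b1, b2]" "N x = {a, a1, a2, p, b, b1, b2}"
    "Q {x, a, a1, a2}" "Q {x, a, p, b}" "Q {x, b, b1, b2}" "x \<in> V" "a \<in> V" "p \<in> V" "b \<in> V" "a1 \<in> V" "a2 \<in> V"
  using assms maximal_cliqueD(3)[of "{x, a, a1, a2}"] maximal_cliqueD(3)[of "{x, a, p, b}"]
  by (simp_all add: triangle_path_def)

lemma link_iff:
  assumes P: "triangle_path x a a1 a2 p b b1 b2"
  shows "link x y \<longleftrightarrow> y = a \<or> y = b"
proof
  note D = triangle_pathD[OF P]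
  assume "link x y"
  then obtain C E where C: "Q C" "x \<in> C" "y \<in> C" and E: "Q E" "x \<in> E" "y \<in> E" and ne: "C \<noteq> E" "x \<noteq> y"
    unfolding link_def by blast
  show "y = a \<or> y = b"
    using triangle_path_quads[OF P C(1,2)] triangle_path_quads[OF P E(1,2)] C(3) E(3) ne D(1) by auto
next
  note D = triangle_pathD[OF P]
  have ne: "{x, a, a1, a2} \<noteq> {x, a, p, b}" "{x, b, b1, b2} \<noteq> {x, a, p, b}"
    using D(1) by (auto simp: set_eq_iff)
  assume "y = a \<or> y = b"
  then show "link x y"
    using linkI[OF D(3,4) ne(1), of x a] linkI[OF D(5,4) ne(2), of x b] D(1) by auto
qed

lemma quad_has_link:
  assumes "Q F" "x \<in> F" shows "\<exists>y\<in>F. link x y"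
proof -
  have "x \<in> V" using maximal_cliqueD(3) assms by blast
  then obtain a a1 a2 p b b1 b2 where P: "triangle_path x a a1 a2 p b b1 b2" using all_paths by blast
  show ?thesis using triangle_path_quads[OF P assms] link_iff[OF P] by auto
qed

lemma links_two: assumes "x \<in> V" "link x y" "link x z" "y \<noteq> z" shows "link x w \<longleftrightarrow> w = y \<or> w = z"
proof -
  obtain a a1 a2 p b b1 b2 where "triangle_path x a a1 a2 p b b1 b2" using all_paths[OF assms(1)] by blast
  from link_iff[OF this] show ?thesis using assms by metis
qed

lemma link_two_quads:
  assumes "link x y" "x \<in> V" "{x, y} \<subseteq> C" "{x, y} \<subseteq> D" "{x, y} \<subseteq> F" "Q C" "Q D" "Q F" "C \<noteq> D"
  shows "F = C \<or> F = D"
proof -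
  obtain a a1 a2 p b b1 b2 where P: "triangle_path x a a1 a2 p b b1 b2" using all_paths[OF assms(2)] by blast
  note d = triangle_pathD(1)[OF P]
  have quads: "F = {x, a, a1, a2} \<or> F = {x, a, p, b} \<or> F = {x, b, b1, b2}" if "Q F" "{x, y} \<subseteq> F" for F
    using triangle_path_quads[OF P that(1)] that(2) by blast
  have "y = a \<or> y = b" using link_iff[OF P] assms(1) by blast
  then show ?thesis
  proof
    assume y: "y = a"
    then have "\<not> {x, y} \<subseteq> {x, b, b1, b2}" using d by auto
    then show ?thesis using quads[of C] quads[of D] quads[of F] assms by metis
  next
    assume y: "y = b"
    then have "\<not> {x, y} \<subseteq> {x, a, a1, a2}" using d by auto
    then show ?thesis using quads[of C] quads[of D] quads[of F] assms by metis
  qed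
qed

text \<open>Since \<open>x\<close> and \<open>p\<close> are the only links of \<open>a\<close>, the
  vertex \<open>a1\<close> must be linked to \<open>a2\<close>; a second clique on that edge has a
  further vertex \<open>e\<close>. Covering \<open>{x, a, a1, a2}\<close> joins \<open>e\<close> to
  \<open>p\<close> and \<open>b\<close>, so the edge from \<open>p\<close> to \<open>b\<close> lies
  in a second clique.\<close>

lemma square_core:
  assumes P: "triangle_path x a a1 a2 p b b1 b2" and pa: "link p a" shows "link p b"
proof -
  note D = triangle_pathD[OF P]
  note d = D(1)
  have "link x a" using link_iff[OF P] by simp
  then have la: "link a w \<longleftrightarrow> w = x \<or> w = p" for w
    using links_two[OF D(7), of x p w] link_sym pa d by auto
  obtain y where y: "y \<in> {x, a, a1, a2}" "link a1 y" using quad_has_link[OF D(3), of a1] by auto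
  have "y \<noteq> x" "y \<noteq> a" "y \<noteq> a1"
    using link_iff[OF P, of a1] la[of a1] link_sym[OF y(2)] d by (auto simp: link_def)
  then have "link a1 a2" using y by auto
  then obtain F where F: "Q F" "a1 \<in> F" "a2 \<in> F" "F \<noteq> {x, a, a1, a2}"
    using link_other_quad by metis
  have "a1 \<noteq> a2" using d by simp
  then obtain e f where e: "F = {a1, a2, e, f}" "e \<noteq> a1" "e \<noteq> a2"
    using quad_third[OF w4 F(1-3)] by metis
  have eE: "e \<noteq> x" "e \<noteq> a"
    using quad_unique[OF F(1) D(3), of a1 a2 e] F e d by auto
  have ea: "a1 \<sim> e" "a2 \<sim> e" using maximal_clique_adj[OF F(1)] e by auto
  have ab: "x \<sim> p" "a \<sim> p" "x \<sim> b" "a \<sim> b" "p \<sim> b" using maximal_clique_adj[OF D(4)] d by auto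
  have "e \<in> V" using ea adj_in_V by blast
  have "e \<sim> p" by (rule adj_of_cover[OF D(3) \<open>e \<in> V\<close> D(8)]) (use ea ab in auto)
  moreover have "e \<sim> b" by (rule adj_of_cover[OF D(3) \<open>e \<in> V\<close> D(9)]) (use ea ab in auto)
  ultimately obtain H where H: "Q H" "e \<in> H" "p \<in> H" "b \<in> H"
    using triangle_in_maximal_clique ab(5) by metis
  have "e \<notin> {x, a, p, b}" using eE \<open>e \<sim> p\<close> \<open>e \<sim> b\<close> by auto
  then show "link p b"
    using linkI[OF H(1) D(4), of p b] H d by auto
qed

text \<open>In the clique \<open>{x, a, p, b}\<close> the vertex \<open>p\<close> has a link, and
  not to \<open>x\<close>. By symmetry it goes to \<open>a\<close>, and \<open>square_core\<close>
  adds the one to \<open>b\<close>.\<close>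

lemma square:
  assumes P: "triangle_path x a a1 a2 p b b1 b2"
  shows "link a w \<longleftrightarrow> w = x \<or> w = p" "link b w \<longleftrightarrow> w = x \<or> w = p" "link p w \<longleftrightarrow> w = a \<or> w = b"
proof -
  note D = triangle_pathD[OF P]
  obtain y where y: "y \<in> {x, a, p, b}" "link p y" using quad_has_link[OF D(4), of p] by auto
  have "y \<noteq> x" "y \<noteq> p" using link_iff[OF P, of p] link_sym[OF y(2)] D(1) by (auto simp: link_def)
  then have p: "link p a" "link p b"
    using y square_core[OF P] square_core[OF triangle_path_sym(2)[OF P]] by auto
  have x: "link x a" "link x b" using link_iff[OF P] by simp_all
  show "link a w \<longleftrightarrow> w = x \<or> w = p" "link b w \<longleftrightarrow> w = x \<or> w = p"
    using links_two[OF D(7), of x p w] links_two[OF D(9), of x p w] p x link_sym D(1) by auto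
  show "link p w \<longleftrightarrow> w = a \<or> w = b"
    using links_two[OF D(8), of a b w] p D(1) by auto
qed

lemma block_eq:
  assumes P: "triangle_path x a a1 a2 p b b1 b2"
  shows "block x = {x, a, p, b}" "block a = {x, a, p, b}" "block p = {x, a, p, b}" "block b = {x, a, p, b}"
  by (auto simp: block_def link_iff[OF P] square[OF P])

lemma quad_block: assumes "x \<in> V" shows "Q (block x)"
proof -
  obtain a a1 a2 p b b1 b2 where P: "triangle_path x a a1 a2 p b b1 b2" using all_paths[OF assms] by blast
  show ?thesis using block_eq(1)[OF P] triangle_pathD(4)[OF P] by simp
qed

lemma in_block [simp]: "x \<in> block x"
  by (simp add: block_def)

lemma block_cong: assumes "x \<in> V" "y \<in> block x" shows "block y = block x"
proof -
  obtain a a1 a2 p b b1 b2 where P: "triangle_path x a a1 a2 p b b1 b2" using all_paths[OF assms(1)] by blast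
  show ?thesis using block_eq[OF P] assms(2) by auto
qed

lemma block_subset_V: "x \<in> V \<Longrightarrow> block x \<subseteq> V"
  using maximal_cliqueD(3)[OF quad_block] .

lemma block_eq_iff: "x \<in> V \<Longrightarrow> y \<in> V \<Longrightarrow> y \<in> block x \<longleftrightarrow> block y = block x"
  using block_cong in_block by metis

text \<open>Let \<open>c1\<close>, \<open>c2\<close> complete the second clique on the link from
  \<open>p\<close> to \<open>b\<close>. Covering \<open>{x, a, p, b}\<close> makes
  \<open>{a1, a2, c1, c2}\<close> a maximal clique. The link from \<open>a1\<close> to
  \<open>a2\<close> lies in only one other, \<open>{x, a, a1, a2}\<close>, which contains
  \<open>x\<close> and so is not the block of \<open>a1\<close>. The result is the pattern of
  \<open>Q_graph\<close>: two complementary pairs of one block are joined to two complementary pairs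
  of the next.\<close>

lemma junction:
  assumes P: "triangle_path x a a1 a2 p b b1 b2"
  obtains c1 c2 where "block a1 = {a1, a2, c1, c2}" "block a2 = block a1" "distinct [a1, a2, c1, c2]"
    "a1 \<notin> block x" "\<And>z. z \<in> {x, a} \<Longrightarrow> N z \<inter> block a1 = {a1, a2}"
    "\<And>z. z \<in> {p, b} \<Longrightarrow> N z \<inter> block a1 = {c1, c2}"
proof -
  note D = triangle_pathD[OF P]
  note d = D(1)
  note B = block_eq[OF P]
  obtain y where y: "y \<in> {x, a, a1, a2}" "link a1 y" using quad_has_link[OF D(3), of a1] by auto
  have "y \<noteq> x" "y \<noteq> a" "y \<noteq> a1"
    using link_iff[OF P, of a1] square(1)[OF P, of a1] link_sym[OF y(2)] d by (auto simp: link_def)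
  then have l: "link a1 a2" using y by auto
  have "link p b" using square(3)[OF P] by simp
  then obtain E where E: "Q E" "p \<in> E" "b \<in> E" "E \<noteq> {x, a, p, b}" using link_other_quad by metis
  obtain c1 c2 where c: "E = {p, b, c1, c2}" "c1 \<noteq> p" "c1 \<noteq> b" "c2 \<noteq> p" "c2 \<noteq> b" "c1 \<noteq> c2"
    using quad_third[OF w4 E(1-3)] d by (metis distinct_length_2_or_more)
  have cM: "c1 \<noteq> x" "c1 \<noteq> a" "c2 \<noteq> x" "c2 \<noteq> a"
    using quad_unique[OF E(1) D(4), of p b c1] quad_unique[OF E(1) D(4), of p b c2] E c d by auto
  have pc: "p \<sim> c1" "p \<sim> c2" "b \<sim> c1" "b \<sim> c2" "c1 \<sim> c2" using maximal_clique_adj[OF E(1)] c by auto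
  have xa: "x \<sim> a1" "x \<sim> a2" "a \<sim> a1" "a \<sim> a2" "a1 \<sim> a2" using maximal_clique_adj[OF D(3)] d by auto
  have cV: "c1 \<in> V" "c2 \<in> V" using pc adj_in_V by blast+
  have join: "a1 \<sim> c1" "a1 \<sim> c2" "a2 \<sim> c1" "a2 \<sim> c2"
    by (rule adj_of_cover[OF D(4)]; use D(10,11) cV pc xa in auto)+
  have dist: "distinct [a1, a2, c1, c2]" using join xa pc by auto
  have QB: "Q {a1, a2, c1, c2}"
  proof (rule maximal_cliqueI)
    show "clique G {a1, a2, c1, c2}"
      using join xa pc D(10,11) cV adj_sym by (auto simp: clique_def)
    show "card {a1, a2, c1, c2} = \<omega>" using dist w4 by simp
  qed
  have a1x: "a1 \<notin> block x" using B d by auto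
  have a2B: "a2 \<in> block a1" using l by (simp add: block_def)
  have "block a1 \<noteq> {x, a, a1, a2}"
  proof
    assume "block a1 = {x, a, a1, a2}"
    then have "block x = block a1" using block_cong[OF D(10), of x] by auto
    then show False using a1x by simp
  qed
  moreover have "{a1, a2, c1, c2} \<noteq> {x, a, a1, a2}"
    using cM dist by (auto simp: set_eq_iff)
  ultimately have eq: "block a1 = {a1, a2, c1, c2}"
    using link_two_quads[OF l D(10) _ _ _ D(3) QB quad_block[OF D(10)]] a2B by auto
  have out: "z \<notin> {a1, a2, c1, c2}" if "z \<in> {x, a, p, b}" for z
    using that cM c d by auto
  show thesis
  proof (rule that[OF eq])
    show "block a2 = block a1" using block_cong[OF D(10) a2B] .
    show "distinct [a1, a2, c1, c2]" "a1 \<notin> block x" using dist a1x by auto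
    show "N z \<inter> block a1 = {a1, a2}" if z: "z \<in> {x, a}" for z
    proof -
      have "a1 \<sim> z" "a2 \<sim> z" using z xa adj_sym by auto
      then have "\<not> c1 \<sim> z" "\<not> c2 \<sim> z"
        using quad_absorbs[OF w4 QB, of a1 a2 c1 z] quad_absorbs[OF w4 QB, of a1 a2 c2 z] dist out[of z] z by auto
      then show ?thesis using \<open>a1 \<sim> z\<close> \<open>a2 \<sim> z\<close> unfolding eq by (auto dest: adj_sym)
    qed
    show "N z \<inter> block a1 = {c1, c2}" if z: "z \<in> {p, b}" for z
    proof -
      have "c1 \<sim> z" "c2 \<sim> z" using z pc adj_sym by auto
      then have "\<not> a1 \<sim> z" "\<not> a2 \<sim> z"
        using quad_absorbs[OF w4 QB, of a1 c1 c2 z] quad_absorbs[OF w4 QB, of a2 c1 c2 z] dist out[of z] z by auto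
      then show ?thesis using \<open>c1 \<sim> z\<close> \<open>c2 \<sim> z\<close> unfolding eq by (auto dest: adj_sym)
    qed
  qed
qed

lemma outer_neighbor:
  assumes "x \<sim> y" "y \<notin> block x"
  obtains a y2 p b b1 b2 where "triangle_path x a y y2 p b b1 b2"
proof -
  obtain a a1 a2 p b b1 b2 where P: "triangle_path x a a1 a2 p b b1 b2"
    using all_paths[OF adj_in_V(1)[OF assms(1)]] by blast
  have "y \<in> {a1, a2, b1, b2}"
    using assms triangle_pathD(2)[OF P] block_eq(1)[OF P] in_N[of y x] by auto
  then show thesis
    using that P triangle_path_sym(1)[OF P] triangle_path_sym(2)[OF P]
      triangle_path_sym(1)[OF triangle_path_sym(2)[OF P]] by blast
qed

lemma block_neighbors:
  assumes "x \<sim> y" "y \<notin> block x" "s \<in> block x" "t \<in> block x"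
  shows "card (N s \<inter> block y) = 2"
    "N s \<inter> block y = N t \<inter> block y \<or> (N s \<inter> block y) \<inter> (N t \<inter> block y) = {}"
proof -
  obtain a y2 p b b1 b2 where P: "triangle_path x a y y2 p b b1 b2" using outer_neighbor[OF assms(1,2)] .
  obtain c1 c2 where J: "distinct [y, y2, c1, c2]"
    "\<And>z. z \<in> {x, a} \<Longrightarrow> N z \<inter> block y = {y, y2}" "\<And>z. z \<in> {p, b} \<Longrightarrow> N z \<inter> block y = {c1, c2}"
    using junction[OF P] by metis
  have s: "s \<in> {x, a} \<or> s \<in> {p, b}" and t: "t \<in> {x, a} \<or> t \<in> {p, b}"
    using assms(3,4) block_eq(1)[OF P] by auto
  have "N s \<inter> block y = {y, y2} \<or> N s \<inter> block y = {c1, c2}" "N t \<inter> block y = {y, y2} \<or> N t \<inter> block y = {c1, c2}"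
    using s t J by blast+
  moreover have "card {y, y2} = 2" "card {c1, c2} = 2" "{y, y2} \<inter> {c1, c2} = {}" using J(1) by auto
  ultimately show "card (N s \<inter> block y) = 2"
    "N s \<inter> block y = N t \<inter> block y \<or> (N s \<inter> block y) \<inter> (N t \<inter> block y) = {}"
    by (elim disjE; simp add: Int_commute)+
qed

section \<open>The cyclic arrangement of the blocks\<close>

definition block_adj where
  "block_adj B B' \<longleftrightarrow> B \<noteq> B' \<and> B \<in> block ` V \<and> B' \<in> block ` V \<and> (\<exists>s\<in>B. \<exists>t\<in>B'. s \<sim> t)"

lemma block_adj_sym: "block_adj B B' \<Longrightarrow> block_adj B' B"
  unfolding block_adj_def by (metis adj_sym)

lemma block_adjI: "x \<sim> y \<Longrightarrow> block x \<noteq> block y \<Longrightarrow> block_adj (block x) (block y)"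
  unfolding block_adj_def using adj_in_V[of x y] in_block[of x] in_block[of y] by auto

lemma in_blocks: assumes "B \<in> block ` V" "x \<in> B" shows "block x = B" "x \<in> V"
proof -
  obtain y where y: "y \<in> V" "B = block y" using assms(1) by blast
  show "block x = B" "x \<in> V"
    using block_cong[OF y(1), of x] block_subset_V[OF y(1)] assms(2) y(2) by auto
qed

lemma block_adj_obtain:
  assumes "block_adj B B'" obtains x y where "x \<sim> y" "y \<notin> block x" "B = block x" "B' = block y"
proof -
  obtain x y where xy: "x \<in> B" "y \<in> B'" "x \<sim> y" and B: "B \<in> block ` V" "B' \<in> block ` V" "B \<noteq> B'"
    using assms unfolding block_adj_def by blast
  have e: "block x = B" "block y = B'" "x \<in> V" "y \<in> V"
    using in_blocks[OF B(1) xy(1)] in_blocks[OF B(2) xy(2)] by auto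
  then show thesis using that[of x y] xy B block_eq_iff by metis
qed

lemma block_adj_neighbors:
  assumes "block_adj B B'" "s \<in> B" "t \<in> B"
  shows "card (N s \<inter> B') = 2" "N s \<inter> B' = N t \<inter> B' \<or> (N s \<inter> B') \<inter> (N t \<inter> B') = {}"
proof -
  obtain x y where "x \<sim> y" "y \<notin> block x" "B = block x" "B' = block y" using block_adj_obtain[OF assms(1)] .
  then show "card (N s \<inter> B') = 2" "N s \<inter> B' = N t \<inter> B' \<or> (N s \<inter> B') \<inter> (N t \<inter> B') = {}"
    using block_neighbors[of x y s t] assms by auto
qed

text \<open>The outer neighbors of \<open>x\<close> are the end vertices of its path, and the two at
  one end lie in the same block. The two ends give different blocks because \<open>x\<close> has
  only the neighbors \<open>b1\<close>, \<open>b2\<close> in the block of \<open>b1\<close>.\<close>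

lemma blocks_around:
  assumes P: "triangle_path x a a1 a2 p b b1 b2"
  shows "{B. block_adj (block x) B} = {block a1, block b1}" "block a1 \<noteq> block b1"
proof -
  note D = triangle_pathD[OF P] and P' = triangle_path_sym(2)[OF P]
  obtain c1 c2 :: 'a where J: "block a2 = block a1" "a1 \<notin> block x" "\<And>z. z \<in> {x, a} \<Longrightarrow> N z \<inter> block a1 = {a1, a2}"
    using junction[OF P] by metis
  obtain e1 e2 :: 'a where J': "block b2 = block b1" "b1 \<notin> block x" "\<And>z. z \<in> {x, b} \<Longrightarrow> N z \<inter> block b1 = {b1, b2}"
    using junction[OF P'] by metis
  have adj: "x \<sim> a1" "x \<sim> b1" using D(2) in_N[of a1 x] in_N[of b1 x] by auto
  have "a1 \<in> N x \<inter> block a1" "a1 \<notin> {b1, b2}" using adj D(1) by auto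
  moreover have "N x \<inter> block b1 = {b1, b2}" using J'(3) by blast
  ultimately show "block a1 \<noteq> block b1" by metis
  have "block a1 \<noteq> block x" "block b1 \<noteq> block x" using J J' in_block by metis+
  then have "block_adj (block x) (block a1)" "block_adj (block x) (block b1)"
    using block_adjI[OF adj(1)] block_adjI[OF adj(2)] by auto
  moreover have "B = block a1 \<or> B = block b1" if B: "block_adj (block x) B" for B
  proof -
    have "card (N x \<inter> B) = 2" using block_adj_neighbors(1)[OF B, of x x] by simp
    then obtain y where y: "y \<in> N x \<inter> B" using card_pos_obtain[of "N x \<inter> B"] by auto
    have "block y = B" "B \<noteq> block x" using in_blocks y B unfolding block_adj_def by blast+
    then have "y \<notin> block x" using block_cong[OF D(6), of y] by auto
    then have "y \<in> {a1, a2, b1, b2}" using y D(2) block_eq(1)[OF P] by auto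
    then show ?thesis using \<open>block y = B\<close> J(1) J'(1) by auto
  qed
  ultimately show "{B. block_adj (block x) B} = {block a1, block b1}" by blast
qed

lemma card_block_neighbors: assumes "B \<in> block ` V" shows "card {B'. block_adj B B'} = 2"
proof -
  obtain x where x: "x \<in> V" "B = block x" using assms by blast
  obtain a a1 a2 p b b1 b2 where P: "triangle_path x a a1 a2 p b b1 b2" using all_paths[OF x(1)] by blast
  show ?thesis using blocks_around[OF P] x(2) by simp
qed

lemma card_common_neighbors: assumes "s \<sim> t" shows "card (N s \<inter> N t) \<le> 4"
proof -
  obtain a a1 a2 p b b1 b2 where P: "triangle_path s a a1 a2 p b b1 b2"
    using all_paths[OF adj_in_V(1)[OF assms]] by blast
  have "card {y, z} \<le> 4" "card {y, z, u, v} \<le> 4" for y z u v :: 'a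
    using card_length[of "[y, z]"] card_length[of "[y, z, u, v]"] by simp_all
  moreover have "t \<in> {a, a1, a2, p, b, b1, b2}" using assms triangle_pathD(2)[OF P] in_N[of t s] by blast
  ultimately show ?thesis using triangle_path_common[OF P] by auto
qed

text \<open>Such \<open>s\<close> and \<open>t\<close> would have six common neighbors, two in each
  of \<open>B\<close>, \<open>B'\<close> and \<open>B''\<close>, while adjacent vertices have at
  most four. Hence the two adjacent blocks together distinguish the vertices of
  \<open>B\<close>.\<close>

lemma block_separated:
  assumes B: "block_adj B B'" "block_adj B B''" "B' \<noteq> B''" and st: "s \<in> B" "t \<in> B" "s \<noteq> t"
    and eq: "N s \<inter> B' = N t \<inter> B'" "N s \<inter> B'' = N t \<inter> B''"
  shows False
proof -
  have mem: "B \<in> block ` V" "B' \<in> block ` V" "B'' \<in> block ` V" "B \<noteq> B'" "B \<noteq> B''"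
    using B unfolding block_adj_def by auto
  have QB: "Q B" using mem quad_block by auto
  have disj: "C \<inter> D = {}" if "C \<in> block ` V" "D \<in> block ` V" "C \<noteq> D" for C D
    using in_blocks(1)[OF that(1)] in_blocks(1)[OF that(2)] that(3) by blast
  let ?X = "(B - {s, t}) \<union> ((N s \<inter> B') \<union> (N s \<inter> B''))"
  have fin: "finite (B - {s, t})" "card (B - {s, t}) = 2"
    using maximal_cliqueD(2,4)[OF QB] st w4 by (simp_all add: card_Diff_subset)
  have c: "card (N s \<inter> B') = 2" "card (N s \<inter> B'') = 2"
    using block_adj_neighbors(1)[OF B(1) st(1) st(1)] block_adj_neighbors(1)[OF B(2) st(1) st(1)] by auto
  have "card ((N s \<inter> B') \<union> (N s \<inter> B'')) = 4"
    using disj[OF mem(2,3) B(3)] c by (subst card_Un_disjoint) auto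
  moreover have "(B - {s, t}) \<inter> ((N s \<inter> B') \<union> (N s \<inter> B'')) = {}"
    using disj[OF mem(1,2,4)] disj[OF mem(1,3,5)] by blast
  ultimately have "card ?X = 6" using fin by (subst card_Un_disjoint) auto
  moreover have "?X \<subseteq> N s \<inter> N t"
  proof -
    have "B - {s, t} \<subseteq> N s \<inter> N t"
      using maximal_clique_subset_N[OF QB st(1)] maximal_clique_subset_N[OF QB st(2)] by blast
    then show ?thesis using eq by blast
  qed
  ultimately have "6 \<le> card (N s \<inter> N t)" using card_mono[of "N s \<inter> N t" ?X] by simp
  then show False using card_common_neighbors[OF maximal_clique_adj[OF QB st]] by simp
qed

text \<open>\<open>a1\<close> and \<open>a2\<close> have the same neighbors in the block of
  \<open>x\<close>. If the other two blocks were adjacent, the neighbors of \<open>a1\<close> and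
  \<open>a2\<close> would split the block of \<open>b1\<close>, and one of them would be adjacent to
  \<open>b1\<close>; the path at \<open>x\<close> has no such edge.\<close>

lemma neighbor_blocks_not_adjacent:
  assumes P: "triangle_path x a a1 a2 p b b1 b2"
  shows "\<not> block_adj (block a1) (block b1)"
proof
  assume A: "block_adj (block a1) (block b1)"
  note D = triangle_pathD[OF P]
  obtain c1 c2 where J: "block a1 = {a1, a2, c1, c2}" "block a2 = block a1" "distinct [a1, a2, c1, c2]"
    "a1 \<notin> block x" "\<And>z. z \<in> {x, a} \<Longrightarrow> N z \<inter> block a1 = {a1, a2}"
    "\<And>z. z \<in> {p, b} \<Longrightarrow> N z \<inter> block a1 = {c1, c2}"
    using junction[OF P] by metis
  have xb: "block_adj (block x) (block a1)" "block_adj (block x) (block b1)"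
    using blocks_around[OF P] by auto
  have a: "a1 \<in> block a1" "a2 \<in> block a1" "a1 \<noteq> a2" using J D(1) by auto
  have nbr: "z \<sim> a1 \<longleftrightarrow> z \<sim> a2" if "z \<in> block x" for z
  proof -
    have "N z \<inter> block a1 = {a1, a2} \<or> N z \<inter> block a1 = {c1, c2}" using that block_eq(1)[OF P] J(5,6) by blast
    then show ?thesis
    proof
      assume "N z \<inter> block a1 = {a1, a2}"
      then show ?thesis using in_N[of _ z] by blast
    next
      assume e: "N z \<inter> block a1 = {c1, c2}"
      moreover have "a1 \<notin> {c1, c2}" "a2 \<notin> {c1, c2}" using J(3) by auto
      ultimately have "a1 \<notin> N z" "a2 \<notin> N z" using a(1,2) by blast+
      then show ?thesis by simp
    qed
  qed
  have eq: "N a1 \<inter> block x = N a2 \<inter> block x"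
  proof (rule set_eqI)
    show "z \<in> N a1 \<inter> block x \<longleftrightarrow> z \<in> N a2 \<inter> block x" for z
      using nbr[of z] adj_commute[of z] by auto
  qed
  have "N a1 \<inter> block b1 \<noteq> N a2 \<inter> block b1"
    using block_separated[OF block_adj_sym[OF xb(1)] A _ a eq] xb(2) unfolding block_adj_def by blast
  then have dj: "(N a1 \<inter> block b1) \<inter> (N a2 \<inter> block b1) = {}"
    using block_adj_neighbors(2)[OF A a(1,2)] by blast
  have c: "card (N a1 \<inter> block b1) = 2" "card (N a2 \<inter> block b1) = 2"
    using block_adj_neighbors(1)[OF A] a by auto
  have "b1 \<in> N x" using D(2) by simp
  then have "b1 \<in> V" using N_subset_V by blast
  note Bf = maximal_cliqueD[OF quad_block[OF this]]
  have "card ((N a1 \<inter> block b1) \<union> (N a2 \<inter> block b1)) = 4"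
    using c dj by (subst card_Un_disjoint) auto
  then have "(N a1 \<inter> block b1) \<union> (N a2 \<inter> block b1) = block b1"
    using Bf w4 by (intro card_subset_eq) auto
  then have "b1 \<in> N a1 \<or> b1 \<in> N a2" using in_block by blast
  moreover have "b1 \<in> N x" using D(2) by simp
  ultimately have "b1 \<in> N x \<inter> N a1 \<or> b1 \<in> N x \<inter> N a2" by blast
  then show False using triangle_path_common(4,5)[OF P] D(1) by auto
qed

text \<open>In \<open>Q_graph\<close> the third coordinate of a vertex has to match the second
  coordinate of its neighbor in the next block. Accordingly \<open>fw i v\<close> records which pair
  of the next block \<open>v\<close> is joined to, and \<open>bw i w\<close> in which of these pairs
  \<open>w\<close> lies.\<close>

lemma graph_iso_Q_graph: "\<exists>n\<ge>4. graph_iso G (Q_graph n)"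
proof -
  let ?X = "block ` V"
  have disjB: "B \<inter> B' = {}" if "B \<in> ?X" "B' \<in> ?X" "B \<noteq> B'" for B B'
    using in_blocks(1)[OF that(1)] in_blocks(1)[OF that(2)] that(3) by blast
  have conn: "?X \<subseteq> W"
    if W: "B \<in> W" "B \<in> ?X" and cl: "\<And>C D. C \<in> W \<Longrightarrow> C \<in> ?X \<Longrightarrow> block_adj C D \<Longrightarrow> D \<in> W" for W B
  proof -
    obtain v where v: "v \<in> V" "B = block v" using W by blast
    have "V \<subseteq> {v \<in> V. block v \<in> W}"
    proof (rule connected_closed)
      show "v \<in> {v \<in> V. block v \<in> W}" "v \<in> V" using v W by auto
      fix s t assume s: "s \<in> {v \<in> V. block v \<in> W}" and st: "s \<sim> t"
      have "block t \<in> W"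
        using cl[of "block s" "block t"] block_adjI[OF st] s by (cases "block s = block t") auto
      then show "t \<in> {v \<in> V. block v \<in> W}" using adj_in_V(2)[OF st] by simp
    qed
    then show ?thesis by blast
  qed
  obtain xs where xs: "distinct xs" "set xs = ?X" "3 \<le> length xs"
    and cyc: "\<And>i j. i < length xs \<Longrightarrow> j < length xs \<Longrightarrow>
      block_adj (xs ! i) (xs ! j) \<longleftrightarrow> j = Suc i mod length xs \<or> i = Suc j mod length xs"
  proof (rule connected_two_regular_is_cycle[of ?X block_adj])
    show "finite ?X" by simp
    show "?X \<noteq> {}" using V_nonempty by simp
    show "block_adj C D \<Longrightarrow> block_adj D C" for C D by (rule block_adj_sym)
    show "\<not> block_adj C C" for C by (simp add: block_adj_def)
    show "C \<in> ?X \<Longrightarrow> card {D. block_adj C D} = 2" for C by (rule card_block_neighbors)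
    show "C \<in> ?X \<Longrightarrow> block_adj C D \<Longrightarrow> D \<in> ?X" for C D by (simp add: block_adj_def)
    show "?X \<subseteq> W" if "B \<in> W" "B \<in> ?X"
      "\<And>C D. C \<in> W \<Longrightarrow> C \<in> ?X \<Longrightarrow> block_adj C D \<Longrightarrow> D \<in> W" for W B
      using conn[OF that] .
  qed (rule that)
  define n where "n = length xs"
  have n3: "3 \<le> n" and cyc: "\<And>i j. i < n \<Longrightarrow> j < n \<Longrightarrow>
      block_adj (xs ! i) (xs ! j) \<longleftrightarrow> j = Suc i mod n \<or> i = Suc j mod n"
    using xs(3) cyc by (simp_all add: n_def)
  have inX: "xs ! i \<in> ?X" if "i < n" for i using nth_mem[of i xs] that xs(2) by (simp add: n_def)
  have QX: "Q (xs ! i)" if "i < n" for i using inX[OF that] quad_block by auto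
  have inj: "xs ! i = xs ! j \<longleftrightarrow> i = j" if "i < n" "j < n" for i j
    using that xs(1) by (simp add: n_def nth_eq_iff_index_eq)
  have ex_idx: "\<exists>i<n. xs ! i = B" if "B \<in> ?X" for B
    using that xs(2) by (metis in_set_conv_nth n_def)
  have n4: "4 \<le> n"
  proof (rule ccontr)
    assume "\<not> 4 \<le> n"
    \<comment> \<open>On a cycle of length 3 the two neighbors of a block would be adjacent.\<close>
    then have n: "n = 3" using n3 by simp
    obtain x where x: "x \<in> V" using V_nonempty by blast
    obtain a a1 a2 p b b1 b2 where P: "triangle_path x a a1 a2 p b b1 b2" using all_paths[OF x] by blast
    have A: "block_adj (block x) (block a1)" "block_adj (block x) (block b1)" "block a1 \<noteq> block b1"
      using blocks_around[OF P] by auto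
    then obtain i j where ij: "i < n" "j < n" "xs ! i = block a1" "xs ! j = block b1"
      using ex_idx unfolding block_adj_def by meson
    then have "i \<noteq> j" using A(3) by auto
    moreover have "i = 0 \<or> i = 1 \<or> i = 2" "j = 0 \<or> j = 1 \<or> j = 2" using ij(1,2) n by auto
    ultimately have "j = Suc i mod 3 \<or> i = Suc j mod 3" by auto
    then have "block_adj (block a1) (block b1)" using cyc[OF ij(1,2)] ij n by simp
    then show False using neighbor_blocks_not_adjacent[OF P] by simp
  qed
  have "\<exists>i. i < n \<and> xs ! i = block v" if "v \<in> V" for v using ex_idx that by blast
  then obtain idx where idx: "\<And>v. v \<in> V \<Longrightarrow> idx v < n" "\<And>v. v \<in> V \<Longrightarrow> xs ! idx v = block v" by metis
  have idx_eq: "idx v = i" if "i < n" "v \<in> xs ! i" "v \<in> V" for v i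
    using in_blocks(1)[OF inX[OF that(1)] that(2)] idx[OF that(3)] inj[OF _ that(1)] by metis
  have inV: "v \<in> V" if "i < n" "v \<in> xs ! i" for v i using in_blocks(2)[OF inX[OF that(1)] that(2)] .
  define suc where "suc i = Suc i mod n" for i
  define pre where "pre i = (if i = 0 then n - 1 else i - 1)" for i
  have suc: "suc i < n" "suc i \<noteq> i" "block_adj (xs ! i) (xs ! suc i)" if "i < n" for i
    using that n3 cyc[of i "suc i"] by (auto simp: suc_def mod_Suc)
  have pre: "pre i < n" "suc (pre i) = i" "pre i \<noteq> suc i" if "i < n" for i
    using that n3 by (auto simp: suc_def pre_def mod_Suc)
  text \<open>The vertices of consecutive blocks are joined according to a pair of complementary pairs in
    the second block; \<open>P i\<close> is one of these pairs, chosen arbitrarily.\<close>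
  have "\<exists>s. s \<in> xs ! i" if "i < n" for i
    using inX[OF that] in_block by blast
  then obtain base where base: "\<And>i. i < n \<Longrightarrow> base i \<in> xs ! i" by metis
  define P where "P i = N (base i) \<inter> xs ! suc i" for i
  define fw where "fw i v = (if N v \<inter> xs ! suc i = P i then 0 else 1 :: nat)" for i v
  define bw where "bw i v = (if v \<in> P i then 0 else 1 :: nat)" for i v
  \<comment> \<open>The pair seen by \<open>v\<close> is equal to or disjoint from
    \<open>P i\<close>; disjoint pairs fill the block of size 4, so a single bit describes each
    side.\<close>
  have adj_iff: "v \<sim> w \<longleftrightarrow> fw i v = bw i w" if i: "i < n" and v: "v \<in> xs ! i" and w: "w \<in> xs ! suc i" for i v w
  proof -
    have s: "base i \<in> xs ! i" "P i = N (base i) \<inter> xs ! suc i" using base[OF i] by (simp_all add: P_def)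
    note nb = block_adj_neighbors[OF suc(3)[OF i]]
    show ?thesis
    proof (cases "N v \<inter> xs ! suc i = P i")
      case True
      then have "v \<sim> w \<longleftrightarrow> w \<in> P i" using w in_N[of w v] by blast
      then show ?thesis using True by (simp add: fw_def bw_def)
    next
      case False
      then have d: "(N v \<inter> xs ! suc i) \<inter> P i = {}" using nb(2)[OF v s(1)] s(2) by simp
      have c: "card (N v \<inter> xs ! suc i) = 2" "card (P i) = 2" using nb(1)[OF v v] nb(1)[OF s(1) s(1)] s(2) by auto
      have f: "finite (P i)" "P i \<subseteq> xs ! suc i" using s(2) by auto
      note B = maximal_cliqueD[OF QX[OF suc(1)[OF i]]]
      have "card ((N v \<inter> xs ! suc i) \<union> P i) = 4" using c d f by (subst card_Un_disjoint) auto
      then have "(N v \<inter> xs ! suc i) \<union> P i = xs ! suc i"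
        using B f w4 by (intro card_subset_eq) auto
      then have "v \<sim> w \<longleftrightarrow> w \<notin> P i" using d w in_N[of w v] by blast
      then show ?thesis using False by (simp add: fw_def bw_def)
    qed
  qed
  define f where "f v = (idx v, bw (pre (idx v)) v, fw (idx v) v)" for v
  have inj_f: "u = v" if u: "u \<in> V" and v: "v \<in> V" and eq: "f u = f v" for u v
  proof (rule ccontr)
    assume ne: "u \<noteq> v"
    define i where "i = idx u"
    have i: "i < n" and iv: "idx v = i" and e: "bw (pre i) u = bw (pre i) v" "fw i u = fw i v"
      using eq idx(1)[OF u] by (auto simp: f_def i_def)
    have mem: "u \<in> xs ! i" "v \<in> xs ! i" using idx(2)[OF u] idx(2)[OF v] iv i_def in_block by metis+
    have "u \<sim> w \<longleftrightarrow> v \<sim> w" if "w \<in> xs ! suc i" for w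
      using adj_iff[OF i mem(1) that] adj_iff[OF i mem(2) that] e by simp
    then have 1: "N u \<inter> xs ! suc i = N v \<inter> xs ! suc i" by auto
    have m: "u \<in> xs ! suc (pre i)" "v \<in> xs ! suc (pre i)" using mem pre(2)[OF i] by auto
    have "w \<sim> u \<longleftrightarrow> w \<sim> v" if "w \<in> xs ! pre i" for w
      using adj_iff[OF pre(1)[OF i] that m(1)] adj_iff[OF pre(1)[OF i] that m(2)] e by simp
    then have 2: "N u \<inter> xs ! pre i = N v \<inter> xs ! pre i" using adj_commute by (intro set_eqI) auto
    have "block_adj (xs ! i) (xs ! pre i)"
      using suc(3)[OF pre(1)[OF i]] pre(2)[OF i] block_adj_sym by simp
    moreover have "xs ! pre i \<noteq> xs ! suc i" using inj[OF pre(1)[OF i] suc(1)[OF i]] pre(3)[OF i] by simp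
    ultimately show False using block_separated[OF _ suc(3)[OF i] _ mem ne 2 1] by blast
  qed
  have range: "f v \<in> {..<n} \<times> {..<2} \<times> {..<2}" if "v \<in> V" for v
    using idx(1)[OF that] by (auto simp: f_def fw_def bw_def)
  \<comment> \<open>Surjectivity follows by counting, since both vertex sets have
    \<open>4 * n\<close> elements.\<close>
  have "card V = 4 * n"
  proof -
    have "v \<in> V \<longleftrightarrow> (\<exists>i<n. v \<in> xs ! i)" for v
      using idx[of v] inV[of _ v] in_block[of v] by metis
    then have "V = (\<Union>i\<in>{..<n}. xs ! i)" by (auto simp: set_eq_iff)
    moreover have "card (\<Union>i\<in>{..<n}. xs ! i) = (\<Sum>i\<in>{..<n}. card (xs ! i))"
    proof (rule card_UN_disjoint)
      show "\<forall>i\<in>{..<n}. finite (xs ! i)" using QX maximal_cliqueD(2) by simp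
      show "\<forall>i\<in>{..<n}. \<forall>j\<in>{..<n}. i \<noteq> j \<longrightarrow> xs ! i \<inter> xs ! j = {}"
        using disjB[OF inX inX] inj by simp
    qed simp
    moreover have "card (xs ! i) = 4" if "i \<in> {..<n}" for i
      using maximal_cliqueD(4)[OF QX] that w4 by simp
    ultimately show ?thesis by simp
  qed
  moreover have "card (({..<n} \<times> {..<2} \<times> {..<2}) :: (nat \<times> nat \<times> nat) set) = 4 * n" by simp
  moreover have "card (f ` V) = card V" using inj_f by (intro card_image inj_onI)
  moreover have "f ` V \<subseteq> {..<n} \<times> {..<2} \<times> {..<2}" using range by blast
  ultimately have "f ` V = {..<n} \<times> {..<2} \<times> {..<2}" by (intro card_subset_eq) simp_all
  then have bij: "bij_betw f V (pverts (Q_graph n))"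
    using inj_f by (auto simp: bij_betw_def inj_on_def Q_graph_def Let_def)
  have lt2: "fw i v < 2" "bw i v < 2" for i v by (auto simp: fw_def bw_def)
  have Q_adj: "((i, x, y), (j, x', y')) \<in> parcs (Q_graph n) \<longleftrightarrow>
      j = suc i \<and> y = x' \<or> i = suc j \<and> y' = x \<or> i = j \<and> (x, y) \<noteq> (x', y')"
    if "i < n" "j < n" "x < 2" "y < 2" "x' < 2" "y' < 2" for i j x y x' y'
    using that by (auto simp: Q_graph_def Let_def suc_def)
  have "u \<sim> v \<longleftrightarrow> (f u, f v) \<in> parcs (Q_graph n)" if u: "u \<in> V" and v: "v \<in> V" for u v
  proof -
    define i j where "i = idx u" and "j = idx v"
    have ij: "i < n" "j < n" and mem: "u \<in> xs ! i" "v \<in> xs ! j"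
      using idx[OF u] idx[OF v] in_block i_def j_def by auto
    have Qf: "(f u, f v) \<in> parcs (Q_graph n) \<longleftrightarrow>
        j = suc i \<and> fw i u = bw (pre j) v \<or> i = suc j \<and> fw j v = bw (pre i) u \<or>
        i = j \<and> (bw (pre i) u, fw i u) \<noteq> (bw (pre j) v, fw j v)"
      unfolding f_def i_def[symmetric] j_def[symmetric] by (rule Q_adj) (use ij lt2 in auto)
    have pre_suc: "pre (suc i) = i" "pre (suc j) = j"
      using ij n3 by (auto simp: suc_def pre_def mod_Suc)
    \<comment> \<open>For \<open>3 \<le> n\<close> no block is both successor and predecessor of
      another, so only one of the two matching conditions applies.\<close>
    have no2: "\<not> (j = suc i \<and> i = suc j)"
      using ij n3 by (auto simp: suc_def mod_Suc split: if_splits)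
    consider "i = j" | "j = suc i" "i \<noteq> j" | "i = suc j" "i \<noteq> j" | "i \<noteq> j" "j \<noteq> suc i" "i \<noteq> suc j" by blast
    then show ?thesis
    proof cases
      case 1
      then have "u \<sim> v \<longleftrightarrow> u \<noteq> v" using maximal_clique_adj[OF QX[OF ij(1)], of u v] mem by auto
      also have "\<dots> \<longleftrightarrow> f u \<noteq> f v" using inj_f[OF u v] by auto
      also have "\<dots> \<longleftrightarrow> (bw (pre i) u, fw i u) \<noteq> (bw (pre j) v, fw j v)"
        using 1 by (auto simp: f_def i_def j_def)
      finally show ?thesis using Qf 1 suc(2)[OF ij(1)] by auto
    next
      case 2
      then have "u \<sim> v \<longleftrightarrow> fw i u = bw i v" using adj_iff[OF ij(1) mem(1)] mem(2) by simp
      then show ?thesis using Qf 2 no2 pre_suc by auto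
    next
      case 3
      then have "v \<sim> u \<longleftrightarrow> fw j v = bw j u" using adj_iff[OF ij(2) mem(2)] mem(1) by simp
      then show ?thesis using Qf 3 no2 pre_suc adj_commute[of u v] by auto
    next
      case 4
      then have "\<not> block_adj (xs ! i) (xs ! j)" using cyc[OF ij] by (simp add: suc_def)
      moreover have "xs ! i \<noteq> xs ! j" using inj[OF ij] 4 by simp
      ultimately have "\<not> u \<sim> v" unfolding block_adj_def using inX ij mem by blast
      then show ?thesis using Qf 4 by simp
    qed
  qed
  moreover have "pair_wf_digraph (Q_graph n)"
    using n3 by unfold_locales (auto simp: Q_graph_def Let_def)
  ultimately have "graph_iso G (Q_graph n)" using graph_iso_iff[OF pair_wf] bij by blast
  then show ?thesis using n4 by blast
qed

end

section \<open>The classification\<close>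

lemma maximal_stable_set_complement:
  assumes "pair_graph G"
  shows "maximal_stable_set (graph_complement G) C \<longleftrightarrow> maximal_clique G C"
proof -
  interpret pair_graph G by (rule assms)
  have "stable_set (graph_complement G) D \<longleftrightarrow> clique G D" for D
    unfolding stable_set_def clique_def graph_complement_def by auto
  then show ?thesis by (simp add: maximal_stable_set_def maximal_clique_def)
qed

theorem theorem5p4:
  fixes G :: "'a pair_pre_digraph" and k :: nat
  assumes "pair_graph G"
    and "Digraph_Component.connected (with_proj G)"
    and "regular_graph k G"
    and "irreducible_graph G"
    and "well_covered G"
    and "co_well_covered G"
    and "CIS G"
    and "k \<le> 7"
  shows "(\<exists>n. complete_digraph n (with_proj G))
    \<or> graph_iso G (line_graph (complete_bipartite_graph 3 3))
    \<or> graph_iso G (line_graph (complete_bipartite_graph 4 4))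
    \<or> graph_iso G (lex_product (cycle_graph 4) (complete_graph 2))
    \<or> graph_iso G (lex_product (complete_bipartite_graph 3 3) (complete_graph 2))
    \<or> (\<exists>n\<ge>4. graph_iso G (Q_graph n))"
proof -
  have "\<exists>\<omega>. \<forall>C. maximal_clique G C \<longrightarrow> card C = \<omega>"
    using assms(6) unfolding co_well_covered_def well_covered_def maximal_stable_set_complement[OF assms(1)]
    by metis
  then obtain \<omega> where \<omega>: "\<And>C. maximal_clique G C \<Longrightarrow> card C = \<omega>" by blast
  interpret uniform_cis_graph G k \<omega>
    by (rule uniform_cis_graph.intro[OF assms(1-4,7) \<omega>])
  show ?thesis
  proof (cases "\<omega> = k + 1")
    case True
    then show ?thesis using complete_if by blast
  next
    case False
    note bounds = omega_bounds[OF False]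
    have two: "\<omega> \<le> 4" if "k = \<omega> + 1" using omega_le_4_if_two[OF that] .
    \<comment> \<open>From \<open>3 \<le> \<omega> < k \<le> 7\<close>; the last case holds the
      pairs (5, 6) and (6, 7), which divisibility excludes.\<close>
    consider "\<omega> = 3" | "\<omega> = 4" "k = 5" | "\<omega> = 4" "k = 6" | "\<omega> = 4" "k = 7"
      | "\<omega> = 5" "k = 7" | "k = \<omega> + 1" "5 \<le> \<omega>"
      using bounds assms(8) by linarith
    then show ?thesis
    proof cases
      case 1
      then have "k = 4" using valency_of_omega_3[OF 1 False] by simp
      \<comment> \<open>For \<open>\<omega> = 3\<close> the general bound
        \<open>\<omega> - 2\<close> on intersections is already the 1 that the grid
        requires.\<close>
      then have "graph_iso G (line_graph (complete_bipartite_graph \<omega> \<omega>))"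
        using 1 card_Int_maximal_cliques by (intro graph_iso_grid) fastforce+
      then show ?thesis using 1 by simp
    next
      case 2
      then show ?thesis using graph_iso_C4_K2 by blast
    next
      case 3
      then have "graph_iso G (line_graph (complete_bipartite_graph \<omega> \<omega>))"
        using meet_if_omega_4_valency_6 by (intro graph_iso_grid) auto
      then show ?thesis using 3 by simp
    next
      case 4
      interpret uniform_cis_graph_7 G k \<omega> by unfold_locales (use 4 in auto)
      show ?thesis
      proof (cases "\<exists>x c u u' v v' w w'. windmill x c u u' v v' w w'")
        case True
        then show ?thesis using graph_iso_K33_K2 by blast
      next
        case False
        interpret triangle_path_cis_graph G k \<omega>
          by unfold_locales (use local_structure False in blast)
        show ?thesis using graph_iso_Q_graph by blast
      qed
    next
      case 5
      then show ?thesis using not_omega_5_valency_7 by blast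
    next
      case 6
      then show ?thesis using two by simp
    qed
  qed
qed

end
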